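(* Let $1<j<N$ and assume $$I'(V)=\sum_{m=1}^{j}\sum_{\substack{l=j\\ (m,l)\ne (j,j)}}^{N}|\lambda_l-\lambda_m|^{-1}\int_0^\infty |V_{ml}(\tau)|^2\,d\tau<\infty .$$ Then there is an absolute constant $C$ such that for all $t\geq 0$ $$\int_{\mathbb{R}}|x_{jj}(t,k)-\exp(i\lambda_j t k)|^2\,dk\le C\, I'(V).$$ Moreover, there is a function $\tilde{x}_{jj}(\infty,k)$ on $\mathbb{R}$ such that $$\int_{\mathbb{R}}\left|x_{jj}(t,k)\exp(-i\lambda_j t k)-\tilde{x}_{jj}(\infty,k)\right|^2dk\to 0\quad (t\to\infty)$$ and $$\int_{\mathbb{R}}|\tilde{x}_{jj}(\infty,k)-1|^2\,dk\le C\, I'(V).$$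
   Context: Setting: $N\ge 3$, $\Lambda=\mathrm{diag}(\lambda_1,\dots,\lambda_N)$ with real $0=\lambda_1<\lambda_2<\dots<\lambda_N$. $V(t)=(V_{ml}(t))$, $t\ge 0$, is an $N\times N$ Hermitian matrix function with $V_{mm}(t)=0$ for all $m$ and $\|V\|\in L^2_{\rm loc}(\mathbb{R}^+)$. For $k\in\mathbb{R}$, $X(t,k)=(x_{ml}(t,k))$ is the $N\times N$ matrix solution of $X_t=i(k\Lambda+V(t))X$, $X(0,k)=I$. *)

theory Defs
  imports "HOL-Analysis.Analysis"
begin

text \<open>
  The constant in the theorem does not depend on the size \<open>N\<close>, so \<open>N\<close> has to be quantified
  inside the statement and cannot be a type. An \<open>N \<times> N\<close> matrix is therefore a function on pairs
  of indices, of which only the values on \<open>{1..N} \<times> {1..N}\<close> are relevant.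
\<close>

type_synonym cmatrix = "nat \<Rightarrow> nat \<Rightarrow> complex"

definition spectrum_ok :: "nat \<Rightarrow> (nat \<Rightarrow> real) \<Rightarrow> bool" where
  "spectrum_ok N lam \<longleftrightarrow> lam 1 = 0 \<and> strict_mono_on {1..N} lam"

text \<open>
  Frobenius norm. All norms on \<open>N \<times> N\<close> matrices are equivalent, so membership of \<open>\<parallel>V\<parallel>\<close> in
  \<open>L\<^sup>2\<^sub>l\<^sub>o\<^sub>c\<close> does not depend on the choice.
\<close>

definition matrix_norm :: "nat \<Rightarrow> cmatrix \<Rightarrow> real" where
  "matrix_norm N A = L2_set (\<lambda>(m, l). cmod (A m l)) ({1..N} \<times> {1..N})"

definition potential :: "nat \<Rightarrow> (real \<Rightarrow> cmatrix) \<Rightarrow> bool" where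
  "potential N V \<longleftrightarrow>
     (\<forall>m\<in>{1..N}. \<forall>l\<in>{1..N}. set_borel_measurable lebesgue {0..} (\<lambda>t. V t m l)) \<and>
     (\<forall>t\<ge>0. \<forall>m\<in>{1..N}. \<forall>l\<in>{1..N}. V t m l = cnj (V t l m)) \<and>
     (\<forall>t\<ge>0. \<forall>m\<in>{1..N}. V t m m = 0) \<and>
     (\<forall>T\<ge>0. set_integrable lebesgue {0..T} (\<lambda>t. (matrix_norm N (V t))\<^sup>2))"

text \<open>Entry \<open>(m, l)\<close> of \<open>i (k \<Lambda> + V(t)) X\<close>.\<close>

definition ode_rhs ::
  "nat \<Rightarrow> (nat \<Rightarrow> real) \<Rightarrow> (real \<Rightarrow> cmatrix) \<Rightarrow> real \<Rightarrow> real \<Rightarrow> cmatrix \<Rightarrow> cmatrix" where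
  "ode_rhs N lam V k t X m l =
     \<i> * (\<Sum>p\<in>{1..N}. (complex_of_real k * (if m = p then complex_of_real (lam m) else 0) + V t m p)
                     * X p l)"

text \<open>
  As \<open>V\<close> is only locally square integrable, \<open>X\<^sub>t = i (k \<Lambda> + V) X\<close>, \<open>X(0, k) = I\<close> is understood in
  the sense of Caratheodory, i.e. as the integral equation
  \<open>X(t, k) = I + \<integral>\<^sub>0\<^sup>t i (k \<Lambda> + V(s)) X(s, k) ds\<close> with Lebesgue integrals.
  The arguments of \<open>X\<close> are \<open>t\<close>, \<open>k\<close>, row, column.
\<close>

definition fundamental_solution ::
  "nat \<Rightarrow> (nat \<Rightarrow> real) \<Rightarrow> (real \<Rightarrow> cmatrix) \<Rightarrow> (real \<Rightarrow> real \<Rightarrow> cmatrix) \<Rightarrow> bool" where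
  "fundamental_solution N lam V X \<longleftrightarrow>
     (\<forall>k. \<forall>t\<ge>0. \<forall>m\<in>{1..N}. \<forall>l\<in>{1..N}.
        set_integrable lebesgue {0..t} (\<lambda>s. ode_rhs N lam V k s (X s k) m l) \<and>
        X t k m l = (if m = l then 1 else 0) +
          set_lebesgue_integral lebesgue {0..t} (\<lambda>s. ode_rhs N lam V k s (X s k) m l))"

definition I_prime :: "nat \<Rightarrow> (nat \<Rightarrow> real) \<Rightarrow> nat \<Rightarrow> (real \<Rightarrow> cmatrix) \<Rightarrow> ennreal" where
  "I_prime N lam j V =
     (\<Sum>m\<in>{1..j}. \<Sum>l\<in>{l\<in>{j..N}. (m, l) \<noteq> (j, j)}.
        ennreal (inverse \<bar>lam l - lam m\<bar>) *
        (\<integral>\<^sup>+\<tau>\<in>{0..}. ennreal ((cmod (V \<tau> m l))\<^sup>2) \<partial>lebesgue))"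

end

theory Submission
  imports Defs "HOL-Complex_Analysis.Complex_Analysis" "HOL-Real_Asymp.Real_Asymp"
    "Jordan_Normal_Form.Determinant"
begin

text \<open>
  The argument has three ingredients: an \<open>L\<^sup>1\<close> bound for the amplitude of a lowest energy level, the
  observation that leading minors of \<open>X\<close> are such amplitudes, and a quotient formula that recovers
  \<open>x\<^sub>j\<^sub>j\<close> from two consecutive leading minors.

  Consider \<open>\<omega>' = \<i> (z \<mu> + W) \<omega>\<close> with a real diagonal \<open>\<mu> \<ge> 0\<close> and a Hermitian \<open>W\<close>,
  started at a unit vector \<open>\<phi>\<close> in the kernel of \<open>\<mu>\<close>, and let \<open>a(z)\<close> be the inner product of \<open>\<phi>\<close> with
  \<open>\<omega>(t, z)\<close>. The Picard series shows that \<open>a\<close> is entire. Since \<open>|\<omega>|\<^sup>2\<close> has derivative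
  \<open>- 2 Im z \<Sum> \<mu> |\<omega>|\<^sup>2\<close>, on the closed upper half plane \<open>|a| \<le> 1\<close>. On the imaginary axis the same
  identity pays for the time integral of \<open>\<mu> |\<omega>|\<^sup>2\<close>, and this gives \<open>y |1 - a(\<i> y)| \<le> A\<close>, where \<open>A\<close> is
  the sum of \<open>\<mu>\<^sup>-\<^sup>1\<close> times the squared \<open>L\<^sup>2\<close> norms of the couplings out of \<open>\<phi>\<close> (\<open>action_bound\<close>). The
  Poisson formula, with \<open>y\<close> sent to infinity, turns this into \<open>\<integral> (1 - Re a(k)) dk \<le> \<pi> A\<close>
  (\<open>contraction_L1_bound\<close>). Because \<open>|1 - a|\<^sup>2\<close> and \<open>1 - |a|\<^sup>2\<close> are both at most \<open>2 (1 - Re a)\<close>, this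
  is an \<open>L\<^sup>2\<close> bound for \<open>1 - a\<close> and at the same time an \<open>L\<^sup>1\<close> bound for the mass that has left \<open>\<phi>\<close>.

  A level strictly between the lowest and the highest one is not extremal, but the
  first \<open>n\<close> levels together are the ground state of \<open>n\<close> fermions: the \<open>n \<times> n\<close> minors of the first \<open>n\<close>
  columns of \<open>X\<close> satisfy a system of the above kind, in which \<open>\<mu>\<close> is the excess over the ground
  energy \<open>\<lambda>\<^sub>1 + \<dots> + \<lambda>\<^sub>n\<close>. The potential couples the ground state only to the states in which one
  level \<open>m \<le> n\<close> is replaced by one level \<open>l > n\<close>, and the excess of this state is \<open>\<lambda>\<^sub>l - \<lambda>\<^sub>m\<close>. Hence the
  leading minor \<open>\<Delta>\<^sub>n\<close>, up to a phase, obeys the bound with \<open>A\<close> the sum of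
  \<open>|V\<^sub>m\<^sub>l|\<^sup>2 / (\<lambda>\<^sub>l - \<lambda>\<^sub>m)\<close> over these pairs (\<open>lead_L1_bound\<close>). For \<open>n = j - 1\<close> and \<open>n = j\<close> all these terms
  occur in the hypothesis of the theorem.

  For real \<open>k\<close> the matrix \<open>X\<close> is unitary. Laplace expansion of \<open>\<Delta>\<^sub>j\<close> along its last column
  and the Cauchy--Binet formula show that \<open>\<Delta>\<^sub>j - x\<^sub>j\<^sub>j \<Delta>\<^sub>j\<^sub>-\<^sub>1\<close> is controlled by the defects
  \<open>1 - |x\<^sub>j\<^sub>j|\<^sup>2\<close> and \<open>1 - |\<Delta>\<^sub>j\<^sub>-\<^sub>1|\<^sup>2\<close> (\<open>minor_expansion\<close>). Therefore both \<open>|x\<^sub>j\<^sub>j - 1|\<^sup>2\<close>, with the phases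
  removed, and \<open>1 - |x\<^sub>j\<^sub>j|\<^sup>2\<close> are at most a constant times the two \<open>L\<^sup>1\<close> controlled quantities
  (\<open>quotient_of_near_units\<close>).

  The propagator from time \<open>T\<close> to time \<open>t\<close> is again a fundamental solution, for the
  potential shifted by \<open>T\<close>. Applied to it, the bounds say that the entry, with its phase removed,
  changes between \<open>T\<close> and \<open>t\<close> by at most a constant times the tail of the action in \<open>L\<^sup>2\<close>
  (\<open>diag_increment\<close>); the bound for \<open>1 - |x\<^sub>j\<^sub>j|\<^sup>2\<close> is what makes the contribution of the other
  entries small. The family is Cauchy, and the limit inherits the bound by Fatou's lemma.
\<close>


section \<open>Primitives of locally integrable functions\<close>

abbreviation (input) integrable_to :: "real \<Rightarrow> (real \<Rightarrow> 'a::{banach,second_countable_topology}) \<Rightarrow> bool" where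
  "integrable_to t f \<equiv> set_integrable lebesgue {0..t} f"

abbreviation (input) integral_to :: "real \<Rightarrow> (real \<Rightarrow> 'a::{banach,second_countable_topology}) \<Rightarrow> 'a" where
  "integral_to t f \<equiv> set_lebesgue_integral lebesgue {0..t} f"

text \<open>
  The potential is only locally integrable, so differential equations are read as integral equations.
  A pair \<open>(F, f)\<close> in this relation plays the part of a function with its derivative.
\<close>

definition is_primitive :: "(real \<Rightarrow> 'a::{real_normed_field,banach,second_countable_topology}) \<Rightarrow> (real \<Rightarrow> 'a) \<Rightarrow> bool" where
  "is_primitive F f \<longleftrightarrow> (\<forall>t\<ge>0. integrable_to t f \<and>
     F t = F 0 + integral_to t f)"

lemma is_primitiveD:
  assumes "is_primitive F f" "t \<ge> 0"
  shows "integrable_to t f" "F t = F 0 + integral_to t f"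
  using assms unfolding is_primitive_def by blast+

lemma is_primitive_cong:
  assumes "is_primitive F f" "\<And>t. t \<ge> 0 \<Longrightarrow> F t = G t" "\<And>t. t \<ge> 0 \<Longrightarrow> f t = g t"
  shows "is_primitive G g"
  unfolding is_primitive_def
proof (intro allI impI conjI)
  fix t :: real assume t: "t \<ge> 0"
  have "integrable_to t f = integrable_to t g"
    by (rule set_integrable_cong) (use assms(3) in auto)
  with is_primitiveD(1)[OF assms(1) t] show "integrable_to t g" by blast
  have e: "integral_to t f = integral_to t g"
    by (rule set_lebesgue_integral_cong) (use assms(3) in auto)
  have "G t = F t" by (rule assms(2)[OF t, symmetric])
  also have "\<dots> = F 0 + integral_to t f"
    by (rule is_primitiveD(2)[OF assms(1) t])
  also have "\<dots> = G 0 + integral_to t g"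
    by (simp only: assms(2)[OF order_refl] e)
  finally show "G t = G 0 + integral_to t g" .
qed

lemma is_primitive_const: "is_primitive (\<lambda>t. c) (\<lambda>t. 0)"
  by (simp add: is_primitive_def)

lemma is_primitive_add:
  assumes "is_primitive F f" "is_primitive G g"
  shows "is_primitive (\<lambda>t. F t + G t) (\<lambda>t. f t + g t)"
  unfolding is_primitive_def
proof (intro allI impI conjI)
  fix t :: real assume t: "t \<ge> 0"
  note f = is_primitiveD[OF assms(1) t] and g = is_primitiveD[OF assms(2) t]
  show "integrable_to t (\<lambda>t. f t + g t)"
    using f(1) g(1) by (rule set_integral_add)
  show "F t + G t = F 0 + G 0 + integral_to t (\<lambda>t. f t + g t)"
  proof -
    have "F t + G t = (F 0 + integral_to t f) + (G 0 + integral_to t g)"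
      by (intro arg_cong2[where f="(+)"] f(2) g(2))
    then show ?thesis
      by (simp only: set_integral_add(2)[OF f(1) g(1)] ac_simps)
  qed
qed

lemma is_primitive_cmult:
  assumes "is_primitive F f"
  shows "is_primitive (\<lambda>t. c * F t) (\<lambda>t. c * f t)"
  unfolding is_primitive_def
proof (intro allI impI conjI)
  fix t :: real assume t: "t \<ge> 0"
  show "integrable_to t (\<lambda>t. c * f t)"
    using is_primitiveD(1)[OF assms t] by simp
  show "c * F t = c * F 0 + integral_to t (\<lambda>t. c * f t)"
    using is_primitiveD(2)[OF assms t] by (simp add: distrib_left)
qed

lemma is_primitive_sum:
  assumes "finite A" "\<And>a. a \<in> A \<Longrightarrow> is_primitive (F a) (f a)"
  shows "is_primitive (\<lambda>t. \<Sum>a\<in>A. F a t) (\<lambda>t. \<Sum>a\<in>A. f a t)"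
  using assms
proof (induction A rule: finite_induct)
  case empty
  then show ?case by (simp add: is_primitive_const)
next
  case (insert x A)
  then show ?case using is_primitive_add[of "F x" "f x"] by simp
qed

lemma is_primitive_diff:
  assumes "is_primitive F f" "is_primitive G g"
  shows "is_primitive (\<lambda>t. F t - G t) (\<lambda>t. f t - g t)"
  using is_primitive_add[OF assms(1) is_primitive_cmult[OF assms(2), of "-1"]] by simp

lemma set_integral_sum:
  fixes f :: "'i \<Rightarrow> 'a \<Rightarrow> 'b::{banach,second_countable_topology}"
  assumes "\<And>i. i \<in> I \<Longrightarrow> set_integrable M A (f i)"
  shows "set_integrable M A (\<lambda>x. \<Sum>i\<in>I. f i x)"
    and "set_lebesgue_integral M A (\<lambda>x. \<Sum>i\<in>I. f i x) = (\<Sum>i\<in>I. set_lebesgue_integral M A (f i))"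
  using assms unfolding set_integrable_def set_lebesgue_integral_def scaleR_sum_right
  by (auto intro!: Bochner_Integration.integrable_sum Bochner_Integration.integral_sum)

lemma is_primitive_bounded_linear:
  assumes "bounded_linear T" "is_primitive F f"
  shows "is_primitive (\<lambda>t. T (F t)) (\<lambda>t. T (f t))"
  unfolding is_primitive_def
proof (intro allI impI conjI)
  fix t :: real assume t: "t \<ge> 0"
  interpret T: bounded_linear T by fact
  have i: "integrable lebesgue (\<lambda>x. indicator {0..t} x *\<^sub>R f x)"
    using is_primitiveD(1)[OF assms(2) t] by (simp add: set_integrable_def)
  show "integrable_to t (\<lambda>t. T (f t))"
    using integrable_bounded_linear[OF assms(1) i] by (simp add: set_integrable_def T.scaleR)
  show "T (F t) = T (F 0) + integral_to t (\<lambda>t. T (f t))"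
    using integral_bounded_linear[OF assms(1) i] is_primitiveD(2)[OF assms(2) t]
    by (simp add: set_lebesgue_integral_def T.scaleR T.add)
qed

lemma is_primitive_cnj:
  "is_primitive F f \<Longrightarrow> is_primitive (\<lambda>t. cnj (F t)) (\<lambda>t. cnj (f t))"
  by (rule is_primitive_bounded_linear[OF bounded_linear_cnj])

lemma sigma_finite_lebesgue: "sigma_finite_measure (lebesgue :: real measure)"
proof -
  obtain A :: "real set set" where A: "countable A" "A \<subseteq> sets lborel" "\<Union>A = space lborel"
      "\<forall>a\<in>A. emeasure lborel a \<noteq> \<infinity>"
    using lborel.sigma_finite_countable by blast
  show ?thesis
    by (rule sigma_finite_measure.intro, rule exI[of _ A])
       (use A in \<open>auto simp: sets_completionI_sets\<close>)
qed

lemma set_lebesgue_integral_subinterval: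
  fixes f :: "real \<Rightarrow> 'a::{real_normed_field,banach,second_countable_topology}"
  assumes "0 \<le> s" "s \<le> t"
  shows "integral_to s f = (\<integral>x. indicator {..s} x *\<^sub>R (indicator {0..t} x *\<^sub>R f x) \<partial>lebesgue)"
  unfolding set_lebesgue_integral_def using assms
  by (intro Bochner_Integration.integral_cong) (auto simp: indicator_def)

lemma integral_lessThan_eq_atMost:
  fixes f :: "real \<Rightarrow> 'a::{real_normed_field,banach,second_countable_topology}"
  assumes "f \<in> borel_measurable lebesgue"
  shows "(\<integral>x. indicator {..<s} x *\<^sub>R f x \<partial>lebesgue) = (\<integral>x. indicator {..s} x *\<^sub>R f x \<partial>lebesgue)"
proof (rule integral_cong_AE)
  have "AE x in lebesgue. x \<noteq> s"
    by (rule AE_completion) (rule AE_lborel_singleton)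
  then show "AE x in lebesgue. indicator {..<s} x *\<^sub>R f x = indicator {..s} x *\<^sub>R f x"
    by eventually_elim (auto simp: indicator_def)
next
  have b: "(\<lambda>x::real. x) \<in> borel_measurable lebesgue"
    by (rule measurable_completion) simp
  have "(indicator A :: real \<Rightarrow> real) \<in> borel_measurable lebesgue" if "A \<in> sets borel" for A
    using that by (intro borel_measurable_indicator) (simp add: sets_completionI_sets)
  then show "(\<lambda>x. indicat_real {..<s} x *\<^sub>R f x) \<in> borel_measurable lebesgue"
    "(\<lambda>x. indicat_real {..s} x *\<^sub>R f x) \<in> borel_measurable lebesgue"
    using assms by (auto intro!: borel_measurable_scaleR)
qed

text \<open>
  The integral of \<open>f(s) g(u)\<close> over the square \<open>[0, t]\<^sup>2\<close> is computed by Fubini's theorem separately on the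
  triangles \<open>u \<le> s\<close> and \<open>s < u\<close>; on either one the inner integral is an increment of \<open>G\<close> or \<open>F\<close>.
\<close>

lemma is_primitive_mult:
  assumes F: "is_primitive F f" and G: "is_primitive G g"
  shows "is_primitive (\<lambda>t. F t * G t) (\<lambda>t. f t * G t + F t * g t)"
proof -
  interpret P: pair_sigma_finite "lebesgue :: real measure" "lebesgue :: real measure"
    by (simp add: pair_sigma_finite_def sigma_finite_lebesgue)
  have *: "integrable_to t (\<lambda>s. f s * G s)" (is ?A)
     "integrable_to t (\<lambda>s. F s * g s)" (is ?B)
     "F t * G t = F 0 * G 0 + (integral_to t (\<lambda>s. f s * G s)
        + integral_to t (\<lambda>s. F s * g s))" (is ?C) if t: "t \<ge> 0" for t
  proof -
    define f' where "f' = (\<lambda>x. indicator {0..t} x *\<^sub>R f x)"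
    define g' where "g' = (\<lambda>x. indicator {0..t} x *\<^sub>R g x)"
    have f': "integrable lebesgue f'" and g': "integrable lebesgue g'"
      using is_primitiveD(1)[OF F t] is_primitiveD(1)[OF G t] by
          (auto simp: f'_def g'_def set_integrable_def)
    have mf[measurable]: "f' \<in> borel_measurable lebesgue"
        and mg[measurable]: "g' \<in> borel_measurable lebesgue"
      using f' g' by auto
    define h where "h = (\<lambda>p::real\<times>real. f' (fst p) * g' (snd p))"
    have mh: "h \<in> borel_measurable (lebesgue \<Otimes>\<^sub>M lebesgue)"
      unfolding h_def
      by (intro borel_measurable_times measurable_compose[OF measurable_fst mf] measurable_compose[OF measurable_snd mg])
    have h: "integrable (lebesgue \<Otimes>\<^sub>M lebesgue) h"
    proof (rule P.Fubini_integrable[OF mh])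
      have "integrable lebesgue (\<lambda>s. norm (f' s) * (\<integral>u. norm (g' u) \<partial>lebesgue))"
        using f' by (intro integrable_mult_left integrable_norm) auto
      then show "integrable lebesgue (\<lambda>s. \<integral>u. norm (h (s, u)) \<partial>lebesgue)"
        by (simp add: norm_mult h_def)
      show "AE x in lebesgue. integrable lebesgue (\<lambda>y. h (x, y))"
        using g' by (simp add: h_def)
    qed
    have b: "(\<lambda>x::real. x) \<in> borel_measurable lebesgue"
      by (rule measurable_completion) simp
    have [measurable]: "(fst :: real \<times> real \<Rightarrow> real) \<in> borel_measurable (lebesgue \<Otimes>\<^sub>M lebesgue)"
      "(snd :: real \<times> real \<Rightarrow> real) \<in> borel_measurable (lebesgue \<Otimes>\<^sub>M lebesgue)"
      using measurable_compose[OF measurable_fst b] measurable_compose[OF measurable_snd b] by auto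
    define L :: "(real \<times> real) set" where "L = {p \<in> space (lebesgue \<Otimes>\<^sub>M lebesgue). snd p \<le> fst p}"
    define U :: "(real \<times> real) set" where "U = {p \<in> space (lebesgue \<Otimes>\<^sub>M lebesgue). fst p < snd p}"
    have L: "L \<in> sets (lebesgue \<Otimes>\<^sub>M lebesgue)" unfolding L_def by measurable
    have U: "U \<in> sets (lebesgue \<Otimes>\<^sub>M lebesgue)" unfolding U_def by measurable
    have memL: "(s, u) \<in> L \<longleftrightarrow> u \<le> s" and memU: "(s, u) \<in> U \<longleftrightarrow> s < u" for s u
      by (auto simp: L_def U_def space_pair_measure)
    note hL = integrable_mult_indicator[OF L h] and hU = integrable_mult_indicator[OF U h]
    have "(\<integral>s. f' s \<partial>lebesgue) * (\<integral>u. g' u \<partial>lebesgue) = (\<integral>s. \<integral>u. h (s, u) \<partial>lebesgue \<partial>lebesgue)"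
      by (simp add: h_def)
    also have "\<dots> = integral\<^sup>L (lebesgue \<Otimes>\<^sub>M lebesgue) h"
      by (rule P.integral_fst'[OF h])
    also have "\<dots> = integral\<^sup>L (lebesgue \<Otimes>\<^sub>M lebesgue) (\<lambda>p. indicator L p *\<^sub>R h p + indicator U p *\<^sub>R h p)"
      using memL memU by (intro Bochner_Integration.integral_cong) (auto simp: indicator_def)
    also have "\<dots> = integral\<^sup>L (lebesgue \<Otimes>\<^sub>M lebesgue) (\<lambda>p. indicator L p *\<^sub>R h p)
                  + integral\<^sup>L (lebesgue \<Otimes>\<^sub>M lebesgue) (\<lambda>p. indicator U p *\<^sub>R h p)"
      using hL hU by (rule Bochner_Integration.integral_add)
    finally have split: "(\<integral>s. f' s \<partial>lebesgue) * (\<integral>u. g' u \<partial>lebesgue) =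
       integral\<^sup>L (lebesgue \<Otimes>\<^sub>M lebesgue) (\<lambda>p. indicator L p *\<^sub>R h p) +
       integral\<^sup>L (lebesgue \<Otimes>\<^sub>M lebesgue) (\<lambda>p. indicator U p *\<^sub>R h p)" .
    have FG: "(\<integral>s. f' s \<partial>lebesgue) = F t - F 0" "(\<integral>s. g' s \<partial>lebesgue) = G t - G 0"
      using is_primitiveD(2)[OF F t] is_primitiveD(2)[OF G t]
      by (auto simp: f'_def g'_def set_lebesgue_integral_def)
    have Gs: "(\<integral>u. indicator {..s} u *\<^sub>R g' u \<partial>lebesgue) = G s - G 0" if "s \<in> {0..t}" for s
      using that set_lebesgue_integral_subinterval[of s t g] is_primitiveD(2)[OF G, of s] by
          (simp add: g'_def)
    have Fs: "(\<integral>u. indicator {..<s} u *\<^sub>R f' u \<partial>lebesgue) = F s - F 0" if "s \<in> {0..t}" for s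
      using that set_lebesgue_integral_subinterval[of s t f] is_primitiveD(2)[OF F, of s]
        integral_lessThan_eq_atMost[OF mf, of s] by (simp add: f'_def)
    have innerL: "(\<integral>u. indicator L (s, u) *\<^sub>R h (s, u) \<partial>lebesgue) = indicator {0..t} s *\<^sub>R (f s
        * (G s - G 0))" for s
    proof -
      have "(\<integral>u. indicator L (s, u) *\<^sub>R h (s, u) \<partial>lebesgue) = (\<integral>u. f' s * (indicator {..s} u
          *\<^sub>R g' u) \<partial>lebesgue)"
        using memL by (intro Bochner_Integration.integral_cong) (auto simp: indicator_def h_def)
      also have "\<dots> = f' s * (\<integral>u. indicator {..s} u *\<^sub>R g' u \<partial>lebesgue)"
        by (rule integral_mult_right_zero)
      finally show ?thesis using Gs[of s] by (cases "s \<in> {0..t}") (auto simp: f'_def)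
    qed
    have innerU: "(\<integral>s. indicator U (s, u) *\<^sub>R h (s, u) \<partial>lebesgue) = indicator {0..t} u *\<^sub>R ((F u
        - F 0) * g u)" for u
    proof -
      have "(\<integral>s. indicator U (s, u) *\<^sub>R h (s, u) \<partial>lebesgue) = (\<integral>s. (indicator {..<u} s *\<^sub>R f' s)
          * g' u \<partial>lebesgue)"
        using memU by (intro Bochner_Integration.integral_cong) (auto simp: indicator_def h_def)
      also have "\<dots> = (\<integral>s. indicator {..<u} s *\<^sub>R f' s \<partial>lebesgue) * g' u"
        by (rule integral_mult_left_zero)
      finally show ?thesis using Fs[of u] by (cases "u \<in> {0..t}") (auto simp: g'_def)
    qed
    have iL: "integrable_to t (\<lambda>s. f s * (G s - G 0))"
      using P.integrable_fst'[OF hL] by (simp add: innerL set_integrable_def)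
    have iU: "integrable_to t (\<lambda>s. (F s - F 0) * g s)"
      using P.integrable_snd[of "\<lambda>s u. indicator U (s, u) *\<^sub>R h (s, u)"] hU
      by (simp add: innerU set_integrable_def split_beta')
    note fi = is_primitiveD(1)[OF F t] and gi = is_primitiveD(1)[OF G t]
    have cf: "integrable_to t (\<lambda>s. f s * G 0)" and cg: "integrable_to t (\<lambda>s. F 0 * g s)"
      using fi gi by auto
    have eL: "(\<lambda>s. f s * G s) = (\<lambda>s. f s * (G s - G 0) + f s * G 0)"
      and eU: "(\<lambda>s. F s * g s) = (\<lambda>s. (F s - F 0) * g s + F 0 * g s)"
      by (auto simp: algebra_simps)
    show ?A unfolding eL using iL cf by (rule set_integral_add)
    show ?B unfolding eU using iU cg by (rule set_integral_add)
    have 1: "integral_to t (\<lambda>s. f s * G s) =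
      integral\<^sup>L (lebesgue \<Otimes>\<^sub>M lebesgue) (\<lambda>p. indicator L p *\<^sub>R h p) + (F t - F 0) * G 0"
    proof -
      have "integral_to t (\<lambda>s. f s * (G s - G 0)) = integral\<^sup>L (lebesgue \<Otimes>\<^sub>M lebesgue)
          (\<lambda>p. indicator L p *\<^sub>R h p)"
        using P.integral_fst'[OF hL] by (simp add: innerL set_lebesgue_integral_def)
      moreover have "integral_to t (\<lambda>s. f s * G 0) = (F t - F 0) * G 0"
        using is_primitiveD(2)[OF F t] by simp
      ultimately show ?thesis unfolding eL set_integral_add(2)[OF iL cf] by simp
    qed
    have 2: "integral_to t (\<lambda>s. F s * g s) =
      integral\<^sup>L (lebesgue \<Otimes>\<^sub>M lebesgue) (\<lambda>p. indicator U p *\<^sub>R h p) + F 0 * (G t - G 0)"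
    proof -
      have "integral_to t (\<lambda>s. (F s - F 0) * g s) = integral\<^sup>L (lebesgue \<Otimes>\<^sub>M lebesgue)
          (\<lambda>p. indicator U p *\<^sub>R h p)"
        using P.integral_snd[of "\<lambda>s u. indicator U (s, u) *\<^sub>R h (s, u)"] hU
        by (simp add: innerU set_lebesgue_integral_def split_beta')
      moreover have "integral_to t (\<lambda>s. F 0 * g s) = F 0 * (G t - G 0)"
        using is_primitiveD(2)[OF G t] by simp
      ultimately show ?thesis unfolding eU set_integral_add(2)[OF iU cg] by simp
    qed
    show ?C using split unfolding 1 2 FG by (simp add: algebra_simps)
  qed
  show ?thesis unfolding is_primitive_def
  proof (intro allI impI conjI)
    fix t :: real assume t: "t \<ge> 0"
    show "integrable_to t (\<lambda>t. f t * G t + F t * g t)"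
      using *(1)[OF t] *(2)[OF t] by (rule set_integral_add)
    show "F t * G t = F 0 * G 0 + integral_to t (\<lambda>t. f t * G t + F t * g t)"
      unfolding set_integral_add(2)[OF *(1)[OF t] *(2)[OF t]] by (rule *(3)[OF t])
  qed
qed

lemma is_primitive_prod:
  fixes F :: "'i \<Rightarrow> real \<Rightarrow> 'a::{real_normed_field,banach,second_countable_topology}"
  assumes "finite A" "\<And>a. a \<in> A \<Longrightarrow> is_primitive (F a) (f a)"
  shows "is_primitive (\<lambda>t. \<Prod>a\<in>A. F a t) (\<lambda>t. \<Sum>a\<in>A. f a t * (\<Prod>b\<in>A-{a}. F b t))"
  using assms
proof (induction A rule: finite_induct)
  case empty
  then show ?case by (simp add: is_primitive_const)
next
  case (insert x A)
  have "is_primitive (\<lambda>t. F x t * (\<Prod>a\<in>A. F a t))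
      (\<lambda>t. f x t * (\<Prod>a\<in>A. F a t) + F x t * (\<Sum>a\<in>A. f a t * (\<Prod>b\<in>A-{a}. F b t)))"
    using insert by (intro is_primitive_mult) auto
  moreover have "f x t * (\<Prod>a\<in>A. F a t) + F x t * (\<Sum>a\<in>A. f a t * (\<Prod>b\<in>A-{a}. F b t))
     = (\<Sum>a\<in>insert x A. f a t * (\<Prod>b\<in>insert x A-{a}. F b t))" for t
  proof -
    have "F x t * (f a t * (\<Prod>b\<in>A-{a}. F b t)) = f a t * (\<Prod>b\<in>insert x A-{a}. F b t)" if "a \<in> A" for a
    proof -
      have "insert x A - {a} = insert x (A - {a})" using insert that by auto
      then show ?thesis using insert by simp
    qed
    then have "F x t * (\<Sum>a\<in>A. f a t * (\<Prod>b\<in>A-{a}. F b t)) = (\<Sum>a\<in>A. f a t * (\<Prod>b\<in>insert x A-{a}. F b t))"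
      unfolding sum_distrib_left by (rule sum.cong[OF refl])
    then show ?thesis using insert by simp
  qed
  ultimately show ?case using insert by simp
qed

lemma is_primitive_power:
  fixes F :: "real \<Rightarrow> 'a::{real_normed_field,banach,second_countable_topology}"
  assumes "is_primitive F f"
  shows "is_primitive (\<lambda>t. F t ^ Suc n) (\<lambda>t. of_nat (Suc n) * f t * F t ^ n)"
proof (induction n)
  case 0
  then show ?case using assms by simp
next
  case (Suc n)
  show ?case
    by (rule is_primitive_cong[OF is_primitive_mult[OF assms Suc]]) (auto simp: algebra_simps)
qed

lemma is_primitive_integral:
  assumes "\<And>t. t \<ge> 0 \<Longrightarrow> integrable_to t f"
  shows "is_primitive (\<lambda>t. c + integral_to t f) f"
proof -
  have "(\<integral>x. indicator {0..0::real} x *\<^sub>R f x \<partial>lebesgue) = 0"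
  proof (rule integral_eq_zero_AE)
    have "AE x in lebesgue. x \<noteq> (0::real)"
      by (rule AE_completion) (rule AE_lborel_singleton)
    then show "AE x in lebesgue. indicator {0..0::real} x *\<^sub>R f x = 0"
      by eventually_elim (auto simp: indicator_def)
  qed
  then have "integral_to 0 f = 0"
    by (simp only: set_lebesgue_integral_def)
  then show ?thesis using assms by (simp add: is_primitive_def)
qed

lemma is_primitive_continuous:
  fixes F :: "real \<Rightarrow> complex"
  assumes "is_primitive F f"
  shows "continuous_on {0..} F"
proof -
  have c: "continuous_on {0..t} F" if t: "t \<ge> 0" for t
  proof -
    note i = is_primitiveD(1)[OF assms]
    have "continuous_on {0..t} (\<lambda>s. F 0 + integral {0..s} f)"
      using set_lebesgue_integral_eq_integral(1)[OF i[OF t]]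
      by (intro continuous_intros indefinite_integral_continuous_1)
    moreover have "F 0 + integral {0..s} f = F s" if "s \<in> {0..t}" for s
      using is_primitiveD(2)[OF assms, of s] set_lebesgue_integral_eq_integral(2)[OF i[of s]] that by simp
    ultimately show ?thesis by (rule continuous_on_eq)
  qed
  show ?thesis
    unfolding continuous_on_eq_continuous_within
  proof
    fix t :: real assume t: "t \<in> {0..}"
    then have "continuous (at t within {0..t+1}) F"
      using c[of "t+1"] by (simp add: continuous_on_eq_continuous_within)
    moreover have "at t within {0..t+1} = at t within {0..}"
      by (rule at_within_nhd[of _ "{..<t+1}"]) auto
    ultimately show "continuous (at t within {0..}) F" by simp
  qed
qed

lemma set_integrable_mult_continuous:
  fixes F W :: "real \<Rightarrow> complex"
  assumes "continuous_on {0..} F" "integrable_to t W"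
  shows "integrable_to t (\<lambda>s. W s * F s)"
proof -
  have c: "continuous_on {0..t} F" using assms(1) by (rule continuous_on_subset) auto
  then have "compact (F ` {0..t})" by (intro compact_continuous_image) auto
  then obtain B where B: "\<And>s. s \<in> {0..t} \<Longrightarrow> norm (F s) \<le> B"
    by (meson compact_imp_bounded bounded_iff image_eqI)
  have m: "(\<lambda>s. indicator {0..t} s *\<^sub>R F s) \<in> borel_measurable lebesgue"
    using borel_measurable_continuous_on_indicator[OF _ c] by (intro measurable_completion) auto
  have W: "integrable lebesgue (\<lambda>s. indicator {0..t} s *\<^sub>R W s)"
    using assms(2) by (simp add: set_integrable_def)
  have "integrable lebesgue (\<lambda>s. (indicator {0..t} s *\<^sub>R W s) * (indicator {0..t} s *\<^sub>R F s))"
  proof (rule Bochner_Integration.integrable_bound[OF integrable_mult_right[of B, OF integrable_norm[OF W]]])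
    show "AE x in lebesgue. norm ((indicat_real {0..t} x *\<^sub>R W x) * (indicat_real {0..t} x *\<^sub>R F x))
      \<le> norm (B * norm (indicat_real {0..t} x *\<^sub>R W x))"
    proof (rule AE_I2)
      fix x
      have "norm (F x) * norm (W x) \<le> \<bar>B\<bar> * norm (W x)" if "x \<in> {0..t}"
        using B[OF that] by (intro mult_right_mono) auto
      then show "norm ((indicat_real {0..t} x *\<^sub>R W x) * (indicat_real {0..t} x *\<^sub>R F x))
         \<le> norm (B * norm (indicat_real {0..t} x *\<^sub>R W x))"
        by (auto simp: indicator_def norm_mult abs_mult mult.commute)
    qed
    show "(\<lambda>s. (indicator {0..t} s *\<^sub>R W s) * (indicator {0..t} s *\<^sub>R F s)) \<in> borel_measurable lebesgue"
      by (rule borel_measurable_times[OF borel_measurable_integrable[OF W] m])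
  qed
  moreover have "(\<lambda>s. (indicator {0..t} s *\<^sub>R W s) * (indicator {0..t} s *\<^sub>R F s)) =
      (\<lambda>s. indicator {0..t} s *\<^sub>R (W s * F s))"
    by (auto simp: indicator_def)
  ultimately show ?thesis by (simp add: set_integrable_def)
qed

lemma set_integrable_continuous:
  fixes F :: "real \<Rightarrow> complex"
  assumes "continuous_on {0..} F"
  shows "integrable_to t F"
proof -
  have "set_integrable lborel {0..t} (\<lambda>_. 1::complex)"
    unfolding set_integrable_def by (rule borel_integrable_compact) auto
  then have "integrable_to t (\<lambda>_. 1::complex)"
    unfolding set_integrable_def by (subst integrable_completion) auto
  then show ?thesis
    using set_integrable_mult_continuous[OF assms, of t "\<lambda>_. 1"] by simp
qed

lemma is_primitive_exp: "is_primitive (\<lambda>t. exp (a * of_real t)) (\<lambda>t. a * exp (a * complex_of_real t))"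
  unfolding is_primitive_def
proof (intro allI impI conjI)
  fix t :: real assume t: "t \<ge> 0"
  show i: "integrable_to t (\<lambda>t. a * exp (a * complex_of_real t))"
    by (intro set_integrable_continuous continuous_intros)
  have "((\<lambda>t. a * exp (a * complex_of_real t)) has_integral (exp (a * of_real t) - exp (a
      * of_real 0))) {0..t}"
    using t by (intro fundamental_theorem_of_calculus)
      (auto intro!: derivative_eq_intros has_vector_derivative_real_field simp: algebra_simps)
  from integral_unique[OF this] 
  show "exp (a * of_real t) = exp (a * of_real 0) + integral_to t (\<lambda>t. a * exp (a * complex_of_real t))"
    unfolding set_lebesgue_integral_eq_integral(2)[OF i] by (metis add_diff_cancel_left' diff_add_cancel)
qed

lemma is_primitive_shift:
  fixes F :: "real \<Rightarrow> 'a::{real_normed_field,euclidean_space}"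
  assumes F: "is_primitive F f" and T: "0 \<le> T"
  shows "is_primitive (\<lambda>t. F (T + t)) (\<lambda>s. f (T + s))"
proof -
  have *: "integrable_to t (\<lambda>s. f (T + s)) \<and> F (T + t) = F T + integral_to t (\<lambda>s. f (T + s))"
    if t: "0 \<le> t" for t
  proof -
    define h where "h = (\<lambda>x. indicator {0..T + t} x *\<^sub>R f x)"
    have h: "integrable lebesgue h"
      using is_primitiveD(1)[OF F, of "T + t"] T t by (simp add: h_def set_integrable_def)
    have hs: "integrable lebesgue (\<lambda>s. h (T + 1 * s))"
      using h by (subst lebesgue_integrable_real_affine_iff) auto
    have m: "{..<T} \<in> sets lebesgue" "{..<0::real} \<in> sets lebesgue" "{0::real..} \<in> sets lebesgue"
      by (auto intro: sets_completionI_sets)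
    have i1: "integrable lebesgue (\<lambda>s. indicator {0..} s *\<^sub>R h (T + 1 * s))"
      using m(3) hs by (rule integrable_mult_indicator)
    have i2: "integrable lebesgue (\<lambda>s. indicator {..<0} s *\<^sub>R h (T + 1 * s))"
      using m(2) hs by (rule integrable_mult_indicator)
    have e1: "(\<lambda>s. indicator {0..} s *\<^sub>R h (T + 1 * s)) = (\<lambda>s. indicator {0..t} s *\<^sub>R f (T + s))"
      using T by (auto simp: h_def indicator_def fun_eq_iff)
    have "(\<integral>x. h x \<partial>lebesgue) = (\<integral>s. h (T + 1 * s) \<partial>lebesgue)"
      using lebesgue_integral_real_affine[of 1 h T] by simp
    also have "\<dots> = (\<integral>s. indicator {..<0} s *\<^sub>R h (T + 1 * s) + indicator {0..} s *\<^sub>R h (T + 1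
        * s) \<partial>lebesgue)"
      by (intro Bochner_Integration.integral_cong) (auto simp: indicator_def)
    also have "\<dots> = (\<integral>s. indicator {..<0} s *\<^sub>R h (T + 1 * s) \<partial>lebesgue) + (\<integral>s. indicator {0..} s
        *\<^sub>R h (T + 1 * s) \<partial>lebesgue)"
      by (rule Bochner_Integration.integral_add[OF i2 i1])
    also have "(\<integral>s. indicator {..<0} s *\<^sub>R h (T + 1 * s) \<partial>lebesgue) = (\<integral>x. indicator {..<T} x
        *\<^sub>R h x \<partial>lebesgue)"
    proof -
      have "(\<integral>x. indicator {..<T} x *\<^sub>R h x \<partial>lebesgue) = (\<integral>s. indicator {..<T} (T + 1 * s) *\<^sub>R h (T
          + 1 * s) \<partial>lebesgue)"
        using lebesgue_integral_real_affine[of 1 "\<lambda>x. indicator {..<T} x *\<^sub>R h x" T] by simp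
      also have "\<dots> = (\<integral>s. indicator {..<0} s *\<^sub>R h (T + 1 * s) \<partial>lebesgue)"
        by (intro Bochner_Integration.integral_cong) (auto simp: indicator_def)
      finally show ?thesis by simp
    qed
    also have "\<dots> = integral_to T f"
      using integral_lessThan_eq_atMost[OF borel_measurable_integrable[OF h], of T]
        set_lebesgue_integral_subinterval[of T "T + t" f] T t by (simp add: h_def)
    finally have "integral_to (T + t) f = integral_to T f + integral_to t (\<lambda>s. f (T + s))"
      unfolding e1 by (simp add: set_lebesgue_integral_def h_def)
    moreover have "F (T + t) = F 0 + integral_to (T + t) f"
      using T t by (intro is_primitiveD(2)[OF F]) auto
    ultimately have "F (T + t) = F T + integral_to t (\<lambda>s. f (T + s))"
      using is_primitiveD(2)[OF F T] by simp
    then show ?thesis using i1 unfolding e1 by (simp add: set_integrable_def)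
  qed
  show ?thesis unfolding is_primitive_def
  proof (intro allI impI conjI)
    fix t :: real assume t: "0 \<le> t"
    show "integrable_to t (\<lambda>s. f (T + s))" using *[OF t] by blast
    have "F (T + t) = F T + integral_to t (\<lambda>s. f (T + s))" using *[OF t] by blast
    then show "F (T + t) = F (T + 0) + integral_to t (\<lambda>s. f (T + s))" by (simp only: add_0_right)
  qed
qed

section \<open>Hermitian systems with a spectral parameter\<close>

text \<open>
  Right-hand sides of linear equations commute with linear combinations of the unknown. The shape
  \<open>a (m p + \<Sum> w q)\<close> is that of \<open>\<i> (z \<mu> \<omega> + W \<omega>)\<close>.
\<close>

lemma sum_linear_combination:
  fixes a m :: "'c::comm_ring_1"
  shows "(\<Sum>r\<in>R. y r * (a * (m * p r + (\<Sum>g\<in>G. w g * q g r))))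
    = a * (m * (\<Sum>r\<in>R. y r * p r) + (\<Sum>g\<in>G. w g * (\<Sum>r\<in>R. y r * q g r)))"
proof -
  have "(\<Sum>r\<in>R. y r * (a * (m * p r + (\<Sum>g\<in>G. w g * q g r))))
      = (\<Sum>r\<in>R. a * (m * (y r * p r)) + a * (\<Sum>g\<in>G. w g * (y r * q g r)))"
    by (intro sum.cong refl) (simp add: sum_distrib_left algebra_simps)
  also have "\<dots> = (\<Sum>r\<in>R. a * (m * (y r * p r))) + (\<Sum>r\<in>R. a * (\<Sum>g\<in>G. w g * (y r * q g r)))"
    by (rule sum.distrib)
  also have "(\<Sum>r\<in>R. a * (m * (y r * p r))) = a * (m * (\<Sum>r\<in>R. y r * p r))"
    by (simp add: sum_distrib_left)
  also have "(\<Sum>r\<in>R. a * (\<Sum>g\<in>G. w g * (y r * q g r))) = a * (\<Sum>r\<in>R. \<Sum>g\<in>G. w g * (y r * q g r))"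
    by (rule sum_distrib_left[symmetric])
  also have "(\<Sum>r\<in>R. \<Sum>g\<in>G. w g * (y r * q g r)) = (\<Sum>g\<in>G. \<Sum>r\<in>R. w g * (y r * q g r))"
    by (rule sum.swap)
  also have "\<dots> = (\<Sum>g\<in>G. w g * (\<Sum>r\<in>R. y r * q g r))"
    by (intro sum.cong refl sum_distrib_left[symmetric])
  finally show ?thesis by (simp only: distrib_left)
qed

text \<open>
  The index set is kept abstract because the same system is used for the entries of one column and
  for the minors of several columns.
\<close>

locale hermitian_system =
  fixes F :: "'i set" and mu :: "'i \<Rightarrow> real" and W :: "real \<Rightarrow> 'i \<Rightarrow> 'i \<Rightarrow> complex"
  assumes finite_index: "finite F"
    and mu_nonneg: "f \<in> F \<Longrightarrow> 0 \<le> mu f"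
    and hermitian: "0 \<le> t \<Longrightarrow> f \<in> F \<Longrightarrow> g \<in> F \<Longrightarrow> W t f g = cnj (W t g f)"
    and W_integrable: "0 \<le> t \<Longrightarrow> f \<in> F \<Longrightarrow> g \<in> F \<Longrightarrow> integrable_to t (\<lambda>s. W s f g)"
begin

definition rhs :: "complex \<Rightarrow> real \<Rightarrow> ('i \<Rightarrow> complex) \<Rightarrow> 'i \<Rightarrow> complex" where
  "rhs z s x f = \<i> * (z * mu f * x f + (\<Sum>g\<in>F. W s f g * x g))"

definition solves :: "complex \<Rightarrow> ('i \<Rightarrow> complex) \<Rightarrow> (real \<Rightarrow> 'i \<Rightarrow> complex) \<Rightarrow> bool" where
  "solves z \<phi> x \<longleftrightarrow> (\<forall>f\<in>F. x 0 f = \<phi> f \<and> is_primitive (\<lambda>t. x t f) (\<lambda>s. rhs z s (x s) f))"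

lemma rhs_diff: "rhs z s (\<lambda>f. x f - y f) f = rhs z s x f - rhs z s y f"
  by (simp add: rhs_def algebra_simps sum_subtractf)

text \<open>
  The Hermitian part \<open>W\<close> cancels. What remains is the damping by \<open>Im z\<close>, with the sign that makes the
  upper half plane contractive.
\<close>

lemma energy_density:
  assumes "0 \<le> s"
  shows "(\<Sum>f\<in>F. rhs z s x f * cnj (x f) + x f * cnj (rhs z s x f))
    = complex_of_real (- 2 * Im z * (\<Sum>f\<in>F. mu f * (cmod (x f))\<^sup>2))"
proof -
  define S where "S = (\<Sum>f\<in>F. \<Sum>g\<in>F. W s f g * x g * cnj (x f))"
  have "cnj S = (\<Sum>f\<in>F. \<Sum>g\<in>F. W s g f * cnj (x g) * x f)"
    unfolding S_def cnj_sum complex_cnj_mult complex_cnj_cnj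
    by (intro sum.cong refl) (metis hermitian[OF assms])
  also have "\<dots> = S"
    unfolding S_def by (subst sum.swap) (simp add: mult_ac)
  finally have "Im S = 0" by (metis Reals_cnj_iff complex_is_Real_iff)
  have sq: "(complex_of_real (cmod w))\<^sup>2 = w * cnj w" for w
    by (metis complex_norm_square of_real_power)
  have "(\<Sum>f\<in>F. rhs z s x f * cnj (x f)) = \<i> * (z * (\<Sum>f\<in>F. of_real (mu f * (cmod (x f))\<^sup>2)) + S)"
    by (simp add: rhs_def S_def sum_distrib_left sum_distrib_right sum.distrib algebra_simps sq)
  also have "\<dots> = \<i> * (z * of_real (\<Sum>f\<in>F. mu f * (cmod (x f))\<^sup>2) + S)"
    by simp
  finally have 1: "Re (\<Sum>f\<in>F. rhs z s x f * cnj (x f)) = - Im z * (\<Sum>f\<in>F. mu f * (cmod (x f))\<^sup>2)"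
    using \<open>Im S = 0\<close> by simp
  have "(\<Sum>f\<in>F. rhs z s x f * cnj (x f) + x f * cnj (rhs z s x f))
     = (\<Sum>f\<in>F. rhs z s x f * cnj (x f)) + cnj (\<Sum>f\<in>F. rhs z s x f * cnj (x f))"
    by (simp add: sum.distrib mult.commute)
  also have "\<dots> = of_real (2 * Re (\<Sum>f\<in>F. rhs z s x f * cnj (x f)))"
    by (rule complex_add_cnj)
  finally show ?thesis unfolding 1 by simp
qed

lemma energy_identity:
  assumes "solves z \<phi> x"
  shows "is_primitive (\<lambda>t. \<Sum>f\<in>F. (cmod (x t f))\<^sup>2) (\<lambda>s. - 2 * Im z * (\<Sum>f\<in>F. mu f * (cmod (x s f))\<^sup>2))"
proof -
  have "is_primitive (\<lambda>t. \<Sum>f\<in>F. x t f * cnj (x t f))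
     (\<lambda>s. \<Sum>f\<in>F. rhs z s (x s) f * cnj (x s f) + x s f * cnj (rhs z s (x s) f))"
    using assms unfolding solves_def
    by (intro is_primitive_sum finite_index is_primitive_mult is_primitive_cnj) auto
  from is_primitive_bounded_linear[OF bounded_linear_Re this]
  show ?thesis
    by (rule is_primitive_cong)
        (simp_all only: energy_density Re_complex_of_real, simp add: complex_norm_square[symmetric])
qed

lemma energy_conserved:
  assumes "solves (of_real k) \<phi> x" "0 \<le> t"
  shows "(\<Sum>f\<in>F. (cmod (x t f))\<^sup>2) = (\<Sum>f\<in>F. (cmod (\<phi> f))\<^sup>2)"
proof -
  have "(\<Sum>f\<in>F. (cmod (x t f))\<^sup>2) = (\<Sum>f\<in>F. (cmod (x 0 f))\<^sup>2)"
    using is_primitiveD(2)[OF energy_identity[OF assms(1)] assms(2)] by simp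
  also have "\<dots> = (\<Sum>f\<in>F. (cmod (\<phi> f))\<^sup>2)"
    using assms(1) by (intro sum.cong) (auto simp: solves_def)
  finally show ?thesis .
qed

text \<open>
  For real parameters the norm is conserved, so the difference of two solutions stays zero. This
  identifies the given matrix with the one constructed below, for which analyticity is known.
\<close>

lemma solution_unique:
  assumes "solves (of_real k) \<phi> x" "solves (of_real k) \<phi> y" "0 \<le> t" "f \<in> F"
  shows "x t f = y t f"
proof -
  have "solves (of_real k) (\<lambda>_. 0) (\<lambda>t f. x t f - y t f)"
    using assms(1,2) unfolding solves_def rhs_diff by (auto intro: is_primitive_diff)
  from energy_conserved[OF this assms(3)]
  have "(\<Sum>f\<in>F. (cmod (x t f - y t f))\<^sup>2) = 0" by simp
  then have "(cmod (x t f - y t f))\<^sup>2 = 0"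
    using assms(4) finite_index by (subst (asm) sum_nonneg_eq_0_iff) auto
  then show ?thesis by simp
qed

text \<open>
  The increments of the Picard iteration; the solution is their sum.
\<close>

primrec picard :: "('i \<Rightarrow> complex) \<Rightarrow> complex \<Rightarrow> nat \<Rightarrow> real \<Rightarrow> 'i \<Rightarrow> complex" where
  "picard \<phi> z 0 = (\<lambda>t f. \<phi> f)"
| "picard \<phi> z (Suc n) = (\<lambda>t f. integral_to t (\<lambda>s. rhs z s (picard \<phi> z n s) f))"

lemma rhs_integrable:
  assumes "\<And>f. f \<in> F \<Longrightarrow> continuous_on {0..} (\<lambda>s. x s f)" "f \<in> F" "0 \<le> t"
  shows "integrable_to t (\<lambda>s. rhs z s (x s) f)"
proof -
  have "integrable_to t (\<lambda>s. \<Sum>g\<in>F. W s f g * x s g)"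
    using assms W_integrable by (intro set_integral_sum set_integrable_mult_continuous) auto
  moreover have "integrable_to t (\<lambda>s. z * mu f * x s f)"
    using assms by (intro set_integrable_continuous continuous_intros) auto
  ultimately have "integrable_to t (\<lambda>s. z * mu f * x s f + (\<Sum>g\<in>F. W s f g * x s g))"
    by (rule set_integral_add(1)[rotated])
  then show ?thesis unfolding rhs_def by simp
qed

lemma picard_continuous: "f \<in> F \<Longrightarrow> continuous_on {0..} (\<lambda>t. picard \<phi> z n t f)"
proof (induction n arbitrary: f)
  case (Suc n)
  have "is_primitive (\<lambda>t. 0 + integral_to t (\<lambda>s. rhs z s (picard \<phi> z n s) f))
     (\<lambda>s. rhs z s (picard \<phi> z n s) f)"
    using Suc by (intro is_primitive_integral rhs_integrable)
  from is_primitive_continuous[OF this] show ?case by simp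
qed simp

text \<open>
  Analyticity in the parameter needs no differentiation under the integral sign: each increment is a
  polynomial in \<open>z\<close> whose coefficients are continuous in time.
\<close>

lemma picard_polynomial:
  assumes "f \<in> F"
  shows "\<exists>c. (\<forall>r. continuous_on {0..} (c r)) \<and> (\<forall>z. \<forall>t\<ge>0. picard \<phi> z n t f = (\<Sum>r\<le>n. c r t * z ^ r))"
  using assms
proof (induction n arbitrary: f)
  case 0
  show ?case by (intro exI[of _ "\<lambda>_ _. \<phi> f"]) auto
next
  case (Suc n)
  obtain c where c: "\<And>f r. f \<in> F \<Longrightarrow> continuous_on {0..} (c f r)"
      "\<And>f z t. f \<in> F \<Longrightarrow> 0 \<le> t \<Longrightarrow> picard \<phi> z n t f = (\<Sum>r\<le>n. c f r t * z ^ r)"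
    using Suc.IH by metis
  define d where "d = (\<lambda>r s. \<i> * (of_real (mu f) * (if r = 0 then 0 else c f (r - 1) s)
      + (\<Sum>g\<in>F. W s f g * (if r \<le> n then c g r s else 0))))"
  have d_int: "integrable_to t (d r)" if "0 \<le> t" for r t
  proof -
    have "continuous_on {0..} (\<lambda>s. if r \<le> n then c g r s else 0)" if "g \<in> F" for g
      using c(1)[OF that] by (cases "r \<le> n") auto
    then
    have "integrable_to t (\<lambda>s. \<Sum>g\<in>F. W s f g * (if r \<le> n then c g r s else 0))"
      using Suc.prems W_integrable that
      by (intro set_integral_sum set_integrable_mult_continuous) auto
    moreover have "integrable_to t (\<lambda>s. of_real (mu f) * (if r = 0 then 0 else c f (r - 1) s))"
      using c(1) Suc.prems by (cases "r = 0") (auto intro!: set_integrable_continuous continuous_intros)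
    ultimately have "integrable_to t (\<lambda>s. of_real (mu f) * (if r = 0 then 0 else c f (r - 1) s)
        + (\<Sum>g\<in>F. W s f g * (if r \<le> n then c g r s else 0)))"
      by (rule set_integral_add(1)[rotated])
    then show ?thesis unfolding d_def by (rule set_integrable_mult_right)
  qed
  have eq: "rhs z s (picard \<phi> z n s) f = (\<Sum>r\<le>Suc n. d r s * z ^ r)" if "0 \<le> s" for s z
  proof -
    have 1: "(\<Sum>r\<le>Suc n. z ^ r * (if r = 0 then 0 else c f (r - 1) s)) = z * (\<Sum>r\<le>n. c f r s * z ^ r)"
      by (subst sum.atMost_Suc_shift) (simp add: sum_distrib_left algebra_simps)
    have 2: "(\<Sum>r\<le>Suc n. z ^ r * (if r \<le> n then c g r s else 0)) = (\<Sum>r\<le>n. c g r s * z ^ r)" for g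
      by (simp add: mult.commute)
    have "(\<Sum>r\<le>Suc n. d r s * z ^ r) = (\<Sum>r\<le>Suc n. z ^ r * d r s)"
      by (simp only: mult.commute)
    also have "\<dots> = \<i> * (of_real (mu f) * (\<Sum>r\<le>Suc n. z ^ r * (if r = 0 then 0 else c f (r - 1) s))
       + (\<Sum>g\<in>F. W s f g * (\<Sum>r\<le>Suc n. z ^ r * (if r \<le> n then c g r s else 0))))"
      unfolding d_def by (rule sum_linear_combination)
    also have "\<dots> = rhs z s (picard \<phi> z n s) f"
      unfolding 1 2 rhs_def using c(2)[OF _ that] Suc.prems by (simp cong: sum.cong)
    finally show ?thesis by simp
  qed
  define e where "e = (\<lambda>r t. 0 + integral_to t (d r))"
  show ?case
  proof (intro exI[of _ e] conjI allI impI)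
    show "continuous_on {0..} (e r)" for r
      unfolding e_def by (rule is_primitive_continuous[OF is_primitive_integral]) (rule d_int)
    fix z and t :: real assume t: "t \<ge> 0"
    have "picard \<phi> z (Suc n) t f = integral_to t (\<lambda>s. \<Sum>r\<le>Suc n. d r s * z ^ r)"
      unfolding picard.simps by (rule set_lebesgue_integral_cong) (use eq in auto)
    also have "\<dots> = (\<Sum>r\<le>Suc n. integral_to t (\<lambda>s. d r s * z ^ r))"
      by (rule set_integral_sum(2)) (auto intro!: set_integrable_mult_left d_int t)
    also have "\<dots> = (\<Sum>r\<le>Suc n. e r t * z ^ r)"
      by (intro sum.cong refl) (simp add: e_def)
    finally show "picard \<phi> z (Suc n) t f = (\<Sum>r\<le>Suc n. e r t * z ^ r)" .
  qed
qed

lemma picard_holomorphic: "f \<in> F \<Longrightarrow> 0 \<le> t \<Longrightarrow> (\<lambda>z. picard \<phi> z n t f) holomorphic_on UNIV"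
proof -
  assume "f \<in> F" "0 \<le> t"
  then obtain c where "\<And>z. picard \<phi> z n t f = (\<Sum>r\<le>n. c r t * z ^ r)"
    using picard_polynomial by metis
  then show ?thesis by (auto intro!: holomorphic_intros)
qed

text \<open>
  A row sum bound for the generator \<open>z \<mu> + W\<close> that is uniform for \<open>|z| \<le> R\<close>.
\<close>

definition generator_bound :: "real \<Rightarrow> real \<Rightarrow> real" where
  "generator_bound R s = R * (\<Sum>f\<in>F. mu f) + (\<Sum>f\<in>F. \<Sum>g\<in>F. cmod (W s f g))"

definition generator_bound_int :: "real \<Rightarrow> real \<Rightarrow> real" where
  "generator_bound_int R t = 0 + integral_to t (generator_bound R)"

lemma generator_bound_int_primitive: "is_primitive (generator_bound_int R) (generator_bound R)"
  unfolding generator_bound_int_def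
proof (rule is_primitive_integral)
  fix t :: real assume t: "0 \<le> t"
  have "integrable_to t (\<lambda>s. \<Sum>f\<in>F. \<Sum>g\<in>F. cmod (W s f g))"
    using W_integrable[OF t] by (intro set_integral_sum set_integrable_norm)
  moreover have "integrable_to t (\<lambda>s. R * (\<Sum>f\<in>F. mu f))"
    unfolding set_integrable_def
    by (intro integrable_scaleR_left integrable_real_indicator) (auto simp: emeasure_lborel_Icc_eq)
  ultimately show "integrable_to t (generator_bound R)"
    unfolding generator_bound_def by (rule set_integral_add(1)[rotated])
qed

lemma norm_rhs_le:
  assumes "cmod z \<le> R" "f \<in> F" "\<And>g. g \<in> F \<Longrightarrow> cmod (x g) \<le> M"
  shows "cmod (rhs z s x f) \<le> generator_bound R s * M"
proof -
  have M: "0 \<le> M" using assms(3)[OF assms(2)] norm_ge_zero order_trans by blast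
  have R: "0 \<le> R" using assms(1) norm_ge_zero order_trans by blast
  have "cmod (\<i> * (a + b)) \<le> cmod a + cmod b" for a b
    by (simp add: norm_mult norm_triangle_ineq)
  then have "cmod (rhs z s x f) \<le> cmod (z * mu f * x f) + cmod (\<Sum>g\<in>F. W s f g * x g)"
    unfolding rhs_def .
  also have "cmod (z * mu f * x f) \<le> R * (\<Sum>f\<in>F. mu f) * M"
    unfolding norm_mult using assms R M mu_nonneg finite_index
    by (intro mult_mono) (auto intro!: member_le_sum sum_nonneg mult_nonneg_nonneg)
  also have "cmod (\<Sum>g\<in>F. W s f g * x g) \<le> (\<Sum>g\<in>F. cmod (W s f g) * M)"
    using assms(3) by (intro sum_norm_le) (auto simp: norm_mult intro!: mult_left_mono)
  also have "\<dots> \<le> (\<Sum>f\<in>F. \<Sum>g\<in>F. cmod (W s f g)) * M"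
    unfolding sum_distrib_right[symmetric] using M finite_index assms(2)
    by (intro mult_right_mono member_le_sum[where f="\<lambda>f. \<Sum>g\<in>F. cmod (W s f g)"]) (auto intro: sum_nonneg)
  finally show ?thesis by (simp add: generator_bound_def algebra_simps)
qed

lemma generator_bound_int_power:
  assumes "0 \<le> t"
  shows "integrable_to t (\<lambda>s. generator_bound R s * (B * generator_bound_int R s ^ n / fact n))" (is ?A)
    and "integral_to t (\<lambda>s. generator_bound R s * (B * generator_bound_int R s ^ n / fact n)) = B
        * generator_bound_int R t ^ Suc n / fact (Suc n)" (is ?B)
proof -
  have "is_primitive (\<lambda>t. B / fact (Suc n) * generator_bound_int R t ^ Suc n)
      (\<lambda>t. B / fact (Suc n) * (of_nat (Suc n) * generator_bound R t * generator_bound_int R t ^ n))"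
    by (intro is_primitive_cmult is_primitive_power generator_bound_int_primitive)
  then have p: "is_primitive (\<lambda>t. B / fact (Suc n) * generator_bound_int R t ^ Suc n)
      (\<lambda>s. generator_bound R s * (B * generator_bound_int R s ^ n / fact n))"
    by (rule is_primitive_cong) (simp_all add: fact_Suc field_simps del: of_nat_Suc)
  show ?A by (rule is_primitiveD(1)[OF p assms])
  have "generator_bound_int R 0 = 0"
    using is_primitiveD(2)[OF generator_bound_int_primitive, of 0 R] by (simp add: generator_bound_int_def)
  then show ?B using is_primitiveD(2)[OF p assms] by simp
qed

abbreviation (input) majorant :: "('i \<Rightarrow> complex) \<Rightarrow> real \<Rightarrow> nat \<Rightarrow> real \<Rightarrow> real" where
  "majorant \<phi> R n t \<equiv> (\<Sum>f\<in>F. cmod (\<phi> f)) * generator_bound_int R t ^ n / fact n"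

text \<open>
  Induction with \<open>(G\<^sup>n\<^sup>+\<^sup>1 / (n + 1)!)' = g G\<^sup>n / n!\<close>, where \<open>G\<close> is the primitive of the bound \<open>g\<close> for the
  generator. The second estimate justifies integrating the series term by term.
\<close>

lemma picard_bound:
  assumes "cmod z \<le> R" "0 \<le> t" "f \<in> F"
  shows "cmod (picard \<phi> z n t f) \<le> majorant \<phi> R n t"
    and "integral_to t (\<lambda>s. cmod (rhs z s (picard \<phi> z n s) f)) \<le> majorant \<phi> R (Suc n) t"
proof -
  have step: "integral_to t (\<lambda>s. cmod (rhs z s (picard \<phi> z n s) f)) \<le> majorant \<phi> R (Suc n) t"
    if "\<And>s f. 0 \<le> s \<Longrightarrow> f \<in> F \<Longrightarrow> cmod (picard \<phi> z n s f) \<le> majorant \<phi> R n s" "0 \<le> t" "f \<in> F" for n t f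
    unfolding generator_bound_int_power(2)[OF that(2), symmetric]
  proof (rule set_integral_mono)
    show "integrable_to t (\<lambda>s. cmod (rhs z s (picard \<phi> z n s) f))"
      using that by (intro set_integrable_norm rhs_integrable picard_continuous)
    show "integrable_to t (\<lambda>s. generator_bound R s * (majorant \<phi> R n s))"
      by (rule generator_bound_int_power(1)[OF that(2)])
    show "cmod (rhs z s (picard \<phi> z n s) f) \<le> generator_bound R s * (majorant \<phi> R n s)"
      if "s \<in> {0..t}" for s
      using that \<open>f \<in> F\<close> assms(1) by (intro norm_rhs_le) (auto intro!: \<open>\<And>s f. 0 \<le> s \<Longrightarrow> f \<in> F \<Longrightarrow> _\<close>)
  qed
  have bound: "cmod (picard \<phi> z n t f) \<le> majorant \<phi> R n t"
    if "0 \<le> t" "f \<in> F" for n t f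
    using that
  proof (induction n arbitrary: t f)
    case 0
    then show ?case using finite_index by (auto intro: member_le_sum)
  next
    case (Suc n)
    have "cmod (picard \<phi> z (Suc n) t f) \<le> integral_to t (\<lambda>s. cmod (rhs z s (picard \<phi> z n s) f))"
      unfolding picard.simps using Suc.prems
      by (intro set_integral_norm_bound rhs_integrable picard_continuous)
    also have "\<dots> \<le> majorant \<phi> R (Suc n) t"
      using Suc by (intro step) auto
    finally show ?case .
  qed
  show "cmod (picard \<phi> z n t f) \<le> majorant \<phi> R n t"
    by (rule bound[OF assms(2,3)])
  show "integral_to t (\<lambda>s. cmod (rhs z s (picard \<phi> z n s) f)) \<le> majorant \<phi> R (Suc n) t"
    by (rule step[OF bound assms(2,3)])
qed

lemma summable_exp_series: "summable (\<lambda>n. B * (x::real) ^ n / fact n)"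
  using summable_mult[OF summable_exp[of x], of B] by (simp add: field_simps)

definition solution :: "('i \<Rightarrow> complex) \<Rightarrow> complex \<Rightarrow> real \<Rightarrow> 'i \<Rightarrow> complex" where
  "solution \<phi> z t f = (\<Sum>n. picard \<phi> z n t f)"

lemma picard_summable:
  assumes "0 \<le> t" "f \<in> F"
  shows "summable (\<lambda>n. cmod (picard \<phi> z n t f))"
  by (rule summable_comparison_test'[OF summable_exp_series[of "\<Sum>f\<in>F. cmod (\<phi> f)" "generator_bound_int (cmod z) t"], of 0])
     (use picard_bound(1)[OF order_refl assms] in simp)

lemma solves_solution: "solves z \<phi> (solution \<phi> z)"
  unfolding solves_def
proof (intro ballI conjI)
  fix f assume f: "f \<in> F"
  have sm: "summable (\<lambda>n. picard \<phi> z n t g)" if "0 \<le> t" "g \<in> F" for t g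
    using picard_summable[OF that] by (rule summable_norm_cancel)
  have int: "integrable_to t (\<lambda>s. rhs z s (picard \<phi> z n s) f)" if "0 \<le> t" for t n
    using that f by (intro rhs_integrable picard_continuous)
  have rhs_sums: "(\<lambda>n. rhs z s (picard \<phi> z n s) f) sums rhs z s (solution \<phi> z s) f" if "0 \<le> s" for s
    unfolding rhs_def solution_def using sm[OF that] f
    by (intro sums_mult sums_add sums_sum) (auto intro: summable_sums)
  have rhs_summable: "summable (\<lambda>n. cmod (rhs z s (picard \<phi> z n s) f))" if "0 \<le> s" for s
  proof (rule summable_comparison_test'[of _ 0])
    show "norm (cmod (rhs z s (picard \<phi> z n s) f)) \<le> generator_bound (cmod z) s
        * (majorant \<phi> (cmod z) n s)" for n
      using norm_rhs_le[OF order_refl f picard_bound(1)[OF order_refl that]] by simp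
  qed (intro summable_mult summable_exp_series)
  have main: "integrable_to t (\<lambda>s. rhs z s (solution \<phi> z s) f) \<and>
     solution \<phi> z t f = \<phi> f + integral_to t (\<lambda>s. rhs z s (solution \<phi> z s) f)" if t: "0 \<le> t" for t
  proof -
    define h where "h = (\<lambda>n s. indicator {0..t} s *\<^sub>R rhs z s (picard \<phi> z n s) f)"
    have 1: "integrable lebesgue (h n)" for n
      using int[OF t, of n] by (simp add: h_def set_integrable_def)
    have 2: "AE s in lebesgue. summable (\<lambda>n. norm (h n s))"
      using rhs_summable by (intro AE_I2) (auto simp: h_def indicator_def)
    have 3: "summable (\<lambda>n. \<integral>s. norm (h n s) \<partial>lebesgue)"
    proof (rule summable_comparison_test'[of _ 0])
      show "norm (\<integral>s. norm (h n s) \<partial>lebesgue) \<le> majorant \<phi> (cmod z) (Suc n) t" for n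
      proof -
        have "(\<integral>s. norm (h n s) \<partial>lebesgue) = integral_to t (\<lambda>s. cmod (rhs z s (picard \<phi> z n s) f))"
          unfolding set_lebesgue_integral_def h_def by (intro Bochner_Integration.integral_cong) auto
        moreover have "0 \<le> (\<integral>s. norm (h n s) \<partial>lebesgue)" by simp
        ultimately show ?thesis using picard_bound(2)[OF order_refl t f, where z=z and \<phi>=\<phi> and n=n] by simp
      qed
      show "summable (\<lambda>n. majorant \<phi> (cmod z) (Suc n) t)"
        using summable_exp_series by (subst summable_Suc_iff)
    qed
    have s: "(\<Sum>n. h n s) = indicator {0..t} s *\<^sub>R rhs z s (solution \<phi> z s) f" for s
      using rhs_sums[of s] by (auto simp: h_def indicator_def sums_iff)
    have "integrable lebesgue (\<lambda>s. \<Sum>n. h n s)" by (rule integrable_suminf[OF 1 2 3])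
    then have A: "integrable_to t (\<lambda>s. rhs z s (solution \<phi> z s) f)"
      unfolding s by (simp add: set_integrable_def)
    have "(\<integral>s. (\<Sum>n. h n s) \<partial>lebesgue) = (\<Sum>n. \<integral>s. h n s \<partial>lebesgue)" by (rule integral_suminf[OF 1 2 3])
    then have "integral_to t (\<lambda>s. rhs z s (solution \<phi> z s) f) = (\<Sum>n. picard \<phi> z (Suc n) t f)"
      unfolding s by (simp add: set_lebesgue_integral_def h_def)
    moreover have "solution \<phi> z t f = \<phi> f + (\<Sum>n. picard \<phi> z (Suc n) t f)"
      unfolding solution_def using suminf_split_head[OF sm[OF t f]] by simp
    ultimately show ?thesis using A by simp
  qed
  have prim: "is_primitive (\<lambda>t. \<phi> f + integral_to t (\<lambda>s. rhs z s (solution \<phi> z s) f))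
      (\<lambda>s. rhs z s (solution \<phi> z s) f)"
    using main by (intro is_primitive_integral) blast
  show "is_primitive (\<lambda>t. solution \<phi> z t f) (\<lambda>s. rhs z s (solution \<phi> z s) f)"
    by (rule is_primitive_cong[OF prim]) (use main in metis)+
  show "solution \<phi> z 0 f = \<phi> f"
    using is_primitiveD(2)[OF prim, of 0] main[of 0] by simp
qed

lemma solution_holomorphic:
  assumes t: "0 \<le> t" and f: "f \<in> F"
  shows "(\<lambda>z. solution \<phi> z t f) holomorphic_on UNIV"
proof (rule holomorphic_uniform_sequence[of UNIV "\<lambda>N z. \<Sum>n<N. picard \<phi> z n t f"])
  show "(\<lambda>z. \<Sum>n<N. picard \<phi> z n t f) holomorphic_on UNIV" for N
    using picard_holomorphic[OF f t] by (intro holomorphic_intros)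
  fix w :: complex
  have "uniform_limit (cball w 1) (\<lambda>N z. \<Sum>n<N. picard \<phi> z n t f) (\<lambda>z. \<Sum>n. picard \<phi> z n t f) sequentially"
  proof (rule Weierstrass_m_test[of _ _ "\<lambda>n. majorant \<phi> (cmod w + 1) n t"])
    fix n z assume "z \<in> cball w 1"
    then have "cmod (z - w) \<le> 1" by (simp add: dist_norm norm_minus_commute)
    then have "cmod z \<le> cmod w + 1" using norm_triangle_sub[of z w] by linarith
    then show "cmod (picard \<phi> z n t f) \<le> majorant \<phi> (cmod w + 1) n t"
      by (rule picard_bound(1)[OF _ t f])
  qed (rule summable_exp_series)
  then show "\<exists>d>0. cball w d \<subseteq> UNIV \<and> uniform_limit (cball w d) (\<lambda>N z. \<Sum>n<N. picard \<phi> z n t f)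
      (\<lambda>z. solution \<phi> z t f) sequentially"
    unfolding solution_def by (intro exI[of _ 1]) auto
qed simp

end

text \<open>
  Polarised form of the conservation of energy; for matrices it gives unitarity.
\<close>

lemma (in hermitian_system) inner_conserved:
  assumes x: "solves (of_real k) \<phi> x" and y: "solves (of_real k) \<psi> y" and t: "0 \<le> t"
  shows "(\<Sum>f\<in>F. x t f * cnj (y t f)) = (\<Sum>f\<in>F. \<phi> f * cnj (\<psi> f))"
proof -
  have "is_primitive (\<lambda>t. \<Sum>f\<in>F. x t f * cnj (y t f))
     (\<lambda>s. \<Sum>f\<in>F. rhs (of_real k) s (x s) f * cnj (y s f) + x s f * cnj (rhs (of_real k) s (y s) f))"
    using x y unfolding solves_def
    by (intro is_primitive_sum finite_index is_primitive_mult is_primitive_cnj) auto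
  then have p: "is_primitive (\<lambda>t. \<Sum>f\<in>F. x t f * cnj (y t f)) (\<lambda>s. 0)"
  proof (rule is_primitive_cong)
    fix s :: real assume s: "0 \<le> s"
    have W: "cnj (W s f g) = W s g f" if "f \<in> F" "g \<in> F" for f g
      using hermitian[OF s that(2,1)] by simp
    have "rhs (of_real k) s (x s) f * cnj (y s f) + x s f * cnj (rhs (of_real k) s (y s) f)
       = \<i> * ((\<Sum>g\<in>F. W s f g * x s g * cnj (y s f)) - (\<Sum>g\<in>F. W s g f * x s f * cnj (y s g)))"
           if "f \<in> F" for f
    proof -
      have "(\<Sum>g\<in>F. cnj (W s f g) * cnj (y s g)) = (\<Sum>g\<in>F. W s g f * cnj (y s g))"
        using W that by (intro sum.cong) auto
      then have 1: "cnj (rhs (of_real k) s (y s) f) = - \<i> * (of_real (k * mu f) * cnj (y s f) +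
          (\<Sum>g\<in>F. W s g f * cnj (y s g)))"
        unfolding rhs_def complex_cnj_mult complex_cnj_add cnj_sum by simp
      have 2: "(\<Sum>g\<in>F. W s f g * x s g * cnj (y s f)) = (\<Sum>g\<in>F. W s f g * x s g) * cnj (y s f)"
        by (rule sum_distrib_right[symmetric])
      have 3: "(\<Sum>g\<in>F. W s g f * x s f * cnj (y s g)) = x s f * (\<Sum>g\<in>F. W s g f * cnj (y s g))"
        by (simp add: sum_distrib_left mult_ac)
      have "\<i> * (of_real k * of_real m * a + A) * b + a * (- \<i> * (of_real (k * m) * b + B)) = \<i> * (A
          * b - a * B)" for m a b A B
        by (simp add: algebra_simps)
      then show ?thesis unfolding 1 2 3 unfolding rhs_def .
    qed
    then have "(\<Sum>f\<in>F. rhs (of_real k) s (x s) f * cnj (y s f) + x s f * cnj (rhs (of_real k) s (y s) f))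
       = \<i> * ((\<Sum>f\<in>F. \<Sum>g\<in>F. W s f g * x s g * cnj (y s f)) - (\<Sum>f\<in>F. \<Sum>g\<in>F. W s g f * x s f * cnj (y s g)))"
      by (simp add: sum_distrib_left[symmetric] sum_subtractf)
    also have "(\<Sum>f\<in>F. \<Sum>g\<in>F. W s g f * x s f * cnj (y s g)) = (\<Sum>f\<in>F. \<Sum>g\<in>F. W s f g * x s g * cnj (y s f))"
      by (rule sum.swap)
    finally show "(\<Sum>f\<in>F. rhs (of_real k) s (x s) f * cnj (y s f) + x s f
        * cnj (rhs (of_real k) s (y s) f)) = 0"
      by simp
  qed simp
  have "(\<Sum>f\<in>F. x t f * cnj (y t f)) = (\<Sum>f\<in>F. x 0 f * cnj (y 0 f))"
    using is_primitiveD(2)[OF p t] by simp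
  also have "\<dots> = (\<Sum>f\<in>F. \<phi> f * cnj (\<psi> f))"
    using x y by (intro sum.cong) (auto simp: solves_def)
  finally show ?thesis .
qed

text \<open>
  The vector \<open>\<phi>\<close> is the ground state and \<open>u\<close> collects the couplings out of it. The assumption
  \<open>no_resonance\<close> says that no coupling stays inside the kernel of \<open>\<mu>\<close>, so that division by \<open>\<mu>\<close> is
  harmless.
\<close>

locale seeded_system = hermitian_system +
  fixes \<phi> :: "'a \<Rightarrow> complex" and u :: "real \<Rightarrow> 'a \<Rightarrow> complex"
  assumes u_sum: "u s g = (\<Sum>f\<in>F. cnj (\<phi> f) * W s f g)"
    and seed_unit: "(\<Sum>f\<in>F. (cmod (\<phi> f))\<^sup>2) = 1"
    and seed_kernel: "f \<in> F \<Longrightarrow> \<phi> f \<noteq> 0 \<Longrightarrow> mu f = 0"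
    and no_resonance: "0 \<le> t \<Longrightarrow> g \<in> F \<Longrightarrow> mu g = 0 \<Longrightarrow> u t g = 0"
    and u_sq: "0 \<le> t \<Longrightarrow> g \<in> F \<Longrightarrow> integrable_to t (\<lambda>s. (cmod (u s g))\<^sup>2)"
begin

definition amp :: "real \<Rightarrow> complex \<Rightarrow> complex" where
  "amp t z = (\<Sum>f\<in>F. cnj (\<phi> f) * solution \<phi> z t f)"

text \<open>
  For \<open>mu g = 0\<close> the factor \<open>inverse (mu g)\<close> is zero, in agreement with the vanishing of \<open>u\<close> there.
\<close>

definition action :: "real \<Rightarrow> real" where
  "action t = (\<Sum>g\<in>F. inverse (mu g) * integral_to t (\<lambda>s. (cmod (u s g))\<^sup>2))"

lemma amp_holomorphic: "0 \<le> t \<Longrightarrow> amp t holomorphic_on UNIV"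
  unfolding amp_def by (intro holomorphic_intros solution_holomorphic)

lemma amp_primitive: "is_primitive (\<lambda>t. amp t z) (\<lambda>s. \<i> * (\<Sum>g\<in>F. u s g * solution \<phi> z s g))"
proof -
  have "is_primitive (\<lambda>t. amp t z) (\<lambda>s. \<Sum>f\<in>F. cnj (\<phi> f) * rhs z s (solution \<phi> z s) f)"
    unfolding amp_def using solves_solution[of z \<phi>]
    by (intro is_primitive_sum finite_index is_primitive_cmult) (auto simp: solves_def)
  moreover have "(\<Sum>f\<in>F. cnj (\<phi> f) * rhs z s x f) = \<i> * (\<Sum>g\<in>F. u s g * x g)" for s x
  proof -
    have "cnj (\<phi> f) * rhs z s x f = (\<Sum>g\<in>F. \<i> * (cnj (\<phi> f) * W s f g * x g))" if "f \<in> F" for f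
      using seed_kernel[OF that] by (cases "\<phi> f = 0") (auto simp: rhs_def sum_distrib_left mult_ac)
    then have "(\<Sum>f\<in>F. cnj (\<phi> f) * rhs z s x f) = (\<Sum>f\<in>F. \<Sum>g\<in>F. \<i> * (cnj (\<phi> f) * W s f g * x g))"
      by (rule sum.cong[OF refl])
    also have "\<dots> = (\<Sum>g\<in>F. \<Sum>f\<in>F. \<i> * (cnj (\<phi> f) * W s f g * x g))" by (rule sum.swap)
    finally show ?thesis by (simp add: u_sum sum_distrib_left sum_distrib_right)
  qed
  ultimately show ?thesis by simp
qed

lemma amp_0: "amp 0 z = 1"
proof -
  have "amp 0 z = (\<Sum>f\<in>F. cnj (\<phi> f) * \<phi> f)"
    unfolding amp_def using solves_solution[of z \<phi>] by (intro sum.cong) (auto simp: solves_def)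
  also have "\<dots> = of_real (\<Sum>f\<in>F. (cmod (\<phi> f))\<^sup>2)"
    by (simp only: of_real_sum complex_norm_square mult.commute)
  finally show ?thesis by (simp add: seed_unit)
qed

lemma solution_norm_le_1:
  assumes "0 \<le> Im z" "0 \<le> t"
  shows "(\<Sum>f\<in>F. (cmod (solution \<phi> z t f))\<^sup>2) \<le> 1"
proof -
  note e = is_primitiveD(2)[OF energy_identity[OF solves_solution[of z \<phi>]] assms(2)]
  have "(\<Sum>f\<in>F. (cmod (solution \<phi> z 0 f))\<^sup>2) = 1"
    using solves_solution[of z \<phi>] seed_unit by (simp add: solves_def)
  moreover have "integral_to t (\<lambda>s. - 2 * Im z * (\<Sum>f\<in>F. mu f * (cmod (solution \<phi> z s f))\<^sup>2)) \<le> 0"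
  proof -
    have "0 \<le> integral_to t (\<lambda>s. \<Sum>f\<in>F. mu f * (cmod (solution \<phi> z s f))\<^sup>2)"
      unfolding set_lebesgue_integral_def using mu_nonneg
      by (intro Bochner_Integration.integral_nonneg scaleR_nonneg_nonneg mult_nonneg_nonneg sum_nonneg) auto
    then show ?thesis using assms(1) by (simp only: set_integral_mult_right) (simp add: mult_nonneg_nonneg)
  qed
  ultimately show ?thesis using e by linarith
qed

lemma amp_le_norm: "(cmod (amp t z))\<^sup>2 \<le> (\<Sum>f\<in>F. (cmod (solution \<phi> z t f))\<^sup>2)"
proof -
  have "cmod (amp t z) \<le> (\<Sum>f\<in>F. \<bar>cmod (\<phi> f)\<bar> * \<bar>cmod (solution \<phi> z t f)\<bar>)"
    unfolding amp_def by (rule order_trans[OF norm_sum]) (simp add: norm_mult)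
  also have "\<dots> \<le> L2_set (\<lambda>f. cmod (\<phi> f)) F * L2_set (\<lambda>f. cmod (solution \<phi> z t f)) F"
    by (rule L2_set_mult_ineq)
  also have "\<dots> = L2_set (\<lambda>f. cmod (solution \<phi> z t f)) F"
    by (simp add: L2_set_def seed_unit)
  finally have "(cmod (amp t z))\<^sup>2 \<le> (L2_set (\<lambda>f. cmod (solution \<phi> z t f)) F)\<^sup>2"
    by (intro power_mono) auto
  then show ?thesis by (simp add: L2_set_def sum_nonneg)
qed

lemma amp_le_1: "0 \<le> Im z \<Longrightarrow> 0 \<le> t \<Longrightarrow> cmod (amp t z) \<le> 1"
  using order_trans[OF amp_le_norm solution_norm_le_1] by (simp add: power_le_one_iff abs_square_le_1)

text \<open>
  Only the couplings change the amplitude, so \<open>|1 - a|\<close> is at most the integral of \<open>\<Sum> |u| |\<omega>|\<close>. Splitting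
  each product into \<open>|u|\<^sup>2 / (2 y \<mu>) + y \<mu> |\<omega>|\<^sup>2 / 2\<close> yields \<open>A / (2 y) + (1 - |\<omega>(t)|\<^sup>2) / 4\<close> by the energy
  identity. As \<open>1 - |\<omega>|\<^sup>2 \<le> 1 - |a|\<^sup>2 \<le> 2 |1 - a|\<close>, the second term is at most \<open>|1 - a| / 2\<close> and can be
  absorbed on the left.
\<close>

lemma action_bound:
  assumes y: "0 < y" and t: "0 \<le> t"
  shows "y * cmod (1 - amp t (\<i> * of_real y)) \<le> action t"
proof -
  define z where "z = \<i> * complex_of_real y"
  define x where "x = solution \<phi> z"
  have Imz: "Im z = y" by (simp add: z_def)
  define P where "P = (\<lambda>s. \<Sum>g\<in>F. inverse (mu g) * (cmod (u s g))\<^sup>2)"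
  define Q where "Q = (\<lambda>s. - 2 * y * (\<Sum>f\<in>F. mu f * (cmod (x s f))\<^sup>2))"
  note e = energy_identity[OF solves_solution[of z \<phi>], unfolded Imz, folded x_def, folded Q_def]
  have Q: "integrable_to t Q"
    "integral_to t Q = (\<Sum>f\<in>F. (cmod (x t f))\<^sup>2) - 1"
  proof -
    show "integrable_to t Q" by (rule is_primitiveD(1)[OF e t])
    have "(\<Sum>f\<in>F. (cmod (x 0 f))\<^sup>2) = 1"
      using solves_solution[of z \<phi>] seed_unit by (simp add: solves_def x_def)
    then show "integral_to t Q = (\<Sum>f\<in>F. (cmod (x t f))\<^sup>2) - 1"
      using is_primitiveD(2)[OF e t] by linarith
  qed
  have P: "integrable_to t P" "integral_to t P = action t"
  proof -
    have *: "integrable_to t (\<lambda>s. inverse (mu g) * (cmod (u s g))\<^sup>2)" if "g \<in> F" for g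
      using u_sq[OF t that] by (rule set_integrable_mult_right)
    show "integrable_to t P" unfolding P_def using * by (rule set_integral_sum)
    show "integral_to t P = action t"
      unfolding P_def action_def by (subst set_integral_sum(2)[OF *]) simp_all
  qed
  define R where "R = (\<lambda>s. \<i> * (\<Sum>g\<in>F. u s g * x s g))"
  note a = amp_primitive[of z, folded x_def, folded R_def]
  have R: "integrable_to t R" "integral_to t R = amp t z - 1"
    using is_primitiveD[OF a t] by (auto simp: amp_0)
  have PQ: "integrable_to t (\<lambda>s. 1 / (2 * y) * P s)" "integrable_to t (\<lambda>s. - 1 / 4 * Q s)"
    by (rule set_integrable_mult_right, rule P(1), rule set_integrable_mult_right, rule Q(1))
  have "cmod (1 - amp t z) = cmod (integral_to t R)"
    unfolding R by (rule norm_minus_commute)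
  also have "\<dots> \<le> integral_to t (\<lambda>s. cmod (R s))"
    by (rule set_integral_norm_bound[OF R(1)])
  also have "\<dots> \<le> integral_to t (\<lambda>s. 1 / (2 * y) * P s + (- 1 / 4) * Q s)"
  proof (rule set_integral_mono)
    show "integrable_to t (\<lambda>s. cmod (R s))" by (rule set_integrable_norm[OF R(1)])
    show "integrable_to t (\<lambda>s. 1 / (2 * y) * P s + (- 1 / 4) * Q s)"
      using PQ by (rule set_integral_add)
    fix s assume s: "s \<in> {0..t}"
    have "cmod (R s) \<le> (\<Sum>g\<in>F. cmod (u s g) * cmod (x s g))"
      unfolding R_def by (simp add: norm_mult) (rule order_trans[OF norm_sum], simp add: norm_mult)
    also have "\<dots> \<le> (\<Sum>g\<in>F. 1 / (2 * y) * (inverse (mu g) * (cmod (u s g))\<^sup>2) + y / 2 * (mu g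
        * (cmod (x s g))\<^sup>2))"
    proof (rule sum_mono)
      fix g assume g: "g \<in> F"
      show "cmod (u s g) * cmod (x s g) \<le> 1 / (2 * y) * (inverse (mu g) * (cmod (u s g))\<^sup>2) + y / 2
          * (mu g * (cmod (x s g))\<^sup>2)"
      proof (cases "mu g = 0")
        case True
        then show ?thesis using no_resonance[of s g] s g by simp
      next
        case False
        then have m: "0 < y * mu g" using mu_nonneg[OF g] y by simp
        have "0 \<le> (cmod (u s g) - (y * mu g) * cmod (x s g))\<^sup>2 / (2 * (y * mu g))"
          using m by simp
        also have "\<dots> = 1 / (2 * y) * (inverse (mu g) * (cmod (u s g))\<^sup>2) + y / 2 * (mu g
            * (cmod (x s g))\<^sup>2) - cmod (u s g) * cmod (x s g)"
          using m False y by (simp add: power2_diff field_simps power2_eq_square)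
        finally show ?thesis by simp
      qed
    qed
    also have "\<dots> = 1 / (2 * y) * P s + (- 1 / 4) * Q s"
      unfolding P_def Q_def by (simp add: sum.distrib sum_distrib_left)
    finally show "cmod (R s) \<le> 1 / (2 * y) * P s + (- 1 / 4) * Q s" .
  qed
  also have "\<dots> = 1 / (2 * y) * action t + (1 - (\<Sum>f\<in>F. (cmod (x t f))\<^sup>2)) / 4"
    unfolding set_integral_add(2)[OF PQ] set_integral_mult_right P(2) Q(2) by (simp add: field_simps)
  also have "\<dots> \<le> 1 / (2 * y) * action t + cmod (1 - amp t z) / 2"
  proof -
    have "1 - (\<Sum>f\<in>F. (cmod (x t f))\<^sup>2) \<le> 1 - (cmod (amp t z))\<^sup>2"
      using amp_le_norm[of t z] by (simp add: x_def)
    also have "\<dots> = (1 - cmod (amp t z)) * (1 + cmod (amp t z))"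
      by (simp add: power2_eq_square algebra_simps)
    also have "\<dots> \<le> (1 - cmod (amp t z)) * 2"
      using amp_le_1[of z t] t y Imz by (intro mult_left_mono) auto
    also have "\<dots> \<le> cmod (1 - amp t z) * 2"
      using norm_triangle_ineq2[of 1 "amp t z"] by simp
    finally show ?thesis by simp
  qed
  finally show ?thesis using y by (simp add: z_def field_simps)
qed

end

section \<open>From the imaginary axis to the real line\<close>

text \<open>
  After subtraction of its value at \<open>\<i> y\<close> the function may be divided by \<open>z\<^sup>2 + y\<^sup>2\<close> without creating a pole
  in the upper half plane. Cauchy's theorem on the half disc of radius \<open>R\<close> then compares the segment
  with the arc, and no winding number is needed.
\<close>

lemma half_disc_estimate:
  assumes h: "h holomorphic_on UNIV" and y: "0 < y" "y < R"
    and M: "\<And>z. 0 \<le> Im z \<Longrightarrow> cmod (h z) \<le> M"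
  shows "cmod (integral {-R..R} (\<lambda>k. (h (of_real k) - h (\<i> * of_real y)) / of_real (k\<^sup>2 + y\<^sup>2))) \<le> 2
      * M / (R\<^sup>2 - y\<^sup>2) * R * pi"
proof -
  define w where "w = \<i> * complex_of_real y"
  define d where "d = (\<lambda>z. if z = w then deriv h w else (h z - h w) / (z - w))"
  \<comment> \<open>\<open>d\<close> is the difference quotient with its removable singularity filled in.\<close>
  define q where "q = (\<lambda>z. d z / (z + w))"
  define S where "S = {z. - y < Im z}"
  have R: "0 < R" using y by simp
  have M0: "0 \<le> M" using order_trans[OF norm_ge_zero M[of 0]] by simp
  have "d holomorphic_on UNIV"
    unfolding d_def by (rule pole_lemma[OF h]) simp
  then have q: "q holomorphic_on S"
    unfolding q_def by (intro holomorphic_intros)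
        (auto intro: holomorphic_on_subset simp: S_def w_def complex_eq_iff)
  have sqw: "z\<^sup>2 + of_real (y\<^sup>2) = (z - w) * (z + w)" for z
    by (simp add: w_def power2_eq_square algebra_simps)
  have qeq: "q z = (h z - h w) / (z\<^sup>2 + of_real (y\<^sup>2))" if "z \<noteq> w" for z
    unfolding sqw using that by (simp add: q_def d_def)
  define g where "g = linepath (of_real (-R)) (of_real R) +++ part_circlepath 0 R 0 pi"
  have v: "valid_path (linepath (of_real (-R)) (complex_of_real R))" "valid_path (part_circlepath 0 R 0 pi)"
    by auto
  have arc: "cmod z = R \<and> 0 \<le> Im z" if "z \<in> path_image (part_circlepath 0 R 0 pi)" for z
    using that R by (auto simp: path_image_part_circlepath' closed_segment_eq_real_ivl norm_mult sin_ge_zero)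
  have line: "Im z = 0" if "z \<in> path_image (linepath (of_real (-R)) (complex_of_real R))" for z
    using that by (auto simp: path_image_linepath closed_segment_def)
  have im: "path_image g \<subseteq> S"
    unfolding g_def using arc line y(1) by (subst path_image_join) (force simp: S_def)+
  have "(q has_contour_integral 0) g"
  proof (rule Cauchy_theorem_convex_simple[OF q _ _ im])
    show "convex S" unfolding S_def by (rule convex_halfspace_Im_gt)
    show "valid_path g" unfolding g_def using v by (intro valid_path_join) auto
    show "pathfinish g = pathstart g" by (simp add: g_def)
  qed
  then have ci: "q contour_integrable_on g" "contour_integral g q = 0"
    using contour_integral_unique has_contour_integral_integrable by blast+
  note i1 = contour_integrable_joinD1[OF ci(1)[unfolded g_def] v(1)]
  note i2 = contour_integrable_joinD2[OF ci(1)[unfolded g_def] v(2)]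
  have "contour_integral (linepath (of_real (-R)) (of_real R)) q
      + contour_integral (part_circlepath 0 R 0 pi) q = 0"
    using ci(2) unfolding g_def contour_integral_join[OF i1 i2 v] .
  then have "cmod (contour_integral (linepath (of_real (-R)) (of_real R)) q)
      = cmod (contour_integral (part_circlepath 0 R 0 pi) q)"
    by (metis add_eq_0_iff norm_minus_cancel)
  also have "\<dots> \<le> 2 * M / (R\<^sup>2 - y\<^sup>2) * R * \<bar>pi - 0\<bar>"
  proof (rule contour_integral_bound_part_circlepath[OF i2])
    show "0 \<le> 2 * M / (R\<^sup>2 - y\<^sup>2)" using M0 y by (auto intro!: divide_nonneg_nonneg power_mono)
    fix z assume "z \<in> path_image (part_circlepath 0 R 0 pi)"
    then have z: "cmod z = R" "0 \<le> Im z" using arc by auto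
    have "cmod w = y" using y by (simp add: w_def norm_mult)
    then have "z \<noteq> w" using z y by auto
    have "cmod (h z - h w) \<le> M + M"
      using norm_triangle_ineq4[of "h z" "h w"] M[OF z(2)] M[of w] y by (simp add: w_def)
    moreover have "R\<^sup>2 - y\<^sup>2 \<le> cmod (z\<^sup>2 + of_real (y\<^sup>2))"
      using norm_diff_ineq[of "z\<^sup>2" "of_real (y\<^sup>2)"] z by (simp add: norm_power)
    moreover have "0 < R\<^sup>2 - y\<^sup>2" using y by (simp add: power_strict_mono)
    ultimately show "cmod (q z) \<le> 2 * M / (R\<^sup>2 - y\<^sup>2)"
      unfolding qeq[OF \<open>z \<noteq> w\<close>] norm_divide using M0 by (intro frac_le) auto
  qed (use R in auto)
  also have "contour_integral (linepath (of_real (-R)) (of_real R)) q = integral {-R..R}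
      (\<lambda>k. q (of_real k))"
    using R by (subst contour_integral_linepath_Reals_eq) auto
  also have "\<dots> = integral {-R..R} (\<lambda>k. (h (of_real k) - h w) / of_real (k\<^sup>2 + y\<^sup>2))"
  proof (rule Henstock_Kurzweil_Integration.integral_cong)
    fix k
    have "of_real k \<noteq> w" using y by (auto simp: w_def complex_eq_iff)
    then show "q (of_real k) = (h (of_real k) - h w) / of_real (k\<^sup>2 + y\<^sup>2)" by (simp add: qeq)
  qed
  finally show ?thesis by (simp add: w_def)
qed

lemma poisson_kernel_has_integral:
  assumes "0 < y" "0 \<le> R"
  shows "((\<lambda>k. 1 / (k\<^sup>2 + y\<^sup>2)) has_integral (2 / y * arctan (R / y))) {-R..R}"
proof -
  have "((\<lambda>k. 1 / (k\<^sup>2 + y\<^sup>2)) has_integral (1 / y * arctan (R / y) - 1 / y * arctan (-R / y))) {-R..R}"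
  proof (rule fundamental_theorem_of_calculus)
    fix k
    have "((\<lambda>k. 1 / y * arctan (k / y)) has_real_derivative 1 / y * (1 / y * inverse (1
        + (k / y)\<^sup>2))) (at k within {-R..R})"
      using assms by (auto intro!: derivative_eq_intros)
    moreover have "1 + (k / y)\<^sup>2 = (k\<^sup>2 + y\<^sup>2) / y\<^sup>2"
      using assms by (simp add: field_simps)
    then have "1 / y * (1 / y * inverse (1 + (k / y)\<^sup>2)) = 1 / (k\<^sup>2 + y\<^sup>2)"
      using assms by (simp add: power2_eq_square)
    ultimately have "((\<lambda>k. 1 / y * arctan (k / y)) has_real_derivative 1 / (k\<^sup>2
        + y\<^sup>2)) (at k within {-R..R})"
      by simp
    then show "((\<lambda>k. 1 / y * arctan (k / y)) has_vector_derivative 1 / (k\<^sup>2 + y\<^sup>2)) (at k within {-R..R})"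
      by (simp add: has_real_derivative_iff_has_vector_derivative)
  qed (use assms in auto)
  then show ?thesis by (simp add: arctan_minus field_simps)
qed

text \<open>
  The Poisson formula as an inequality for truncated integrals; this is all that is used, and it avoids
  any question of integrability at infinity.
\<close>

lemma poisson_truncated:
  assumes h: "h holomorphic_on UNIV" and y: "0 < y" "y < R"
    and M: "\<And>z. 0 \<le> Im z \<Longrightarrow> cmod (h z) \<le> M" and nn: "0 \<le> Re (h (\<i> * of_real y))"
  shows "integral {-R..R} (\<lambda>k. Re (h (of_real k)) / (k\<^sup>2 + y\<^sup>2)) \<le> pi / y * Re (h (\<i> * of_real y))
      + 2 * M / (R\<^sup>2 - y\<^sup>2) * R * pi"
proof -
  define c where "c = h (\<i> * of_real y)"
  have cont: "continuous_on {-R..R} (\<lambda>k. h (of_real k))"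
    using holomorphic_on_imp_continuous_on[OF h]
    by (intro continuous_on_compose2[of UNIV h _ "of_real"] continuous_intros) auto
  have nz: "k\<^sup>2 + y\<^sup>2 \<noteq> 0" for k
    using y by (simp add: sum_power2_eq_zero_iff)
  have int: "(\<lambda>k. (h (of_real k) - c) / of_real (k\<^sup>2 + y\<^sup>2)) integrable_on {-R..R}"
    using nz by (intro integrable_continuous_interval continuous_intros cont) (metis of_real_eq_0_iff)
  have i1: "(\<lambda>k. Re (h (of_real k)) / (k\<^sup>2 + y\<^sup>2)) integrable_on {-R..R}"
    using nz by (intro integrable_continuous_interval continuous_intros cont) auto
  have i2: "((\<lambda>k. 1 / (k\<^sup>2 + y\<^sup>2)) has_integral (2 / y * arctan (R / y))) {-R..R}"
    using y by (intro poisson_kernel_has_integral) auto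
  have i3: "(\<lambda>k. Re c * (1 / (k\<^sup>2 + y\<^sup>2))) integrable_on {-R..R}"
    "integral {-R..R} (\<lambda>k. Re c * (1 / (k\<^sup>2 + y\<^sup>2))) = Re c * integral {-R..R} (\<lambda>k. 1 / (k\<^sup>2 + y\<^sup>2))"
    using has_integral_mult_right[OF i2, of "Re c"] integral_unique[OF i2] by
        (auto simp only: integrable_on_def integral_unique)
  have "integral {-R..R} (\<lambda>k. Re (h (of_real k)) / (k\<^sup>2 + y\<^sup>2)) - Re c * integral {-R..R}
      (\<lambda>k. 1 / (k\<^sup>2 + y\<^sup>2))
      = integral {-R..R} (\<lambda>k. Re (h (of_real k)) / (k\<^sup>2 + y\<^sup>2) - Re c * (1 / (k\<^sup>2 + y\<^sup>2)))"
    unfolding i3(2)[symmetric] by (rule Henstock_Kurzweil_Integration.integral_diff[OF i1 i3(1), symmetric])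
  also have "\<dots> = integral {-R..R} (\<lambda>k. Re ((h (of_real k) - c) / of_real (k\<^sup>2 + y\<^sup>2)))"
    by (simp add: Re_divide_of_real diff_divide_distrib del: of_real_add)
  also have "\<dots> = Re (integral {-R..R} (\<lambda>k. (h (of_real k) - c) / of_real (k\<^sup>2 + y\<^sup>2)))"
    using integral_linear[OF int bounded_linear_Re] by (simp add: o_def)
  also have "\<dots> \<le> 2 * M / (R\<^sup>2 - y\<^sup>2) * R * pi"
    using order_trans[OF complex_Re_le_cmod half_disc_estimate[OF h y M]] by (simp add: c_def)
  finally have "integral {-R..R} (\<lambda>k. Re (h (of_real k)) / (k\<^sup>2 + y\<^sup>2)) \<le> Re c * (2 / y
      * arctan (R / y)) + 2 * M / (R\<^sup>2 - y\<^sup>2) * R * pi"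
    using integral_unique[OF i2] y by simp
  moreover have "Re c * (2 / y * arctan (R / y)) \<le> Re c * (pi / y)"
    using arctan_bounded[of "R / y"] y nn by (intro mult_left_mono) (auto simp: c_def field_simps)
  ultimately show ?thesis by (simp add: c_def mult.commute)
qed

text \<open>
  By the Poisson formula, \<open>\<integral> Re (1 - a(k)) y\<^sup>2 / (k\<^sup>2 + y\<^sup>2) dk\<close> is at most \<open>\<pi> y Re (1 - a(\<i> y)) \<le> \<pi> A\<close> for
  every \<open>y\<close>. The integrand is nonnegative because \<open>|a| \<le> 1\<close>, and the weight tends to one on bounded
  intervals as \<open>y\<close> grows.
\<close>

lemma contraction_L1_bound_interval:
  assumes a: "a holomorphic_on UNIV" and le1: "\<And>z. 0 \<le> Im z \<Longrightarrow> cmod (a z) \<le> 1"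
    and A: "\<And>y. 0 < y \<Longrightarrow> y * cmod (1 - a (\<i> * of_real y)) \<le> A" and K: "0 \<le> K"
  shows "integral {-K..K} (\<lambda>k. 1 - Re (a (of_real k))) \<le> pi * A"
proof -
  define h where "h = (\<lambda>z. 1 - a z)"
  have h: "h holomorphic_on UNIV" unfolding h_def using a by (intro holomorphic_intros)
  have hM: "cmod (h z) \<le> 2" if "0 \<le> Im z" for z
    using norm_triangle_ineq4[of 1 "a z"] le1[OF that] by (simp add: h_def)
  have hnn: "0 \<le> Re (h z)" if "0 \<le> Im z" for z
    using order_trans[OF complex_Re_le_cmod le1[OF that]] by (simp add: h_def)
  have cont: "continuous_on S (\<lambda>k. h (of_real k))" for S
    using holomorphic_on_imp_continuous_on[OF h]
    by (intro continuous_on_compose2[of UNIV h _ "of_real"] continuous_intros) auto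
  have nz: "k\<^sup>2 + y\<^sup>2 \<noteq> 0" if "0 < y" for k y :: real
    using that by (simp add: sum_power2_eq_zero_iff)
  define I where "I = integral {-K..K} (\<lambda>k. Re (h (of_real k)))"
  have yK: "I / (K\<^sup>2 + y\<^sup>2) \<le> pi * A / y\<^sup>2" if y: "0 < y" for y
  proof -
    have "I / (K\<^sup>2 + y\<^sup>2) = integral {-K..K} (\<lambda>k. Re (h (of_real k)) / (K\<^sup>2 + y\<^sup>2))"
      by (simp add: I_def)
    also have "\<dots> \<le> integral {-K..K} (\<lambda>k. Re (h (of_real k)) / (k\<^sup>2 + y\<^sup>2))"
    proof (rule integral_le)
      show "(\<lambda>k. Re (h (of_real k)) / (K\<^sup>2 + y\<^sup>2)) integrable_on {-K..K}"
        using nz[OF y] by (intro integrable_continuous_interval continuous_intros cont) auto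
      show "(\<lambda>k. Re (h (of_real k)) / (k\<^sup>2 + y\<^sup>2)) integrable_on {-K..K}"
        using nz[OF y] by (intro integrable_continuous_interval continuous_intros cont) auto
      show "Re (h (of_real k)) / (K\<^sup>2 + y\<^sup>2) \<le> Re (h (of_real k)) / (k\<^sup>2 + y\<^sup>2)" if "k \<in> {-K..K}" for k
      proof (rule divide_left_mono)
        have "k\<^sup>2 \<le> K\<^sup>2" using that by (intro abs_le_square_iff[THEN iffD1]) auto
        then show "k\<^sup>2 + y\<^sup>2 \<le> K\<^sup>2 + y\<^sup>2" by simp
        show "0 \<le> Re (h (of_real k))" by (rule hnn) simp
        show "0 < (K\<^sup>2 + y\<^sup>2) * (k\<^sup>2 + y\<^sup>2)" using y by (intro mult_pos_pos add_nonneg_pos) auto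
      qed
    qed
    finally have 1: "I / (K\<^sup>2 + y\<^sup>2) \<le> integral {-K..K} (\<lambda>k. Re (h (of_real k)) / (k\<^sup>2 + y\<^sup>2))" .
    have "I / (K\<^sup>2 + y\<^sup>2) \<le> pi / y * Re (h (\<i> * of_real y)) + 2 * 2 / (R\<^sup>2 - y\<^sup>2) * R * pi"
        if R: "R > max K y" for R
    proof -
      have "integral {-K..K} (\<lambda>k. Re (h (of_real k)) / (k\<^sup>2 + y\<^sup>2)) \<le> integral {-R..R}
          (\<lambda>k. Re (h (of_real k)) / (k\<^sup>2 + y\<^sup>2))"
        using R nz[OF y] hnn
        by (intro integral_subset_le) (auto intro!: integrable_continuous_interval continuous_intros cont)
      also have "\<dots> \<le> pi / y * Re (h (\<i> * of_real y)) + 2 * 2 / (R\<^sup>2 - y\<^sup>2) * R * pi"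
        using R y by (intro poisson_truncated[OF h y _ hM]) (auto intro: hnn)
      finally show ?thesis using 1 by simp
    qed
    then have "eventually (\<lambda>R. I / (K\<^sup>2 + y\<^sup>2) \<le> pi / y * Re (h (\<i> * of_real y)) + 2 * 2 / (R\<^sup>2
        - y\<^sup>2) * R * pi) at_top"
      by (intro eventually_mono[OF eventually_gt_at_top[of "max K y"]])
    moreover have "((\<lambda>R. pi / y * Re (h (\<i> * of_real y)) + 2 * 2 / (R\<^sup>2 - y\<^sup>2) * R * pi) \<longlongrightarrow> pi / y
        * Re (h (\<i> * of_real y)) + 0) at_top"
      by (intro tendsto_intros) real_asymp
    ultimately have "I / (K\<^sup>2 + y\<^sup>2) \<le> pi / y * Re (h (\<i> * of_real y)) + 0"
      by (intro tendsto_lowerbound[OF _ _ trivial_limit_at_top_linorder]) 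
    also have "\<dots> \<le> pi / y * (A / y)"
    proof -
      have "Re (h (\<i> * of_real y)) \<le> cmod (1 - a (\<i> * of_real y))"
        unfolding h_def by (rule complex_Re_le_cmod)
      also have "\<dots> \<le> A / y" using A[OF y] y by (simp add: field_simps)
      finally show ?thesis using y by (simp only: add_0_right) (intro mult_left_mono, auto)
    qed
    finally show ?thesis by (simp add: power2_eq_square)
  qed
  have "eventually (\<lambda>y. I \<le> pi * A * ((K\<^sup>2 + y\<^sup>2) / y\<^sup>2)) at_top"
  proof (rule eventually_mono[OF eventually_gt_at_top[of 0]])
    fix y :: real assume "0 < y"
    then show "I \<le> pi * A * ((K\<^sup>2 + y\<^sup>2) / y\<^sup>2)"
      using yK[of y] add_nonneg_pos[of "K\<^sup>2" "y\<^sup>2"] by (simp add: field_simps)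
  qed
  moreover have "((\<lambda>y. pi * A * ((K\<^sup>2 + y\<^sup>2) / y\<^sup>2)) \<longlongrightarrow> pi * A * 1) at_top"
    by (intro tendsto_intros) real_asymp
  ultimately have "I \<le> pi * A * 1"
    by (intro tendsto_lowerbound[OF _ _ trivial_limit_at_top_linorder])
  then show ?thesis by (simp add: I_def h_def)
qed

lemma nn_integral_le_of_intervals:
  fixes g :: "real \<Rightarrow> real"
  assumes g: "continuous_on UNIV g" "\<And>k. 0 \<le> g k" and c: "\<And>K. 0 \<le> K \<Longrightarrow> integral {-K..K} g \<le> c"
  shows "(\<integral>\<^sup>+k. ennreal (g k) \<partial>lebesgue) \<le> ennreal c"
proof -
  have gm: "g \<in> borel_measurable borel" using g(1) by (rule borel_measurable_continuous_onI)
  have "(\<integral>\<^sup>+k. ennreal (g k) \<partial>lebesgue) = (\<integral>\<^sup>+k. ennreal (g k) \<partial>lborel)"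
    by (rule nn_integral_completion)
  also have "\<dots> = (\<integral>\<^sup>+k. (SUP n::nat. ennreal (indicator {- real n..real n} k * g k)) \<partial>lborel)"
  proof (rule nn_integral_cong)
    fix k :: real
    obtain m :: nat where m: "\<bar>k\<bar> \<le> real m" using real_arch_simple by blast
    show "ennreal (g k) = (SUP n::nat. ennreal (indicator {- real n..real n} k * g k))"
    proof (rule antisym)
      have "ennreal (g k) = ennreal (indicator {- real m..real m} k * g k)" using m by
          (auto simp: indicator_def)
      also have "\<dots> \<le> (SUP n::nat. ennreal (indicator {- real n..real n} k * g k))" by (rule SUP_upper) simp
      finally show "ennreal (g k) \<le> (SUP n::nat. ennreal (indicator {- real n..real n} k * g k))" .
      show "(SUP n::nat. ennreal (indicator {- real n..real n} k * g k)) \<le> ennreal (g k)"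
        using g(2) by (intro SUP_least) (auto simp: indicator_def)
    qed
  qed
  also have "\<dots> = (SUP n::nat. \<integral>\<^sup>+k. ennreal (indicator {- real n..real n} k * g k) \<partial>lborel)"
  proof (rule nn_integral_monotone_convergence_SUP)
    show "incseq (\<lambda>(n::nat) k. ennreal (indicator {- real n..real n} k * g k))"
      using g(2) by (auto simp: incseq_def le_fun_def indicator_def intro!: ennreal_leI)
  qed (use gm in measurable)
  also have "\<dots> \<le> ennreal c"
  proof (rule SUP_least)
    fix n :: nat
    have "g integrable_on {- real n..real n}"
      using g(1) by (intro integrable_continuous_interval) (auto intro: continuous_on_subset)
    then have "(g has_integral integral {- real n..real n} g) {- real n..real n}"
        by (rule integrable_integral)
    from nn_integral_has_integral_lebesgue[OF _ this] g(2)
    have "(\<integral>\<^sup>+k. ennreal (indicator {- real n..real n} k * g k) \<partial>lborel)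
        = ennreal (integral {- real n..real n} g)"
      by simp
    also have "\<dots> \<le> ennreal c" using c[of "real n"] by (intro ennreal_leI) simp
    finally show "(\<integral>\<^sup>+k. ennreal (indicator {- real n..real n} k * g k) \<partial>lborel) \<le> ennreal c" .
  qed
  finally show ?thesis .
qed

lemma contraction_L1_bound:
  assumes a: "a holomorphic_on UNIV" and le1: "\<And>z. 0 \<le> Im z \<Longrightarrow> cmod (a z) \<le> 1"
    and A: "\<And>y. 0 < y \<Longrightarrow> y * cmod (1 - a (\<i> * of_real y)) \<le> A"
  shows "(\<integral>\<^sup>+k. ennreal (1 - Re (a (of_real k))) \<partial>lebesgue) \<le> ennreal (pi * A)"
proof (rule nn_integral_le_of_intervals)
  show "continuous_on UNIV (\<lambda>k. 1 - Re (a (of_real k)))"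
    by (intro continuous_intros continuous_on_compose2[OF holomorphic_on_imp_continuous_on[OF a]]) auto
  show "0 \<le> 1 - Re (a (of_real k))" for k
    using order_trans[OF complex_Re_le_cmod le1[of "of_real k"]] by simp
qed (rule contraction_L1_bound_interval[OF assms])

lemma (in seeded_system) amp_L1_bound:
  assumes "0 \<le> t"
  shows "(\<integral>\<^sup>+k. ennreal (1 - Re (amp t (of_real k))) \<partial>lebesgue) \<le> ennreal (pi * action t)"
  using assms by (intro contraction_L1_bound amp_holomorphic amp_le_1 action_bound)

section \<open>Minors and the wedge system\<close>

lemma permutes_below: "p permutes {0..<n::nat} \<Longrightarrow> a < n \<Longrightarrow> p a < n"
  using permutes_in_image[of p "{0..<n}" a] by auto

definition minor :: "(nat \<Rightarrow> nat \<Rightarrow> complex) \<Rightarrow> nat \<Rightarrow> (nat \<Rightarrow> nat) \<Rightarrow> complex" where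
  "minor Y n f = Determinant.det (Matrix.mat n n (\<lambda>(a, b). Y (f a) b))"

lemma minor_leibniz:
  "minor Y n f = (\<Sum>p\<in>{p. p permutes {0..<n}}. signof p * (\<Prod>a\<in>{0..<n}. Y (f a) (p a)))"
proof -
  have "minor Y n f = (\<Sum>p\<in>{p. p permutes {0..<n}}. signof p *
      (\<Prod>a\<in>{0..<n}. Matrix.mat n n (\<lambda>(a, b). Y (f a) b) $$ (a, p a)))"
    unfolding minor_def by (rule det_def') auto
  also have "\<dots> = (\<Sum>p\<in>{p. p permutes {0..<n}}. signof p * (\<Prod>a\<in>{0..<n}. Y (f a) (p a)))"
    by (intro sum.cong refl arg_cong[where f="\<lambda>x. _ * x"] prod.cong) (auto dest: permutes_below)
  finally show ?thesis .
qed

lemma minor_not_inj: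
  assumes "\<not> inj_on f {0..<n}"
  shows "minor Y n f = 0"
proof -
  obtain a b where ab: "a < n" "b < n" "a \<noteq> b" "f a = f b"
    using assms by (auto simp: inj_on_def)
  show ?thesis unfolding minor_def
    by (rule det_identical_rows[of _ n a b]) (use ab in \<open>auto simp: row_def\<close>)
qed

lemma minor_cong:
  assumes "\<And>a b. a < n \<Longrightarrow> b < n \<Longrightarrow> Y (f a) b = Z (g a) b"
  shows "minor Y n f = minor Z n g"
  unfolding minor_def using assms by (intro arg_cong[where f=Determinant.det] eq_matI) auto

text \<open>
  States of \<open>n\<close> fermions are described by functions on tuples of levels and not on sets of levels.
  The price is a factor \<open>n!\<close>; the gain is that replacing one level is a function update, without the
  signs that come with reordering.
\<close>

definition tuples :: "nat \<Rightarrow> nat \<Rightarrow> (nat \<Rightarrow> nat) set" where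
  "tuples N n = PiE {0..<n} (\<lambda>_. {0..<N})"

lemma finite_tuples: "finite (tuples N n)"
  unfolding tuples_def by (intro finite_PiE) auto

text \<open>
  Both minors are expanded by the Leibniz formula; the sum over tuples then factorises over positions,
  and each pair of permutations contributes one term of the Leibniz formula for the product matrix.
\<close>

lemma Cauchy_Binet_tuples:
  "(\<Sum>f\<in>tuples N n. minor Y n f * minor Z n f) =
     fact n * Determinant.det (Matrix.mat n n (\<lambda>(a, b). \<Sum>p\<in>{0..<N}. Y p a * Z p b))"
proof -
  define P where "P = {p. p permutes {0..<n}}"
  define M where "M = Matrix.mat n n (\<lambda>(a, b). \<Sum>p\<in>{0..<N}. Y p a * Z p b)"
  have finP: "finite P" unfolding P_def by (intro finite_permutations) auto
  have M: "M \<in> carrier_mat n n" by (simp add: M_def)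
  have "(\<Sum>f\<in>tuples N n. minor Y n f * minor Z n f) =
     (\<Sum>f\<in>tuples N n. \<Sum>\<sigma>\<in>P. \<Sum>\<tau>\<in>P. signof \<sigma> * signof \<tau> * (\<Prod>a\<in>{0..<n}. Y (f a) (\<sigma> a) * Z (f a) (\<tau> a)))"
    unfolding minor_leibniz P_def[symmetric] sum_product prod.distrib by (simp add: mult_ac)
  also have "\<dots> = (\<Sum>\<sigma>\<in>P. \<Sum>\<tau>\<in>P. \<Sum>f\<in>tuples N n. signof \<sigma> * signof \<tau> * (\<Prod>a\<in>{0..<n}. Y (f a) (\<sigma> a)
      * Z (f a) (\<tau> a)))"
    by (subst sum.swap, rule sum.cong[OF refl], rule sum.swap)
  also have "\<dots> = (\<Sum>\<sigma>\<in>P. \<Sum>\<tau>\<in>P. signof \<sigma> * signof \<tau> * (\<Prod>a\<in>{0..<n}. \<Sum>p\<in>{0..<N}. Y p (\<sigma> a) * Z p (\<tau> a)))"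
    unfolding tuples_def sum_distrib_left[symmetric] by (subst prod_sum_PiE) auto
  also have "\<dots> = (\<Sum>\<sigma>\<in>P. signof \<sigma> * (signof \<sigma> * Determinant.det M))"
  proof (rule sum.cong[OF refl])
    fix \<sigma> assume "\<sigma> \<in> P"
    then have \<sigma>: "\<sigma> permutes {0..<n}" by (simp add: P_def)
    have "signof \<sigma> * Determinant.det M = Determinant.det (Matrix.mat n n (\<lambda>(i, j). M $$ (\<sigma> i, j)))"
      by (rule det_permute_rows[OF M \<sigma>, symmetric])
    also have "\<dots> = (\<Sum>\<tau>\<in>P. signof \<tau> * (\<Prod>a\<in>{0..<n}. Matrix.mat n n (\<lambda>(i, j). M $$ (\<sigma> i, j)) $$ (a, \<tau> a)))"
      unfolding P_def by (rule det_def') auto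
    also have "\<dots> = (\<Sum>\<tau>\<in>P. signof \<tau> * (\<Prod>a\<in>{0..<n}. \<Sum>p\<in>{0..<N}. Y p (\<sigma> a) * Z p (\<tau> a)))"
      using \<sigma> by (intro sum.cong refl arg_cong[where f="\<lambda>x. _ * x"] prod.cong)
        (auto dest: permutes_below simp: P_def M_def)
    finally show "(\<Sum>\<tau>\<in>P. signof \<sigma> * signof \<tau> * (\<Prod>a\<in>{0..<n}. \<Sum>p\<in>{0..<N}. Y p (\<sigma> a) * Z p (\<tau> a)))
        = signof \<sigma> * (signof \<sigma> * Determinant.det M)"
      by (simp add: sum_distrib_left mult.assoc)
  qed
  also have "\<dots> = (\<Sum>\<sigma>\<in>P. Determinant.det M)"
    by (intro sum.cong refl) (simp add: sign_def mult.assoc[symmetric])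
  also have "\<dots> = fact n * Determinant.det M"
    by (simp add: P_def card_permutations)
  finally show ?thesis unfolding M_def .
qed

text \<open>
  Indices start at zero, so that the first \<open>n\<close> levels form the set \<open>{0..<n}\<close> and the diagonal entry
  with index \<open>j\<close> belongs to the leading minors of sizes \<open>j\<close> and \<open>j + 1\<close>.
\<close>

locale matrix_system =
  fixes N :: nat and lam :: "nat \<Rightarrow> real" and V :: "real \<Rightarrow> nat \<Rightarrow> nat \<Rightarrow> complex"
    and X :: "real \<Rightarrow> real \<Rightarrow> nat \<Rightarrow> nat \<Rightarrow> complex"
  assumes lam_nonneg: "p < N \<Longrightarrow> 0 \<le> lam p"
    and lam_less: "p < q \<Longrightarrow> q < N \<Longrightarrow> lam p < lam q"
    and V_herm: "0 \<le> t \<Longrightarrow> p < N \<Longrightarrow> q < N \<Longrightarrow> V t p q = cnj (V t q p)"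
    and V_diag: "0 \<le> t \<Longrightarrow> p < N \<Longrightarrow> V t p p = 0"
    and V_int: "0 \<le> t \<Longrightarrow> p < N \<Longrightarrow> q < N \<Longrightarrow> integrable_to t (\<lambda>s. V s p q)"
    and V_sq: "0 \<le> t \<Longrightarrow> p < N \<Longrightarrow> q < N \<Longrightarrow> integrable_to t (\<lambda>s. (cmod (V s p q))\<^sup>2)"
    and X_0: "p < N \<Longrightarrow> q < N \<Longrightarrow> X 0 k p q = (if p = q then 1 else 0)"
    and X_prim: "p < N \<Longrightarrow> q < N \<Longrightarrow> is_primitive (\<lambda>t. X t k p q)
        (\<lambda>s. \<i> * (of_real (k * lam p) * X s k p q + (\<Sum>r\<in>{0..<N}. V s p r * X s k r q)))"
begin

text \<open>
  The product \<open>X\<^bsub>f 0, p 0\<^esub> X\<^bsub>f 1, p 1\<^esub> \<dots>\<close> evolves position by position. The generator acts on the row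
  indices \<open>f\<close> and not on the column indices \<open>p\<close>, so it commutes with the antisymmetrisation over \<open>p\<close>.
\<close>

lemma minor_primitive:
  assumes f: "f \<in> tuples N n" and n: "n \<le> N"
  shows "is_primitive (\<lambda>t. minor (X t k) n f)
     (\<lambda>s. \<i> * (of_real (k * (\<Sum>a\<in>{0..<n}. lam (f a))) * minor (X s k) n f
         + (\<Sum>a\<in>{0..<n}. \<Sum>q\<in>{0..<N}. V s (f a) q * minor (X s k) n (f(a := q)))))"
proof -
  define P where "P = {p. p permutes {0..<n}}"
  define D where "D = (\<lambda>s p c. \<i> * (of_real (k * lam p) * X s k p c + (\<Sum>r\<in>{0..<N}. V s p r * X s k r c)))"
  have finP: "finite P" unfolding P_def by (intro finite_permutations) auto
  have fa: "f a < N" if "a < n" for a using f that by (auto simp: tuples_def)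
  have "is_primitive (\<lambda>t. \<Sum>p\<in>P. signof p * (\<Prod>a\<in>{0..<n}. X t k (f a) (p a)))
      (\<lambda>s. \<Sum>p\<in>P. signof p * (\<Sum>a\<in>{0..<n}. D s (f a) (p a) * (\<Prod>b\<in>{0..<n}-{a}. X s k (f b) (p b))))"
  proof (intro is_primitive_sum finP is_primitive_cmult is_primitive_prod)
    fix p a assume "p \<in> P" "a \<in> {0..<n}"
    then have "p a < N" using n by (auto simp: P_def dest: permutes_below)
    then show "is_primitive (\<lambda>t. X t k (f a) (p a)) (\<lambda>s. D s (f a) (p a))"
      unfolding D_def using fa \<open>a \<in> {0..<n}\<close> by (intro X_prim) auto
  qed auto
  then show ?thesis
  proof (rule is_primitive_cong)
    show "(\<Sum>p\<in>P. signof p * (\<Prod>a\<in>{0..<n}. X t k (f a) (p a))) = minor (X t k) n f" for t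
      by (simp add: minor_leibniz P_def)
    fix s
    have "D s (f a) (p a) * (\<Prod>b\<in>{0..<n}-{a}. X s k (f b) (p b))
       = \<i> * (of_real (k * lam (f a)) * (\<Prod>b\<in>{0..<n}. X s k (f b) (p b))
          + (\<Sum>q\<in>{0..<N}. V s (f a) q * (\<Prod>b\<in>{0..<n}. X s k ((f(a := q)) b) (p b))))"
              if a: "a \<in> {0..<n}" for p a
    proof -
      have "(\<Prod>b\<in>{0..<n}. X s k ((f(a := q)) b) (p b)) = X s k q (p a)
          * (\<Prod>b\<in>{0..<n}-{a}. X s k (f b) (p b))" for q
        using a by (subst prod.remove[of _ a]) (auto intro!: prod.cong)
      moreover have "(\<Prod>b\<in>{0..<n}. X s k (f b) (p b)) = X s k (f a) (p a)
          * (\<Prod>b\<in>{0..<n}-{a}. X s k (f b) (p b))"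
        using a by (subst prod.remove[of _ a]) auto
      ultimately show ?thesis
        by (simp add: D_def algebra_simps sum_distrib_left)
    qed
    then have "(\<Sum>p\<in>P. signof p * (\<Sum>a\<in>{0..<n}. D s (f a) (p a) * (\<Prod>b\<in>{0..<n}-{a}. X s k (f b) (p b))))
      = (\<Sum>p\<in>P. signof p * (\<Sum>a\<in>{0..<n}. \<i> * (of_real (k * lam (f a)) * (\<Prod>b\<in>{0..<n}. X s k (f b) (p b))
          + (\<Sum>q\<in>{0..<N}. V s (f a) q * (\<Prod>b\<in>{0..<n}. X s k ((f(a := q)) b) (p b))))))"
      by simp
    also have "\<dots> = (\<Sum>a\<in>{0..<n}. \<i> * (of_real (k * lam (f a)) * minor (X s k) n f
         + (\<Sum>q\<in>{0..<N}. V s (f a) q * minor (X s k) n (f(a := q)))))"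
    proof -
      have "(\<Sum>p\<in>P. signof p * (\<i> * (of_real (k * lam (f a)) * (\<Prod>b\<in>{0..<n}. X s k (f b) (p b))
          + (\<Sum>q\<in>{0..<N}. V s (f a) q * (\<Prod>b\<in>{0..<n}. X s k ((f(a := q)) b) (p b))))))
        = \<i> * (of_real (k * lam (f a)) * minor (X s k) n f
         + (\<Sum>q\<in>{0..<N}. V s (f a) q * minor (X s k) n (f(a := q))))" for a
        unfolding minor_leibniz P_def[symmetric] by (rule sum_linear_combination)
      note * = this
      show ?thesis
        unfolding sum_distrib_left[of _ _ "{0..<n}"] 
        by (subst sum.swap) (intro sum.cong refl *)
    qed
    also have "\<dots> = \<i> * (of_real (k * (\<Sum>a\<in>{0..<n}. lam (f a))) * minor (X s k) n f
         + (\<Sum>a\<in>{0..<n}. \<Sum>q\<in>{0..<N}. V s (f a) q * minor (X s k) n (f(a := q))))"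
      by (simp add: sum.distrib sum_distrib_left sum_distrib_right distrib_left)
    finally show "(\<Sum>p\<in>P. signof p * (\<Sum>a\<in>{0..<n}. D s (f a) (p a) * (\<Prod>b\<in>{0..<n}-{a}. X s k (f b) (p b))))
      = \<i> * (of_real (k * (\<Sum>a\<in>{0..<n}. lam (f a))) * minor (X s k) n f
         + (\<Sum>a\<in>{0..<n}. \<Sum>q\<in>{0..<N}. V s (f a) q * minor (X s k) n (f(a := q))))" .
  qed
qed

end

text \<open>
  The system for \<open>n\<close> fermions. States are the injective tuples, \<open>mu\<close> is the energy above the ground state,
  and \<open>W\<close> lets \<open>V\<close> act on one position at a time.
\<close>

locale wedge_system = matrix_system +
  fixes n :: nat
  assumes n_less: "n < N"
begin

definition F :: "(nat \<Rightarrow> nat) set" where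
  "F = {f \<in> tuples N n. inj_on f {0..<n}}"

definition ground :: real where
  "ground = (\<Sum>a\<in>{0..<n}. lam a)"

definition mu :: "(nat \<Rightarrow> nat) \<Rightarrow> real" where
  "mu f = (\<Sum>a\<in>{0..<n}. lam (f a)) - ground"

definition W :: "real \<Rightarrow> (nat \<Rightarrow> nat) \<Rightarrow> (nat \<Rightarrow> nat) \<Rightarrow> complex" where
  "W s f g = (\<Sum>a\<in>{0..<n}. if \<forall>b\<in>{0..<n}-{a}. g b = f b then V s (f a) (g a) else 0)"

text \<open>
  The antisymmetrised product of the first \<open>n\<close> basis vectors, normalised over tuples.
\<close>

definition \<phi> :: "(nat \<Rightarrow> nat) \<Rightarrow> complex" where
  "\<phi> f = minor (\<lambda>p q. if p = q then 1 else 0) n f / sqrt (fact n)"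

definition u :: "real \<Rightarrow> (nat \<Rightarrow> nat) \<Rightarrow> complex" where
  "u s g = (\<Sum>f\<in>F. cnj (\<phi> f) * W s f g)"

lemma F_tuples: "F \<subseteq> tuples N n" by (auto simp: F_def)

lemma finite_F: "finite F" using finite_tuples F_tuples by (rule finite_subset[rotated])

lemma F_less: "f \<in> F \<Longrightarrow> a < n \<Longrightarrow> f a < N"
  by (auto simp: F_def tuples_def)

lemma F_upd: "f \<in> tuples N n \<Longrightarrow> a < n \<Longrightarrow> q < N \<Longrightarrow> f(a := q) \<in> tuples N n"
  by (auto simp: tuples_def PiE_iff extensional_def)

lemma \<phi>_F: "f \<in> tuples N n \<Longrightarrow> \<phi> f \<noteq> 0 \<Longrightarrow> f \<in> F"
  using minor_not_inj[of f n] by (auto simp: F_def \<phi>_def)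

lemma cnj_\<phi>: "cnj (\<phi> f) = \<phi> f"
  by (simp add: \<phi>_def minor_leibniz cnj_sum cnj_prod sign_def if_distrib[of cnj] cong: if_cong)

lemma \<phi>_image:
  assumes "f \<in> tuples N n" "\<phi> f \<noteq> 0"
  shows "f ` {0..<n} = {0..<n}"
proof -
  have inj: "inj_on f {0..<n}" using \<phi>_F[OF assms] by (simp add: F_def)
  have "f a < n" if "a < n" for a
  proof (rule ccontr)
    assume "\<not> f a < n"
    then have "(\<Prod>a\<in>{0..<n}. if f a = p a then 1 else 0) = (0::complex)" if "p permutes {0..<n}" for p
      using permutes_below[OF that \<open>a < n\<close>] \<open>a < n\<close> by (intro prod_zero) (auto intro!: bexI[of _ a])
    then have "minor (\<lambda>p q. if p = q then 1 else 0) n f = 0"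
      unfolding minor_leibniz by (intro sum.neutral) auto
    then have "\<phi> f = 0" by (simp add: \<phi>_def)
    then show False using assms by simp
  qed
  then have "f ` {0..<n} \<subseteq> {0..<n}" by auto
  then show ?thesis using inj by (intro endo_inj_surj) auto
qed

lemma sum_lam_perm: "inj_on f {0..<n} \<Longrightarrow> f ` {0..<n} = {0..<n} \<Longrightarrow> (\<Sum>a\<in>{0..<n}. lam (f a)) = ground"
  unfolding ground_def by (metis sum.reindex_cong)

text \<open>
  Replacing levels below \<open>n\<close> by as many levels from \<open>n\<close> on can only raise the energy, and \<open>lam n\<close>
  separates the two groups. This is where the order of the eigenvalues enters.
\<close>

lemma mu_nonneg_strict:
  assumes "f \<in> F"
  shows "0 \<le> mu f" "mu f = 0 \<Longrightarrow> f ` {0..<n} = {0..<n}"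
proof -
  define S where "S = f ` {0..<n}"
  define I where "I = {0..<n}"
  have inj: "inj_on f {0..<n}" using assms by (simp add: F_def)
  have fin: "finite S" "finite I" and card: "card S = card I" by (auto simp: S_def I_def card_image inj)
  have SN: "p < N" if "p \<in> S" for p using that F_less[OF assms] by (auto simp: S_def)
  have "card (S - I) = card (I - S)"
    using card fin by (metis Int_commute card_Diff_subset_Int finite_Int)
  have mu: "mu f = (\<Sum>p\<in>S - I. lam p) - (\<Sum>p\<in>I - S. lam p)"
  proof -
    have "mu f = (\<Sum>p\<in>S. lam p) - (\<Sum>p\<in>I. lam p)"
      by (simp add: mu_def ground_def S_def I_def sum.reindex[OF inj] o_def)
    moreover have "(\<Sum>p\<in>S. lam p) = (\<Sum>p\<in>S \<inter> I. lam p) + (\<Sum>p\<in>S - I. lam p)"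
      using fin by (intro sum.Int_Diff)
    moreover have "(\<Sum>p\<in>I. lam p) = (\<Sum>p\<in>I \<inter> S. lam p) + (\<Sum>p\<in>I - S. lam p)"
      using fin by (intro sum.Int_Diff)
    ultimately show ?thesis by (simp add: Int_commute)
  qed
  \<comment> \<open>\<open>lam n\<close> lies above every vacated level and not above any newly occupied one.\<close>
  have up: "lam n \<le> lam p" if "p \<in> S - I" for p
    using that lam_less[of n p] SN by (cases "p = n") (auto simp: I_def not_less)
  have lo: "lam p < lam n" if "p \<in> I - S" for p
    using that lam_less[of p n] n_less by (auto simp: I_def)
  have 1: "card (S - I) * lam n \<le> (\<Sum>p\<in>S - I. lam p)"
    using sum_bounded_below[of "S - I" "lam n" lam] up by simp
  have 2: "(\<Sum>p\<in>I - S. lam p) \<le> card (I - S) * lam n"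
    using sum_bounded_above[of "I - S" lam "lam n"] lo by (simp add: less_imp_le)
  show "0 \<le> mu f" using 1 2 \<open>card (S - I) = card (I - S)\<close> by (simp add: mu)
  assume "mu f = 0"
  have "I - S = {}"
  proof (rule ccontr)
    assume "I - S \<noteq> {}"
    then have "(\<Sum>p\<in>I - S. lam p) < (\<Sum>p\<in>I - S. lam n)"
      using fin lo by (intro sum_strict_mono) auto
    then show False using 1 \<open>card (S - I) = card (I - S)\<close> \<open>mu f = 0\<close> by (simp add: mu)
  qed
  then have "card (S - I) = 0" using \<open>card (S - I) = card (I - S)\<close> by (metis card.empty)
  then have "S - I = {}" using fin by (metis card_eq_0_iff finite_Diff)
  then have "S = I" using \<open>I - S = {}\<close> by blast
  then show "f ` {0..<n} = {0..<n}" by (simp add: S_def I_def)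
qed

text \<open>
  Updates that leave the injective tuples may be included, because the functions of interest vanish
  there.
\<close>

lemma W_action:
  assumes f: "f \<in> F" and x: "\<And>g. g \<in> tuples N n \<Longrightarrow> g \<notin> F \<Longrightarrow> x g = 0"
  shows "(\<Sum>g\<in>F. W s f g * x g) = (\<Sum>a\<in>{0..<n}. \<Sum>q\<in>{0..<N}. V s (f a) q * x (f(a := q)))"
proof -
  have ft: "f \<in> tuples N n" using f F_tuples by auto
  have "(\<Sum>g\<in>F. W s f g * x g) = (\<Sum>g\<in>tuples N n. W s f g * x g)"
    using x F_tuples finite_tuples by (intro sum.mono_neutral_left) auto
  also have "\<dots> = (\<Sum>a\<in>{0..<n}. \<Sum>g\<in>tuples N n. (if \<forall>b\<in>{0..<n}-{a}. g b
      = f b then V s (f a) (g a) else 0) * x g)"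
    unfolding W_def sum_distrib_right by (rule sum.swap)
  also have "\<dots> = (\<Sum>a\<in>{0..<n}. \<Sum>q\<in>{0..<N}. V s (f a) q * x (f(a := q)))"
  proof (rule sum.cong[OF refl])
    fix a assume a: "a \<in> {0..<n}"
    have inj: "inj_on (\<lambda>q. f(a := q)) {0..<N}" by (auto simp: inj_on_def fun_eq_iff)
    have sub: "(\<lambda>q. f(a := q)) ` {0..<N} \<subseteq> tuples N n" using F_upd[OF ft] a by auto
    have out: "\<not> (\<forall>b\<in>{0..<n}-{a}. g b = f b)" if "g \<in> tuples N n" "g \<notin> (\<lambda>q. f(a := q)) ` {0..<N}" for g
    proof
      assume eq: "\<forall>b\<in>{0..<n}-{a}. g b = f b"
      have "g = f(a := g a)"
      proof
        fix b show "g b = (f(a := g a)) b"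
          using eq that(1) ft by (cases "b < n") (auto simp: tuples_def PiE_iff extensional_def)
      qed
      moreover have "g a < N" using that(1) a by (auto simp: tuples_def)
      ultimately show False using that(2) by auto
    qed
    have "(\<Sum>g\<in>tuples N n. (if \<forall>b\<in>{0..<n}-{a}. g b = f b then V s (f a) (g a) else 0) * x g)
      = (\<Sum>g\<in>(\<lambda>q. f(a := q)) ` {0..<N}. (if \<forall>b\<in>{0..<n}-{a}. g b = f b then V s (f a) (g a) else 0) * x g)"
    proof (rule sum.mono_neutral_right[OF finite_tuples sub], rule ballI)
      fix g assume "g \<in> tuples N n - (\<lambda>q. f(a := q)) ` {0..<N}"
      then have "\<not> (\<forall>b\<in>{0..<n}-{a}. g b = f b)" using out by blast
      then show "(if \<forall>b\<in>{0..<n}-{a}. g b = f b then V s (f a) (g a) else 0) * x g = 0"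
        by (simp only: if_False mult_zero_left)
    qed
    also have "\<dots> = (\<Sum>q\<in>{0..<N}. V s (f a) q * x (f(a := q)))"
      by (subst sum.reindex[OF inj]) (auto intro!: sum.cong)
    finally show "(\<Sum>g\<in>tuples N n. (if \<forall>b\<in>{0..<n}-{a}. g b = f b then V s (f a) (g a) else 0) * x g)
      = (\<Sum>q\<in>{0..<N}. V s (f a) q * x (f(a := q)))" .
  qed
  finally show ?thesis .
qed

lemma W_herm:
  assumes "0 \<le> s" "f \<in> F" "g \<in> F"
  shows "W s f g = cnj (W s g f)"
  unfolding W_def cnj_sum
proof (rule sum.cong[OF refl])
  fix a assume "a \<in> {0..<n}"
  then have "V s (f a) (g a) = cnj (V s (g a) (f a))"
    using assms by (intro V_herm F_less) auto
  moreover have "(\<forall>b\<in>{0..<n}-{a}. g b = f b) \<longleftrightarrow> (\<forall>b\<in>{0..<n}-{a}. f b = g b)" by (metis)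
  ultimately show "(if \<forall>b\<in>{0..<n}-{a}. g b = f b then V s (f a) (g a) else 0) =
      cnj (if \<forall>b\<in>{0..<n}-{a}. f b = g b then V s (g a) (f a) else 0)"
    by (simp only: if_distrib[of cnj] complex_cnj_zero)
qed

lemma W_int: "0 \<le> t \<Longrightarrow> f \<in> F \<Longrightarrow> g \<in> F \<Longrightarrow> integrable_to t (\<lambda>s. W s f g)"
  unfolding W_def
proof (rule set_integral_sum(1))
  fix a assume *: "0 \<le> t" "f \<in> F" "g \<in> F" "a \<in> {0..<n}"
  show "integrable_to t (\<lambda>s. if \<forall>b\<in>{0..<n}-{a}. g b = f b then V s (f a) (g a) else 0)"
  proof (cases "\<forall>b\<in>{0..<n}-{a}. g b = f b")
    case True
    have "integrable_to t (\<lambda>s. V s (f a) (g a))"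
      using * by (intro V_int F_less) auto
    then show ?thesis unfolding if_P[OF True] .
  next
    case False
    show ?thesis unfolding if_not_P[OF False] by (simp add: set_integrable_def)
  qed
qed

lemma \<phi>_unit: "(\<Sum>f\<in>F. (cmod (\<phi> f))\<^sup>2) = 1"
proof -
  define \<delta> where "\<delta> = (\<lambda>p q::nat. if p = q then 1 else (0::complex))"
  have "complex_of_real (\<Sum>f\<in>F. (cmod (\<phi> f))\<^sup>2) = (\<Sum>f\<in>F. \<phi> f * \<phi> f)"
    unfolding of_real_sum by (intro sum.cong refl) (metis complex_norm_square cnj_\<phi>)
  also have "\<dots> = (\<Sum>f\<in>tuples N n. \<phi> f * \<phi> f)"
    using \<phi>_F F_tuples finite_tuples by (intro sum.mono_neutral_left) auto
  also have "\<dots> = (\<Sum>f\<in>tuples N n. minor \<delta> n f * minor \<delta> n f) / fact n"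
  proof -
    have "\<phi> f * \<phi> f = minor \<delta> n f * minor \<delta> n f / fact n" for f
    proof -
      have "complex_of_real (sqrt (fact n)) * complex_of_real (sqrt (fact n)) = fact n"
        by (metis of_real_mult of_real_fact real_sqrt_mult_self abs_of_nonneg fact_ge_zero)
      then show ?thesis by (simp add: \<phi>_def \<delta>_def)
    qed
    then show ?thesis by (simp add: sum_divide_distrib)
  qed
  also have "(\<Sum>f\<in>tuples N n. minor \<delta> n f * minor \<delta> n f) = fact n * Determinant.det (Matrix.mat n n
      (\<lambda>(a, b). \<Sum>p\<in>{0..<N}. \<delta> p a * \<delta> p b))"
    by (rule Cauchy_Binet_tuples)
  also have "Matrix.mat n n (\<lambda>(a, b). \<Sum>p\<in>{0..<N}. \<delta> p a * \<delta> p b) = 1\<^sub>m n"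
  proof (rule eq_matI)
    fix a b assume ab: "a < dim_row (1\<^sub>m n :: complex mat)" "b < dim_col (1\<^sub>m n :: complex mat)"
    have "(\<Sum>p\<in>{0..<N}. \<delta> p a * \<delta> p b) = (\<Sum>p\<in>{0..<N}. if p = a then (if a = b then 1 else 0) else 0)"
      by (intro sum.cong) (auto simp: \<delta>_def)
    then show "Matrix.mat n n (\<lambda>(a, b). \<Sum>p\<in>{0..<N}. \<delta> p a * \<delta> p b) $$ (a, b) = 1\<^sub>m n $$ (a, b)"
      using ab n_less by (simp add: sum.delta)
  qed auto
  finally have "complex_of_real (\<Sum>f\<in>F. (cmod (\<phi> f))\<^sup>2) = 1" by simp
  then show ?thesis by (metis of_real_eq_1_iff)
qed

end

context matrix_system
begin

sublocale base: hermitian_system "{0..<N}" lam V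
proof unfold_locales
  show "V t f g = cnj (V t g f)" if "0 \<le> t" "f \<in> {0..<N}" "g \<in> {0..<N}" for t f g
    using that by (intro V_herm) auto
qed (auto intro: lam_nonneg V_int)

lemma column_solves:
  "q < N \<Longrightarrow> base.solves (of_real k) (\<lambda>p. if p = q then 1 else 0) (\<lambda>t p. X t k p q)"
  unfolding base.solves_def base.rhs_def using X_0 X_prim by auto

lemma columns_orthonormal:
  assumes "q < N" "r < N" "0 \<le> t"
  shows "(\<Sum>p\<in>{0..<N}. cnj (X t k p q) * X t k p r) = (if q = r then 1 else 0)"
proof -
  have "(\<Sum>p\<in>{0..<N}. cnj (X t k p q) * X t k p r) = (\<Sum>p\<in>{0..<N}. (if p = r then 1 else 0)
      * cnj (if p = q then 1 else 0))"
    using base.inner_conserved[OF column_solves[OF assms(2)] column_solves[OF assms(1)] assms(3), of k]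
    by (simp only: mult.commute)
  also have "\<dots> = (\<Sum>p\<in>{0..<N}. if p = r then (if q = r then 1 else 0) else 0)"
    by (intro sum.cong) auto
  finally show ?thesis using assms by simp
qed

text \<open>
  Nothing is assumed about the dependence of \<open>X\<close> on \<open>k\<close>. Its regularity comes from uniqueness, which
  identifies each column with the restriction of an entire function.
\<close>

lemma X_continuous:
  assumes "p < N" "q < N" "0 \<le> t"
  shows "continuous_on UNIV (\<lambda>k. X t k p q)"
proof -
  have "X t k p q = base.solution (\<lambda>p. if p = q then 1 else 0) (of_real k) t p" for k
    using base.solution_unique[OF column_solves[OF assms(2)] base.solves_solution assms(3), of p k] assms(1) by simp
  moreover have "continuous_on UNIV (\<lambda>k. base.solution (\<lambda>p. if p = q then 1 else 0) (of_real k) t p)"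
    by (rule continuous_on_compose2[OF holomorphic_on_imp_continuous_on[OF base.solution_holomorphic]])
       (use assms in \<open>auto intro!: continuous_intros\<close>)
  ultimately show ?thesis by simp
qed

end

context wedge_system
begin

definition swap :: "nat \<Rightarrow> nat \<Rightarrow> (nat \<Rightarrow> nat) \<Rightarrow> nat \<Rightarrow> nat" where
  "swap m l g = restrict (Transposition.transpose m l \<circ> g) {0..<n}"

lemma u_eq:
  assumes "0 \<le> s" "g \<in> F"
  shows "u s g = cnj (\<Sum>a\<in>{0..<n}. \<Sum>q\<in>{0..<N}. V s (g a) q * \<phi> (g(a := q)))"
proof -
  have "u s g = cnj (\<Sum>f\<in>F. W s g f * \<phi> f)"
    unfolding u_def cnj_sum
  proof (intro sum.cong refl)
    fix f assume "f \<in> F"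
    then have "W s f g = cnj (W s g f)" using assms by (intro W_herm)
    then show "cnj (\<phi> f) * W s f g = cnj (W s g f * \<phi> f)" by (simp add: mult.commute)
  qed
  also have "(\<Sum>f\<in>F. W s g f * \<phi> f) = (\<Sum>a\<in>{0..<n}. \<Sum>q\<in>{0..<N}. V s (g a) q * \<phi> (g(a := q)))"
    using \<phi>_F by (intro W_action assms) auto
  finally show ?thesis .
qed

text \<open>
  A tuple coupled to the ground state differs from a permutation of the first \<open>n\<close> levels in exactly one
  entry. An exchange within these levels would return the same level, where the diagonal of \<open>V\<close>
  vanishes.
\<close>

lemma exchange:
  assumes s: "0 \<le> s" and g: "g \<in> F" and a: "a < n" and q: "q < N" and nz: "V s (g a) q * \<phi> (g(a := q)) \<noteq> 0"
  shows "q < n" "n \<le> g a" "q \<notin> g ` {0..<n}" "(g(a := q)) ` {0..<n} = {0..<n}" "inj_on (g(a := q)) {0..<n}"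
proof -
  have gt: "g(a := q) \<in> tuples N n" using g F_tuples a q by (intro F_upd) auto
  have ph: "\<phi> (g(a := q)) \<noteq> 0" using nz by auto
  show im: "(g(a := q)) ` {0..<n} = {0..<n}" by (rule \<phi>_image[OF gt ph])
  show inj: "inj_on (g(a := q)) {0..<n}" using \<phi>_F[OF gt ph] by (simp add: F_def)
  have injg: "inj_on g {0..<n}" using g by (simp add: F_def)
  show qn: "q < n" using im a by (metis atLeastLessThan_iff fun_upd_same imageI le0)
  have "q \<noteq> g a" using nz V_diag[OF s F_less[OF g a]] by auto
  show ga: "n \<le> g a"
  proof (rule ccontr)
    assume "\<not> n \<le> g a"
    then have "g a \<in> (g(a := q)) ` {0..<n}" using im by auto
    then obtain b where b: "b < n" "g a = (g(a := q)) b" by auto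
    have "b \<noteq> a" using b(2) \<open>q \<noteq> g a\<close> by (metis fun_upd_same)
    then have "g a = g b" using b(2) by (metis fun_upd_other)
    then have "a = b" using inj_onD[OF injg, of a b] a b(1) by simp
    then show False using \<open>b \<noteq> a\<close> by simp
  qed
  show "q \<notin> g ` {0..<n}"
  proof
    assume "q \<in> g ` {0..<n}"
    then obtain b where b: "b < n" "q = g b" by auto
    have "b \<noteq> a"
    proof
      assume "b = a"
      then have "n \<le> q" using b(2) ga by (simp only:)
      then show False using qn by linarith
    qed
    then have "(g(a := q)) b = g b" by (rule fun_upd_other)
    also have "\<dots> = q" by (rule b(2)[symmetric])
    also have "q = (g(a := q)) a" by (rule fun_upd_same[symmetric])
    finally have "(g(a := q)) b = (g(a := q)) a" .
    from inj_onD[OF inj this] have "b = a" using a b(1) by (simp only: atLeastLessThan_iff le0 simp_thms)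
    with \<open>b \<noteq> a\<close> show False by (rule notE)
  qed
qed

abbreviation (input) leak :: "real \<Rightarrow> (nat \<Rightarrow> nat) \<Rightarrow> real" where
  "leak s g \<equiv> \<Sum>m\<in>{0..<n}. \<Sum>l\<in>{n..<N}.
     inverse (lam l - lam m) * (cmod (V s m l))\<^sup>2 * (cmod (\<phi> (swap m l g)))\<^sup>2"

text \<open>
  Either no exchange leads to the ground state, and then \<open>u\<close> vanishes, or exactly one does. In the latter
  case it replaces some \<open>l \<ge> n\<close> by some \<open>m < n\<close>, the excess energy is \<open>lam l - lam m\<close>, and the term of the
  sum with this \<open>m\<close> and \<open>l\<close>, times the excess energy, already equals the left-hand side.
\<close>

lemma u_square_bound:
  assumes s: "0 \<le> s" and g: "g \<in> F"
  shows "(cmod (u s g))\<^sup>2 \<le> mu g * leak s g"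
proof -
  define B where "B = (\<lambda>m l. inverse (lam l - lam m) * (cmod (V s m l))\<^sup>2 * (cmod (\<phi> (swap m l g)))\<^sup>2)"
  have B0: "0 \<le> B m l" if "m \<in> {0..<n}" "l \<in> {n..<N}" for m l
    using lam_less[of m l] that by (auto simp: B_def)
  define h where "h = (\<lambda>a q. V s (g a) q * \<phi> (g(a := q)))"
  have u: "u s g = cnj (\<Sum>a\<in>{0..<n}. \<Sum>q\<in>{0..<N}. h a q)" using u_eq[OF s g] by (simp add: h_def)
  have "(cmod (u s g))\<^sup>2 \<le> mu g * (\<Sum>m\<in>{0..<n}. \<Sum>l\<in>{n..<N}. B m l)"
  proof (cases "\<exists>a<n. \<exists>q<N. h a q \<noteq> 0")
    case False
    then have "u s g = 0" unfolding u by (auto intro!: sum.neutral)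
    then show ?thesis using mu_nonneg_strict(1)[OF g] B0 by (auto intro!: mult_nonneg_nonneg sum_nonneg)
  next
    case True
    then obtain a m where am: "a < n" "m < N" "h a m \<noteq> 0" by blast
    note e = exchange[OF s g am(1,2) am(3)[unfolded h_def]]
    define l where "l = g a"
    have lN: "l < N" using F_less[OF g am(1)] by (simp add: l_def)
    have injg: "inj_on g {0..<n}" using g by (simp add: F_def)
    have other: "h b q = (if b = a then (if q = m then h a m else 0) else 0)"
        if "b \<in> {0..<n}" "q \<in> {0..<N}" for b q
    proof (cases "h b q = 0")
      case False
      then have e': "q < n" "q \<notin> g ` {0..<n}" "(g(b := q)) ` {0..<n} = {0..<n}"
        using exchange[OF s g, of b q] that by (auto simp: h_def)
      have "b = a"
      proof (rule ccontr)
        assume "b \<noteq> a"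
        then have "g a \<in> (g(b := q)) ` {0..<n}" using am(1) by (auto intro!: image_eqI[of _ _ a])
        then have "g a \<in> {0..<n}" unfolding e'(3) .
        then show False using e(2) by simp
      qed
      moreover have "q = m"
      proof (rule ccontr)
        assume "q \<noteq> m"
        have "m \<in> (g(b := q)) ` {0..<n}" using e'(3) e(1) by auto
        then show False using e(3) \<open>q \<noteq> m\<close> by (auto split: if_splits)
      qed
      ultimately show ?thesis by simp
    qed (use am in auto)
    have "(\<Sum>b\<in>{0..<n}. \<Sum>q\<in>{0..<N}. h b q) = (\<Sum>b\<in>{0..<n}. \<Sum>q\<in>{0..<N}. if b = a then (if q
        = m then h a m else 0) else 0)"
      by (intro sum.cong refl other)
    also have "\<dots> = (\<Sum>b\<in>{0..<n}. if b = a then (\<Sum>q\<in>{0..<N}. if q = m then h a m else 0) else 0)"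
      by (intro sum.cong refl) auto
    also have "\<dots> = h a m" using am by simp
    finally have uh: "(cmod (u s g))\<^sup>2 = (cmod (h a m))\<^sup>2" unfolding u by simp
    have sw: "swap m l g = g(a := m)"
    proof
      fix b
      show "swap m l g b = (g(a := m)) b"
      proof (cases "b < n")
        case True
        have "g b \<noteq> m" using e(3) True by (metis atLeastLessThan_iff imageI le0)
        moreover have "g b \<noteq> l" if "b \<noteq> a"
          using inj_onD[OF injg, of b a] True am(1) that by (auto simp only: l_def atLeastLessThan_iff le0)
        moreover have "swap m l g b = Transposition.transpose m l (g b)"
          using True by (simp add: swap_def)
        ultimately show ?thesis
          by (cases "b = a") (simp_all add: l_def[symmetric] transpose_apply_other)
      next
        case False
        then have "g b = undefined" using g by (auto simp: F_def tuples_def PiE_iff extensional_def)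
        then show ?thesis using False am(1) by (auto simp: swap_def)
      qed
    qed
    have mu: "mu g = lam l - lam m"
    proof -
      have "ground = (\<Sum>b\<in>{0..<n}. lam ((g(a := m)) b))" using sum_lam_perm[OF e(5,4)] by simp
      also have "\<dots> = lam m + (\<Sum>b\<in>{0..<n}-{a}. lam (g b))"
        using am(1) by (subst sum.remove[of _ a]) (auto intro!: sum.cong)
      finally have 1: "ground = lam m + (\<Sum>b\<in>{0..<n}-{a}. lam (g b))" .
      have "(\<Sum>b\<in>{0..<n}. lam (g b)) = lam l + (\<Sum>b\<in>{0..<n}-{a}. lam (g b))"
        using am(1) by (subst sum.remove[of _ a]) (auto simp: l_def)
      then show ?thesis using 1 by (simp add: mu_def)
    qed
    have lm: "lam m < lam l" using lam_less[of m l] e(1,2) lN by (simp add: l_def)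
    have "cmod (V s l m) = cmod (V s m l)"
      by (subst V_herm[OF s lN am(2)]) (rule complex_mod_cnj)
    then have "(cmod (h a m))\<^sup>2 = mu g * B m l"
      using lm by (simp add: h_def B_def sw mu norm_mult power_mult_distrib l_def[symmetric])
    also have "\<dots> \<le> mu g * (\<Sum>m\<in>{0..<n}. \<Sum>l\<in>{n..<N}. B m l)"
    proof (rule mult_left_mono)
      have "B m l \<le> (\<Sum>l\<in>{n..<N}. B m l)"
        using e(1,2) lN B0 by (intro member_le_sum) (auto simp: l_def)
      also have "\<dots> \<le> (\<Sum>m\<in>{0..<n}. \<Sum>l\<in>{n..<N}. B m l)"
        using e(1) B0 by (intro member_le_sum[of m _ "\<lambda>m. \<Sum>l\<in>{n..<N}. B m l"]) (auto intro!: sum_nonneg)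
      finally show "B m l \<le> (\<Sum>m\<in>{0..<n}. \<Sum>l\<in>{n..<N}. B m l)" .
      show "0 \<le> mu g" by (rule mu_nonneg_strict(1)[OF g])
    qed
    finally show ?thesis using uh by simp
  qed
  then show ?thesis by (simp only: B_def)
qed

lemma swap_F:
  assumes "g \<in> F" "m < N" "l < N"
  shows "swap m l g \<in> F" "swap m l (swap m l g) = g"
proof -
  have tr: "Transposition.transpose m l p < N" if "p < N" for p
    using assms(2,3) that by (cases "p = m"; cases "p = l") simp_all
  have "swap m l g \<in> tuples N n"
    unfolding swap_def tuples_def using tr F_less[OF assms(1)] by (intro restrict_PiE_iff[THEN iffD2]) auto
  moreover have "inj_on (swap m l g) {0..<n}"
    using assms(1) by (auto simp: F_def swap_def inj_on_def dest!: transpose_eq_imp_eq)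
  ultimately show "swap m l g \<in> F" by (simp add: F_def)
  show "swap m l (swap m l g) = g"
  proof
    fix b
    show "swap m l (swap m l g) b = g b"
      using assms(1) by (cases "b < n") (auto simp: swap_def F_def tuples_def PiE_iff extensional_def)
  qed
qed

text \<open>
  For fixed levels \<open>m\<close> and \<open>l\<close> the swap permutes the states, so the weights add up to at most one. This
  removes the factor \<open>n!\<close> and makes the constant independent of \<open>n\<close> and \<open>N\<close>.
\<close>

lemma sum_swap_le:
  assumes "m < N" "l < N"
  shows "(\<Sum>g\<in>F. (cmod (\<phi> (swap m l g)))\<^sup>2) \<le> 1"
proof -
  have inj: "inj_on (swap m l) F" using swap_F(2) assms by (metis inj_on_inverseI)
  have "(\<Sum>g\<in>F. (cmod (\<phi> (swap m l g)))\<^sup>2) = (\<Sum>h\<in>swap m l ` F. (cmod (\<phi> h))\<^sup>2)"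
    by (simp add: sum.reindex[OF inj])
  also have "\<dots> \<le> (\<Sum>h\<in>F. (cmod (\<phi> h))\<^sup>2)"
    using swap_F(1) assms finite_F by (intro sum_mono2) auto
  finally show ?thesis by (simp add: \<phi>_unit)
qed

lemma u_square_integrable:
  assumes t: "0 \<le> t" and g: "g \<in> F"
  shows "integrable_to t (\<lambda>s. (cmod (u s g))\<^sup>2)"
proof (rule set_integrable_bound)
  have *: "integrable_to t (\<lambda>s. inverse (lam l - lam m) * (cmod (V s m l))\<^sup>2 * (cmod (\<phi> (swap m l g)))\<^sup>2)"
    if "m \<in> {0..<n}" "l \<in> {n..<N}" for m l
    using V_sq[OF t, of m l] that n_less by (intro set_integrable_mult_left set_integrable_mult_right) auto
  show "integrable_to t (\<lambda>s. mu g * leak s g)"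
    by (intro set_integrable_mult_right set_integral_sum *)
  have "integrable_to t (\<lambda>s. u s g)"
    unfolding u_def using t g by (intro set_integral_sum set_integrable_mult_right W_int)
  then have m: "(\<lambda>s. indicator {0..t} s *\<^sub>R u s g) \<in> borel_measurable lebesgue"
    by (auto simp: set_integrable_def)
  have "(\<lambda>s. (cmod (indicator {0..t} s *\<^sub>R u s g))\<^sup>2) \<in> borel_measurable lebesgue"
    using m by measurable
  moreover have "(\<lambda>s. (cmod (indicator {0..t} s *\<^sub>R u s g))\<^sup>2) = (\<lambda>s. indicator {0..t} s
      *\<^sub>R (cmod (u s g))\<^sup>2)"
    by (auto simp: indicator_def)
  ultimately show "set_borel_measurable lebesgue {0..t} (\<lambda>s. (cmod (u s g))\<^sup>2)"
    by (simp add: set_borel_measurable_def)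
  show "AE s in lebesgue. s \<in> {0..t} \<longrightarrow> norm ((cmod (u s g))\<^sup>2) \<le> norm (mu g * leak s g)"
    using u_square_bound[OF _ g] by (intro AE_I2) (auto intro: order_trans[OF _ abs_ge_self])
qed

sublocale seeded_system F mu W \<phi> u
proof unfold_locales
  show "u s g = (\<Sum>f\<in>F. cnj (\<phi> f) * W s f g)" for s g
    by (rule u_def)
  show "mu f = 0" if "f \<in> F" "\<phi> f \<noteq> 0" for f
    using sum_lam_perm[of f] \<phi>_image[of f] that F_tuples by (auto simp: mu_def F_def)
  show "u t g = 0" if "0 \<le> t" "g \<in> F" "mu g = 0" for t g
    using u_square_bound[OF that(1,2)] that(3) by simp
qed (fact finite_F mu_nonneg_strict(1) W_herm W_int \<phi>_unit u_square_integrable)+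

definition gap_action :: "real \<Rightarrow> real" where
  "gap_action t = (\<Sum>m\<in>{0..<n}. \<Sum>l\<in>{n..<N}. inverse (lam l - lam m) * integral_to t
      (\<lambda>s. (cmod (V s m l))\<^sup>2))"

lemma action_le_gap_action:
  assumes t: "0 \<le> t"
  shows "action t \<le> gap_action t"
proof -
  define I where "I = (\<lambda>m l. integral_to t (\<lambda>s. (cmod (V s m l))\<^sup>2))"
  define c where "c = (\<lambda>m l. inverse (lam l - lam m))"
  define w where "w = (\<lambda>m l g. (cmod (\<phi> (swap m l g)))\<^sup>2)"
  have I0: "0 \<le> I m l" for m l
    unfolding I_def set_lebesgue_integral_def by (intro Bochner_Integration.integral_nonneg) auto
  have c0: "0 \<le> c m l" if "m \<in> {0..<n}" "l \<in> {n..<N}" for m l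
    using lam_less[of m l] that by (auto simp: c_def)
  have w0: "0 \<le> w m l g" for m l g by (simp add: w_def)
  have step: "inverse (mu g) * integral_to t (\<lambda>s. (cmod (u s g))\<^sup>2)
      \<le> (\<Sum>m\<in>{0..<n}. \<Sum>l\<in>{n..<N}. c m l * I m l * w m l g)" if g: "g \<in> F" for g
  proof -
    have i: "integrable_to t (\<lambda>s. c m l * (cmod (V s m l))\<^sup>2 * w m l g)"
        if "m \<in> {0..<n}" "l \<in> {n..<N}" for m l
      using V_sq[OF t, of m l] that n_less
          by (intro set_integrable_mult_left set_integrable_mult_right) auto
    have i2: "integrable_to t (\<lambda>s. \<Sum>l\<in>{n..<N}. c m l * (cmod (V s m l))\<^sup>2 * w m l g)" if "m \<in> {0..<n}" for m
      using i that by (intro set_integral_sum) auto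
    have "inverse (mu g) * integral_to t (\<lambda>s. (cmod (u s g))\<^sup>2)
       = integral_to t (\<lambda>s. inverse (mu g) * (cmod (u s g))\<^sup>2)"
      by (rule set_integral_mult_right[symmetric])
    also have "\<dots> \<le> integral_to t (\<lambda>s. \<Sum>m\<in>{0..<n}. \<Sum>l\<in>{n..<N}. c m l * (cmod (V s m l))\<^sup>2 * w m l g)"
    proof (rule set_integral_mono)
      show "integrable_to t (\<lambda>s. inverse (mu g) * (cmod (u s g))\<^sup>2)"
        by (intro set_integrable_mult_right u_square_integrable t g)
      show "integrable_to t (\<lambda>s. \<Sum>m\<in>{0..<n}. \<Sum>l\<in>{n..<N}. c m l * (cmod (V s m l))\<^sup>2 * w m l g)"
        using i2 by (rule set_integral_sum(1))
      fix s assume "s \<in> {0..t}"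
      then have b: "(cmod (u s g))\<^sup>2 \<le> mu g * (\<Sum>m\<in>{0..<n}. \<Sum>l\<in>{n..<N}. c m l * (cmod (V s m l))\<^sup>2
          * w m l g)"
        using u_square_bound[OF _ g, of s] by (simp add: c_def w_def)
      show "inverse (mu g) * (cmod (u s g))\<^sup>2 \<le> (\<Sum>m\<in>{0..<n}. \<Sum>l\<in>{n..<N}. c m l * (cmod (V s m l))\<^sup>2
          * w m l g)"
      proof (cases "mu g = 0")
        case True
        then show ?thesis using c0 w0 by (auto intro!: sum_nonneg mult_nonneg_nonneg)
      next
        case False
        then have "0 < mu g" using mu_nonneg_strict(1)[OF g] by simp
        then show ?thesis using b by (simp add: field_simps)
      qed
    qed
    also have "\<dots> = (\<Sum>m\<in>{0..<n}. integral_to t (\<lambda>s. \<Sum>l\<in>{n..<N}. c m l * (cmod (V s m l))\<^sup>2 * w m l g))"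
      using i2 by (rule set_integral_sum(2))
    also have "\<dots> = (\<Sum>m\<in>{0..<n}. \<Sum>l\<in>{n..<N}. integral_to t (\<lambda>s. c m l * (cmod (V s m l))\<^sup>2 * w m l g))"
      using i by (intro sum.cong refl set_integral_sum(2))
    also have "\<dots> = (\<Sum>m\<in>{0..<n}. \<Sum>l\<in>{n..<N}. c m l * I m l * w m l g)"
      by (simp only: I_def set_integral_mult_left set_integral_mult_right)
    finally show ?thesis .
  qed
  have "action t \<le> (\<Sum>g\<in>F. \<Sum>m\<in>{0..<n}. \<Sum>l\<in>{n..<N}. c m l * I m l * w m l g)"
    unfolding action_def by (intro sum_mono step)
  also have "\<dots> = (\<Sum>m\<in>{0..<n}. \<Sum>l\<in>{n..<N}. \<Sum>g\<in>F. c m l * I m l * w m l g)"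
    by (subst sum.swap, rule sum.cong[OF refl], rule sum.swap)
  also have "\<dots> \<le> (\<Sum>m\<in>{0..<n}. \<Sum>l\<in>{n..<N}. c m l * I m l)"
  proof (intro sum_mono)
    fix m l assume ml: "m \<in> {0..<n}" "l \<in> {n..<N}"
    have "(\<Sum>g\<in>F. c m l * I m l * w m l g) = c m l * I m l * (\<Sum>g\<in>F. w m l g)"
      by (simp add: sum_distrib_left)
    also have "\<dots> \<le> c m l * I m l * 1"
      using sum_swap_le[of m l] ml n_less c0 I0 by (intro mult_left_mono) (auto simp: w_def)
    finally show "(\<Sum>g\<in>F. c m l * I m l * w m l g) \<le> c m l * I m l" by simp
  qed
  finally show ?thesis by (simp only: gap_action_def c_def I_def)
qed

definition \<omega> :: "real \<Rightarrow> real \<Rightarrow> (nat \<Rightarrow> nat) \<Rightarrow> complex" where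
  "\<omega> k t f = exp (- \<i> * of_real (k * ground) * of_real t) * minor (X t k) n f / sqrt (fact n)"

lemma \<omega>_solves: "solves (of_real k) \<phi> (\<omega> k)"
  unfolding solves_def
proof (intro ballI conjI)
  fix f assume f: "f \<in> F"
  have ft: "f \<in> tuples N n" using f F_tuples by auto
  have "minor (X 0 k) n f = minor (\<lambda>p q. if p = q then 1 else 0) n f"
    using F_less[OF f] n_less by (intro minor_cong X_0) auto
  then show "\<omega> k 0 f = \<phi> f" by (simp add: \<omega>_def \<phi>_def)
  define E where "E = (\<lambda>t. exp (- \<i> * of_real (k * ground) * complex_of_real t))"
  define S where "S = complex_of_real (sqrt (fact n))"
  have "is_primitive (\<lambda>t. 1 / S * (E t * minor (X t k) n f)) (\<lambda>s. 1 / S * (- \<i> * of_real (k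
      * ground) * E s * minor (X s k) n f
     + E s * (\<i> * (of_real (k * (\<Sum>a\<in>{0..<n}. lam (f a))) * minor (X s k) n f
         + (\<Sum>a\<in>{0..<n}. \<Sum>q\<in>{0..<N}. V s (f a) q * minor (X s k) n (f(a := q)))))))"
    unfolding E_def using n_less
    by (intro is_primitive_cmult is_primitive_mult is_primitive_exp minor_primitive[OF ft]) auto
  then show "is_primitive (\<lambda>t. \<omega> k t f) (\<lambda>s. rhs (of_real k) s (\<omega> k s) f)"
  proof (rule is_primitive_cong)
    show "1 / S * (E t * minor (X t k) n f) = \<omega> k t f" for t
      by (simp add: \<omega>_def E_def S_def)
    fix s
    have "(\<Sum>g\<in>F. W s f g * \<omega> k s g) = (\<Sum>a\<in>{0..<n}. \<Sum>q\<in>{0..<N}. V s (f a) q * \<omega> k s (f(a := q)))"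
      using minor_not_inj by (intro W_action f) (auto simp: F_def \<omega>_def)
    also have "\<dots> = 1 / S * E s * (\<Sum>a\<in>{0..<n}. \<Sum>q\<in>{0..<N}. V s (f a) q * minor (X s k) n (f(a := q)))"
      by (simp add: \<omega>_def E_def S_def sum_distrib_left mult_ac)
    finally have act: "(\<Sum>g\<in>F. W s f g * \<omega> k s g) = 1 / S * E s *
        (\<Sum>a\<in>{0..<n}. \<Sum>q\<in>{0..<N}. V s (f a) q * minor (X s k) n (f(a := q)))" .
    have alg: "1 / S * (- \<i> * of_real (k * G) * e * M + e * (\<i> * (of_real (k * L) * M + Q)))
       = \<i> * (of_real k * of_real (L - G) * (e * M / S) + 1 / S * e * Q)" for G L e M Q
      by (simp add: algebra_simps add_divide_distrib diff_divide_distrib)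
    have \<omega>: "\<omega> k s f = E s * minor (X s k) n f / S" by (simp add: \<omega>_def E_def S_def)
    show "1 / S * (- \<i> * of_real (k * ground) * E s * minor (X s k) n f
     + E s * (\<i> * (of_real (k * (\<Sum>a\<in>{0..<n}. lam (f a))) * minor (X s k) n f
         + (\<Sum>a\<in>{0..<n}. \<Sum>q\<in>{0..<N}. V s (f a) q * minor (X s k) n (f(a := q))))))
             = rhs (of_real k) s (\<omega> k s) f"
      unfolding rhs_def act unfolding \<omega> mu_def by (rule alg)
  qed
qed

text \<open>
  The leading minor with the phase of the free evolution of the ground state removed.
\<close>

definition lead :: "real \<Rightarrow> real \<Rightarrow> complex" where
  "lead k t = exp (- \<i> * of_real (k * ground) * of_real t) * minor (X t k) n id"

lemma amp_eq_lead:
  assumes t: "0 \<le> t"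
  shows "amp t (of_real k) = lead k t"
proof -
  define \<delta> where "\<delta> = (\<lambda>p q::nat. if p = q then 1 else (0::complex))"
  define E where "E = exp (- \<i> * of_real (k * ground) * complex_of_real t)"
  have sq: "complex_of_real (sqrt (fact n)) * complex_of_real (sqrt (fact n)) = fact n"
    by (metis of_real_mult of_real_fact real_sqrt_mult_self abs_of_nonneg fact_ge_zero)
  have "amp t (of_real k) = (\<Sum>f\<in>F. \<phi> f * \<omega> k t f)"
    unfolding amp_def using solution_unique[OF solves_solution \<omega>_solves t]
    by (intro sum.cong refl) (simp add: cnj_\<phi>)
  also have "\<dots> = (\<Sum>f\<in>tuples N n. \<phi> f * \<omega> k t f)"
    using \<phi>_F F_tuples finite_tuples by (intro sum.mono_neutral_left) auto
  also have "\<dots> = (\<Sum>f\<in>tuples N n. E / fact n * (minor \<delta> n f * minor (X t k) n f))"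
    using sq by (intro sum.cong refl) (simp add: \<phi>_def \<omega>_def \<delta>_def E_def mult_ac)
  also have "\<dots> = E / fact n * (\<Sum>f\<in>tuples N n. minor \<delta> n f * minor (X t k) n f)"
    by (rule sum_distrib_left[symmetric])
  also have "(\<Sum>f\<in>tuples N n. minor \<delta> n f * minor (X t k) n f)
     = fact n * Determinant.det (Matrix.mat n n (\<lambda>(a, b). \<Sum>p\<in>{0..<N}. \<delta> p a * X t k p b))"
    by (rule Cauchy_Binet_tuples)
  also have "Matrix.mat n n (\<lambda>(a, b). \<Sum>p\<in>{0..<N}. \<delta> p a * X t k p b) = Matrix.mat n n (\<lambda>(a, b). X t k a b)"
  proof (rule eq_matI)
    fix a b assume ab: "a < dim_row (Matrix.mat n n
        (\<lambda>(a, b). X t k a b))" "b < dim_col (Matrix.mat n n (\<lambda>(a, b). X t k a b))"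
    have "(\<Sum>p\<in>{0..<N}. \<delta> p a * X t k p b) = (\<Sum>p\<in>{0..<N}. if p = a then X t k a b else 0)"
      by (intro sum.cong) (auto simp: \<delta>_def)
    then show "Matrix.mat n n (\<lambda>(a, b). \<Sum>p\<in>{0..<N}. \<delta> p a * X t k p b) $$ (a, b) = Matrix.mat n n
        (\<lambda>(a, b). X t k a b) $$ (a, b)"
      using ab n_less by simp
  qed auto
  finally show ?thesis by (simp add: lead_def E_def minor_def)
qed

lemma lead_le_1: "0 \<le> t \<Longrightarrow> cmod (lead k t) \<le> 1"
  using amp_le_1[of "of_real k" t] by (simp add: amp_eq_lead)

lemma lead_continuous:
  assumes "0 \<le> t"
  shows "continuous_on UNIV (\<lambda>k. lead k t)"
proof -
  have "continuous_on UNIV (\<lambda>k. amp t (of_real k))"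
    by (rule continuous_on_compose2[OF holomorphic_on_imp_continuous_on[OF amp_holomorphic[OF assms]]])
       (auto intro!: continuous_intros)
  then show ?thesis by (simp only: amp_eq_lead[OF assms])
qed

lemma lead_L1_bound:
  assumes "0 \<le> t"
  shows "(\<integral>\<^sup>+k. ennreal (1 - Re (lead k t)) \<partial>lebesgue) \<le> ennreal (pi * gap_action t)"
proof -
  have "(\<integral>\<^sup>+k. ennreal (1 - Re (lead k t)) \<partial>lebesgue) \<le> ennreal (pi * action t)"
    using amp_L1_bound[OF assms] by (simp add: amp_eq_lead[OF assms])
  also have "\<dots> \<le> ennreal (pi * gap_action t)"
    using action_le_gap_action[OF assms] by (intro ennreal_leI mult_left_mono) auto
  finally show ?thesis .
qed

end

section \<open>Diagonal entries as quotients of leading minors\<close>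

lemma minor_permute:
  assumes "p permutes {0..<n}"
  shows "minor Y n (f \<circ> p) = signof p * minor Y n f"
proof -
  have "minor Y n (f \<circ> p) = Determinant.det (Matrix.mat n n (\<lambda>(i, j). Matrix.mat n n
      (\<lambda>(a, b). Y (f a) b) $$ (p i, j)))"
    unfolding minor_def using permutes_below[OF assms]
    by (intro arg_cong[where f=Determinant.det] eq_matI) auto
  also have "\<dots> = signof p * minor Y n f"
    unfolding minor_def by (rule det_permute_rows[OF _ assms]) simp
  finally show ?thesis .
qed

lemma minor_cnj: "minor (\<lambda>p q. cnj (Y p q)) n f = cnj (minor Y n f)"
  by (simp add: minor_leibniz sign_def if_distrib[of cnj] cong: if_cong)

text \<open>
  Each family of rows occurs in \<open>n!\<close> orders among the tuples, and by Cauchy--Binet the squared minors over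
  all tuples add up to \<open>n!\<close>.
\<close>

lemma sum_minors_le_1:
  fixes U :: "nat \<Rightarrow> nat \<Rightarrow> complex" and f :: "'i \<Rightarrow> nat \<Rightarrow> nat"
  assumes orth: "\<And>b c. b < n \<Longrightarrow> c < n \<Longrightarrow> (\<Sum>p\<in>{0..<N}. cnj (U p b) * U p c) = (if b = c then 1 else 0)"
    and I: "finite I" and f: "\<And>i a. i \<in> I \<Longrightarrow> a < n \<Longrightarrow> f i a < N" "\<And>i. i \<in> I \<Longrightarrow> inj_on (f i) {0..<n}"
    and diff: "\<And>i i'. i \<in> I \<Longrightarrow> i' \<in> I \<Longrightarrow> f i ` {0..<n} = f i' ` {0..<n} \<Longrightarrow> i = i'"
  shows "(\<Sum>i\<in>I. (cmod (minor U n (f i)))\<^sup>2) \<le> 1"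
proof -
  define P where "P = {p. p permutes {0..<n}}"
  define h where "h = (\<lambda>(i, p). restrict (f i \<circ> p) {0..<n})"
  have total: "(\<Sum>g\<in>tuples N n. (cmod (minor U n g))\<^sup>2) = fact n"
  proof -
    have "complex_of_real (\<Sum>g\<in>tuples N n. (cmod (minor U n g))\<^sup>2) = (\<Sum>g\<in>tuples N n. minor
        (\<lambda>p q. cnj (U p q)) n g * minor U n g)"
      unfolding of_real_sum minor_cnj by (intro sum.cong refl) (metis complex_norm_square mult.commute)
    also have "\<dots> = fact n * Determinant.det (Matrix.mat n n (\<lambda>(a, b). \<Sum>p\<in>{0..<N}. cnj (U p a) * U p b))"
      by (rule Cauchy_Binet_tuples)
    also have "Matrix.mat n n (\<lambda>(a, b). \<Sum>p\<in>{0..<N}. cnj (U p a) * U p b) = 1\<^sub>m n"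
      by (rule eq_matI) (auto simp: orth)
    finally have "complex_of_real (\<Sum>g\<in>tuples N n. (cmod (minor U n g))\<^sup>2) = of_real (fact n)" by simp
    then show ?thesis by (simp only: of_real_eq_iff)
  qed
  have img: "h (i, p) ` {0..<n} = f i ` {0..<n}" if "p \<in> P" for i p
  proof -
    have "h (i, p) ` {0..<n} = f i ` (p ` {0..<n})" by (auto simp: h_def image_image)
    then show ?thesis using that permutes_image[of p "{0..<n}"] by (simp add: P_def)
  qed
  have inj: "inj_on h (I \<times> P)"
  proof (rule inj_onI)
    fix x y assume x: "x \<in> I \<times> P" and y: "y \<in> I \<times> P" and eq: "h x = h y"
    obtain i p where xp: "x = (i, p)" "i \<in> I" "p \<in> P" using x by auto
    obtain j q where yq: "y = (j, q)" "j \<in> I" "q \<in> P" using y by auto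
    have "f i ` {0..<n} = f j ` {0..<n}" using img[OF xp(3), of i] img[OF yq(3), of j] eq by
        (simp add: xp(1) yq(1))
    then have ij: "i = j" using diff xp yq by blast
    have "p a = q a" for a
    proof (cases "a < n")
      case True
      have "h x a = h y a" using eq by simp
      then have "f i (p a) = f i (q a)" using True by (simp add: h_def xp(1) yq(1) ij)
      moreover have "p a \<in> {0..<n}" "q a \<in> {0..<n}"
        using True permutes_below xp(3) yq(3) by (auto simp: P_def)
      ultimately show ?thesis using inj_onD[OF f(2)[OF xp(2)]] by blast
    next
      case False
      then show ?thesis using xp(3) yq(3) by (auto simp: P_def permutes_def)
    qed
    then show "x = y" by (auto simp: xp(1) yq(1) ij)
  qed
  have val: "(cmod (minor U n (h (i, p))))\<^sup>2 = (cmod (minor U n (f i)))\<^sup>2" if "p \<in> P" for i p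
  proof -
    have "minor U n (h (i, p)) = minor U n (f i \<circ> p)" by (rule minor_cong) (simp add: h_def)
    also have "\<dots> = signof p * minor U n (f i)" using that by (intro minor_permute) (simp add: P_def)
    finally show ?thesis by (simp add: norm_mult sign_def)
  qed
  have "fact n * (\<Sum>i\<in>I. (cmod (minor U n (f i)))\<^sup>2) = (\<Sum>i\<in>I. \<Sum>p\<in>P. (cmod (minor U n (h (i, p))))\<^sup>2)"
    by (simp add: val P_def card_permutations sum_distrib_left)
  also have "\<dots> = (\<Sum>x\<in>I \<times> P. (cmod (minor U n (h x)))\<^sup>2)"
    by (simp add: sum.cartesian_product)
  also have "\<dots> = (\<Sum>g\<in>h ` (I \<times> P). (cmod (minor U n g))\<^sup>2)"
    by (simp add: sum.reindex[OF inj])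
  also have "\<dots> \<le> (\<Sum>g\<in>tuples N n. (cmod (minor U n g))\<^sup>2)"
  proof (rule sum_mono2[OF finite_tuples])
    show "h ` (I \<times> P) \<subseteq> tuples N n"
      using f(1) permutes_below by (auto simp: h_def tuples_def P_def)
  qed auto
  finally have "fact n * (\<Sum>i\<in>I. (cmod (minor U n (f i)))\<^sup>2) \<le> fact n" unfolding total .
  then show ?thesis by simp
qed

text \<open>
  In the Laplace expansion along the last column, the cofactors are up to sign the minors of the first
  \<open>j\<close> columns over \<open>j\<close> of the first \<open>j + 1\<close> rows. Their squares add up to at most one, and the cofactor of
  the corner is the smaller leading minor. The remaining terms are estimated by Cauchy--Schwarz.
\<close>

lemma minor_expansion:
  fixes U :: "nat \<Rightarrow> nat \<Rightarrow> complex"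
  assumes j: "j < N"
    and orth: "\<And>b c. b < N \<Longrightarrow> c < N \<Longrightarrow> (\<Sum>p\<in>{0..<N}. cnj (U p b) * U p c) = (if b = c then 1 else 0)"
  shows "(cmod (minor U (Suc j) id - U j j * minor U j id))\<^sup>2 \<le> (1 - (cmod (U j j))\<^sup>2) * (1
      - (cmod (minor U j id))\<^sup>2)"
proof -
  define M where "M = Matrix.mat (Suc j) (Suc j) (\<lambda>(a, b). U a b)"
  \<comment> \<open>\<open>skip a\<close> enumerates the first \<open>j + 1\<close> rows without row \<open>a\<close>.\<close>
  define skip where "skip = (\<lambda>a i::nat. if i < a then i else Suc i)"
  define c where "c = (\<lambda>a. cofactor M a j)"
  have c: "c a = (-1) ^ (a + j) * minor U j (skip a)" if "a \<le> j" for a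
  proof -
    have "mat_delete M a j = Matrix.mat j j (\<lambda>(i, b). U (skip a i) b)"
      using that by (intro eq_matI) (auto simp: mat_delete_def M_def skip_def)
    then show ?thesis by (simp add: c_def cofactor_def minor_def)
  qed
  have cj: "c j = minor U j id"
  proof -
    have "minor U j (skip j) = minor U j id" by (rule minor_cong) (simp add: skip_def)
    then show ?thesis using c[of j] by (simp flip: mult_2 add: power_mult)
  qed
  have "minor U (Suc j) id = (\<Sum>a<Suc j. M $$ (a, j) * c a)"
    unfolding minor_def c_def using laplace_expansion_column[of M "Suc j" j] by (simp add: M_def)
  also have "\<dots> = (\<Sum>a<j. U a j * c a) + U j j * minor U j id"
    by (simp add: M_def cj)
  finally have e: "minor U (Suc j) id - U j j * minor U j id = (\<Sum>a<j. U a j * c a)" by simp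
  have ca: "(cmod (c a))\<^sup>2 = (cmod (minor U j (skip a)))\<^sup>2" if "a \<le> j" for a
    using c[OF that] by (simp add: norm_mult norm_power)
  have "(\<Sum>a\<in>{..j}. (cmod (minor U j (skip a)))\<^sup>2) \<le> 1"
  proof (rule sum_minors_le_1[where n=j and N=N])
    show "skip i a < N" if "i \<in> {..j}" "a < j" for i a using that j by (auto simp: skip_def)
    show "inj_on (skip i) {0..<j}" for i by (auto simp: inj_on_def skip_def split: if_splits)
    show "i = i'" if "i \<in> {..j}" "i' \<in> {..j}" "skip i ` {0..<j} = skip i' ` {0..<j}" for i i'
    proof (rule ccontr)
      assume "i \<noteq> i'"
      have notin: "a \<notin> skip a ` {0..<j}" for a by (auto simp: skip_def)
      have inn: "b \<in> skip a ` {0..<j}" if "b \<le> j" "a \<le> j" "b \<noteq> a" for a b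
      proof (cases "b < a")
        case True
        then show ?thesis using that by (intro image_eqI[of _ _ b]) (auto simp: skip_def)
      next
        case False
        then show ?thesis using that by (intro image_eqI[of _ _ "b - 1"]) (auto simp: skip_def)
      qed
      show False using inn[of i i'] notin[of i] that \<open>i \<noteq> i'\<close> by auto
    qed
  qed (use orth j in auto)
  then have "(\<Sum>a\<in>{..j}. (cmod (c a))\<^sup>2) \<le> 1" by (simp add: ca)
  then have cs: "(\<Sum>a<j. (cmod (c a))\<^sup>2) \<le> 1 - (cmod (minor U j id))\<^sup>2"
    by (simp add: lessThan_Suc_atMost[symmetric] cj)
  have "complex_of_real (\<Sum>p\<in>{0..<N}. (cmod (U p j))\<^sup>2) = 1"
    unfolding of_real_sum complex_norm_square using orth[OF j j] by (simp add: mult.commute)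
  then have "(\<Sum>p\<in>{0..<N}. (cmod (U p j))\<^sup>2) = 1" by (metis of_real_eq_1_iff)
  moreover have "(\<Sum>p\<in>insert j {..<j}. (cmod (U p j))\<^sup>2) \<le> (\<Sum>p\<in>{0..<N}. (cmod (U p j))\<^sup>2)"
    using j by (intro sum_mono2) auto
  ultimately have us: "(\<Sum>a<j. (cmod (U a j))\<^sup>2) \<le> 1 - (cmod (U j j))\<^sup>2" by simp
  have "cmod (\<Sum>a<j. U a j * c a) \<le> (\<Sum>a<j. \<bar>cmod (U a j)\<bar> * \<bar>cmod (c a)\<bar>)"
    by (rule order_trans[OF norm_sum]) (simp add: norm_mult)
  also have "\<dots> \<le> L2_set (\<lambda>a. cmod (U a j)) {..<j} * L2_set (\<lambda>a. cmod (c a)) {..<j}"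
    by (rule L2_set_mult_ineq)
  finally have "(cmod (\<Sum>a<j. U a j * c a))\<^sup>2 \<le> (L2_set (\<lambda>a. cmod (U a j)) {..<j} * L2_set
      (\<lambda>a. cmod (c a)) {..<j})\<^sup>2"
    by (intro power_mono) auto
  also have "\<dots> = (\<Sum>a<j. (cmod (U a j))\<^sup>2) * (\<Sum>a<j. (cmod (c a))\<^sup>2)"
    by (simp add: power_mult_distrib L2_set_def sum_nonneg)
  also have "\<dots> \<le> (1 - (cmod (U j j))\<^sup>2) * (1 - (cmod (minor U j id))\<^sup>2)"
  proof (rule mult_mono[OF us cs])
    show "0 \<le> 1 - (cmod (U j j))\<^sup>2" by (rule order_trans[OF _ us]) (simp add: sum_nonneg)
  qed (simp add: sum_nonneg)
  finally show ?thesis unfolding e .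
qed

text \<open>
  With \<open>q\<^sup>2 = 1 - |x|\<^sup>2\<close> and \<open>s\<^sup>2 = 1 - |L0|\<^sup>2\<close> the hypothesis reads \<open>|L1 - x L0| \<le> q s\<close>. For the second claim,
  \<open>|L1| \<le> |x| + q s \<le> 1 - q\<^sup>2 / 2 + q\<^sup>2 / 4 + s\<^sup>2\<close>, so \<open>q\<^sup>2\<close> is bounded by the defects of \<open>L0\<close> and \<open>L1\<close>.
\<close>

lemma quotient_of_near_units:
  fixes x L0 L1 :: complex
  assumes x: "cmod x \<le> 1" and L0: "cmod L0 \<le> 1" and L1: "cmod L1 \<le> 1"
    and e: "(cmod (L1 - x * L0))\<^sup>2 \<le> (1 - (cmod x)\<^sup>2) * (1 - (cmod L0)\<^sup>2)"
  shows "(cmod (x - 1))\<^sup>2 \<le> 12 * ((1 - Re L0) + (1 - Re L1))"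
    and "1 - (cmod x)\<^sup>2 \<le> 8 * ((1 - Re L0) + (1 - Re L1))"
proof -
  have sq: "(cmod (L - 1))\<^sup>2 = 1 - 2 * Re L + (cmod L)\<^sup>2" for L
    unfolding cmod_power2 by (simp add: power2_eq_square algebra_simps)
  have near: "(cmod (L - 1))\<^sup>2 \<le> 2 * (1 - Re L)" if "cmod L \<le> 1" for L
    using that sq[of L] power_le_one[of "cmod L" 2] by simp
  have defect: "1 - (cmod L)\<^sup>2 \<le> 2 * (1 - Re L)" for L
  proof -
    have "0 \<le> 1 - 2 * Re L + (cmod L)\<^sup>2" by (metis sq zero_le_power2)
    then show ?thesis by simp
  qed
  have x2: "(cmod x)\<^sup>2 \<le> 1" and L02: "(cmod L0)\<^sup>2 \<le> 1" using x L0 by (simp_all add: power_le_one)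
  define a b c where "a = cmod (L0 - 1)" and "b = cmod (L1 - x * L0)" and "c = cmod (L1 - 1)"
  have "cmod (x - 1) \<le> a + b + c"
  proof -
    have "x - 1 = x * (1 - L0) + ((x * L0 - L1) + (L1 - 1))" by (simp add: algebra_simps)
    then have "cmod (x - 1) \<le> cmod (x * (1 - L0)) + (cmod (x * L0 - L1) + cmod (L1 - 1))"
      by (metis norm_triangle_ineq order_trans add_left_mono)
    moreover have "cmod (x * (1 - L0)) \<le> a"
      using mult_right_mono[OF x, of "cmod (1 - L0)"] by (simp add: norm_mult a_def norm_minus_commute)
    ultimately show ?thesis by (simp add: b_def c_def norm_minus_commute)
  qed
  then have "(cmod (x - 1))\<^sup>2 \<le> (a + b + c)\<^sup>2" by (intro power_mono) auto
  also have "\<dots> \<le> 3 * (a\<^sup>2 + b\<^sup>2 + c\<^sup>2)"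
    using zero_le_power2[of "a - b"] zero_le_power2[of "b - c"] zero_le_power2[of "a - c"]
    by (simp add: power2_eq_square algebra_simps)
  also have "\<dots> \<le> 3 * (2 * (1 - Re L0) + 2 * (1 - Re L0) + 2 * (1 - Re L1))"
  proof -
    have "b\<^sup>2 \<le> 1 * (1 - (cmod L0)\<^sup>2)"
      unfolding b_def using e x2 L02 by (elim order_trans) (intro mult_right_mono, auto)
    then show ?thesis using near[OF L0] near[OF L1] defect[of L0] by (simp add: a_def c_def)
  qed
  also have "\<dots> \<le> 12 * ((1 - Re L0) + (1 - Re L1))"
    using order_trans[OF complex_Re_le_cmod L1] by simp
  finally show "(cmod (x - 1))\<^sup>2 \<le> 12 * ((1 - Re L0) + (1 - Re L1))" .
  define q s where "q = sqrt (1 - (cmod x)\<^sup>2)" and "s = sqrt (1 - (cmod L0)\<^sup>2)"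
  have q2: "q\<^sup>2 = 1 - (cmod x)\<^sup>2" and s2: "s\<^sup>2 = 1 - (cmod L0)\<^sup>2" using x2 L02 by
      (simp_all add: q_def s_def)
  have qs0: "0 \<le> q" "0 \<le> s" using x2 L02 by (simp_all add: q_def s_def)
  have "b\<^sup>2 \<le> (q * s)\<^sup>2" using e by (simp add: b_def power_mult_distrib q2 s2)
  then have "b \<le> q * s" using qs0 by (meson mult_nonneg_nonneg power2_le_imp_le)
  have "cmod L1 \<le> cmod x + q * s"
  proof -
    have "cmod L1 \<le> cmod (x * L0) + b" unfolding b_def by (rule norm_triangle_sub)
    moreover have "cmod (x * L0) \<le> cmod x" using L0 by (simp add: norm_mult mult_left_le)
    ultimately show ?thesis using \<open>b \<le> q * s\<close> by simp
  qed
  moreover have "(cmod L1)\<^sup>2 \<le> cmod L1" using L1 by (simp add: power2_eq_square mult_left_le)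
  moreover have "cmod x \<le> 1 - q\<^sup>2 / 2"
    unfolding q2 using zero_le_power2[of "cmod x - 1"] by (simp add: power2_eq_square field_simps)
  moreover have "q * s \<le> q\<^sup>2 / 4 + s\<^sup>2" using zero_le_power2[of "q / 2 - s"] by
      (simp add: power2_eq_square algebra_simps)
  ultimately have "q\<^sup>2 \<le> 4 * ((1 - (cmod L1)\<^sup>2) + s\<^sup>2)" by simp
  then show "1 - (cmod x)\<^sup>2 \<le> 8 * ((1 - Re L0) + (1 - Re L1))"
    using defect[of L0] defect[of L1] by (simp add: q2 s2)
qed

lemma continuous_imp_lebesgue_measurable: "continuous_on UNIV (f :: real \<Rightarrow> 'b::topological_space)
    \<Longrightarrow> f \<in> borel_measurable lebesgue"
  by (intro measurable_completion) (simp add: borel_measurable_continuous_onI)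

abbreviation (input) L2sq :: "(real \<Rightarrow> complex) \<Rightarrow> ennreal" where
  "L2sq h \<equiv> \<integral>\<^sup>+k. ennreal ((cmod (h k))\<^sup>2) \<partial>lebesgue"

lemma square_measurable:
  assumes "set_borel_measurable M A f"
  shows "(\<lambda>x. ennreal ((cmod (f x))\<^sup>2) * indicator A x) \<in> borel_measurable M"
proof -
  have "(\<lambda>x. ennreal ((cmod (indicator A x *\<^sub>R f x))\<^sup>2)) \<in> borel_measurable M"
    using assms unfolding set_borel_measurable_def by measurable
  moreover have "(\<lambda>x. ennreal ((cmod (indicator A x *\<^sub>R f x))\<^sup>2)) = (\<lambda>x. ennreal ((cmod (f x))\<^sup>2)
      * indicator A x)"
    by (auto simp: indicator_def)
  ultimately show ?thesis by (simp only:)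
qed

context matrix_system
begin

definition coupled :: "nat \<Rightarrow> (nat \<times> nat) set" where
  "coupled j = {0..j} \<times> {j..<N} - {(j, j)}"

text \<open>
  Extended values are used because finiteness is known only as a hypothesis. At \<open>T = 0\<close> this is,
  up to the shift of the indices, the functional \<open>I_prime\<close>.
\<close>

definition tail_action :: "nat \<Rightarrow> real \<Rightarrow> ennreal" where
  "tail_action j T = (\<Sum>(m, l)\<in>coupled j. ennreal (inverse (lam l - lam m)) *
     (\<integral>\<^sup>+\<tau>\<in>{T..}. ennreal ((cmod (V \<tau> m l))\<^sup>2) \<partial>lebesgue))"

lemma finite_coupled: "finite (coupled j)" by (simp add: coupled_def)

lemma gap_action_le_tail_action:
  assumes w: "wedge_system N lam V X n" and n: "n = j \<or> n = Suc j" and t: "0 \<le> t"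
  shows "ennreal (wedge_system.gap_action N lam V n t) \<le> tail_action j 0"
proof -
  interpret w: wedge_system N lam V X n by fact
  define I where "I = (\<lambda>(m, l). integral_to t (\<lambda>s. (cmod (V s m l))\<^sup>2))"
  define c where "c = (\<lambda>(m, l). inverse (lam l - lam m))"
  have I0: "0 \<le> I x" for x
    unfolding I_def set_lebesgue_integral_def by
        (auto simp: split_beta intro!: Bochner_Integration.integral_nonneg)
  have c0: "0 \<le> c x" if "x \<in> {0..<n} \<times> {n..<N}" for x
    using that lam_less[of "fst x" "snd x"] by (auto simp: c_def)
  have "ennreal (w.gap_action t) = ennreal (\<Sum>x\<in>{0..<n} \<times> {n..<N}. c x * I x)"
    unfolding w.gap_action_def c_def I_def by (simp add: sum.cartesian_product split_beta)
  also have "\<dots> = (\<Sum>x\<in>{0..<n} \<times> {n..<N}. ennreal (c x * I x))"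
    using c0 I0 by (intro sum_ennreal[symmetric]) auto
  also have "\<dots> \<le> (\<Sum>x\<in>{0..<n} \<times> {n..<N}. case x of (m, l) \<Rightarrow> ennreal (inverse (lam l - lam m))
      * (\<integral>\<^sup>+\<tau>\<in>{0..}. ennreal ((cmod (V \<tau> m l))\<^sup>2) \<partial>lebesgue))"
  proof (rule sum_mono)
    fix x assume x: "x \<in> {0..<n} \<times> {n..<N}"
    obtain m l where ml: "x = (m, l)" "m < N" "l < N" using x w.n_less by auto
    have i: "integrable lebesgue (\<lambda>s. indicator {0..t} s *\<^sub>R (cmod (V s m l))\<^sup>2)"
      using V_sq[OF t ml(2,3)] by (simp add: set_integrable_def)
    have "ennreal (I x) = (\<integral>\<^sup>+s. ennreal (indicator {0..t} s *\<^sub>R (cmod (V s m l))\<^sup>2) \<partial>lebesgue)"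
      unfolding I_def ml(1) set_lebesgue_integral_def prod.case
      by (rule nn_integral_eq_integral[OF i, symmetric]) (auto intro!: AE_I2)
    also have "\<dots> \<le> (\<integral>\<^sup>+\<tau>\<in>{0..}. ennreal ((cmod (V \<tau> m l))\<^sup>2) \<partial>lebesgue)"
      by (intro nn_integral_mono) (auto simp: indicator_def)
    finally have "ennreal (c x) * ennreal (I x) \<le> ennreal (c x)
        * (\<integral>\<^sup>+\<tau>\<in>{0..}. ennreal ((cmod (V \<tau> m l))\<^sup>2) \<partial>lebesgue)"
      by (intro mult_left_mono) auto
    then show "ennreal (c x * I x) \<le> (case x of (m, l) \<Rightarrow> ennreal (inverse (lam l - lam m))
        * (\<integral>\<^sup>+\<tau>\<in>{0..}. ennreal ((cmod (V \<tau> m l))\<^sup>2) \<partial>lebesgue))"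
      using c0[OF x] I0 by (simp add: ennreal_mult c_def ml(1))
  qed
  also have "\<dots> \<le> tail_action j 0"
    unfolding tail_action_def using n finite_coupled
    by (intro sum_mono2) (auto simp: coupled_def)
  finally show ?thesis .
qed

lemma column_norm:
  assumes "j < N" "0 \<le> t"
  shows "(\<Sum>p\<in>{0..<N}. (cmod (X t k p j))\<^sup>2) = 1"
proof -
  have "complex_of_real (\<Sum>p\<in>{0..<N}. (cmod (X t k p j))\<^sup>2) = 1"
    unfolding of_real_sum complex_norm_square
    using columns_orthonormal[OF assms(1,1,2), of k] by (simp add: mult.commute)
  then show ?thesis by (metis of_real_eq_1_iff)
qed

text \<open>
  A left inverse of a square matrix is a right inverse.
\<close>

lemma rows_orthonormal:
  assumes "p < N" "q < N" "0 \<le> t"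
  shows "(\<Sum>r\<in>{0..<N}. X t k p r * cnj (X t k q r)) = (if p = q then 1 else 0)"
proof -
  define A where "A = Matrix.mat N N (\<lambda>(p, r). X t k p r)"
  define B where "B = Matrix.mat N N (\<lambda>(r, p). cnj (X t k p r))"
  have AB: "A \<in> carrier_mat N N" "B \<in> carrier_mat N N" by (auto simp: A_def B_def)
  have "B * A = 1\<^sub>m N"
    by (rule eq_matI) (use columns_orthonormal[OF _ _ assms(3), of _ _ k] in \<open>auto simp: A_def B_def scalar_prod_def\<close>)
  then have "A * B = 1\<^sub>m N" using mat_mult_left_right_inverse[OF AB(2,1)] by simp
  then have "(A * B) $$ (p, q) = (if p = q then 1 else 0)" using assms by simp
  then show ?thesis using assms by (simp add: A_def B_def scalar_prod_def)
qed

lemma row_norm: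
  assumes "j < N" "0 \<le> t"
  shows "(\<Sum>q\<in>{0..<N}. (cmod (X t k j q))\<^sup>2) = 1"
proof -
  have "complex_of_real (\<Sum>q\<in>{0..<N}. (cmod (X t k j q))\<^sup>2) = 1"
    unfolding of_real_sum complex_norm_square
    using rows_orthonormal[OF assms(1,1,2), of k] by simp
  then show ?thesis by (metis of_real_eq_1_iff)
qed

lemma entry_le_1:
  assumes "p < N" "q < N" "0 \<le> t"
  shows "cmod (X t k p q) \<le> 1"
proof -
  have "(cmod (X t k p q))\<^sup>2 \<le> (\<Sum>p\<in>{0..<N}. (cmod (X t k p q))\<^sup>2)"
    using assms by (intro member_le_sum) auto
  then show ?thesis
    using column_norm[OF assms(2,3), of k] by (simp add: power_le_one_iff abs_square_le_1)
qed

definition diag :: "nat \<Rightarrow> real \<Rightarrow> real \<Rightarrow> complex" where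
  "diag j t k = X t k j j * exp (- \<i> * of_real (lam j * t * k))"

lemma norm_diag: "cmod (diag j t k) = cmod (X t k j j)"
  by (simp add: diag_def norm_mult)

lemma diag_continuous: "j < N \<Longrightarrow> 0 \<le> t \<Longrightarrow> continuous_on UNIV (diag j t)"
  unfolding diag_def by (intro continuous_intros X_continuous) auto

text \<open>
  The two leading minors of sizes \<open>j\<close> and \<open>j + 1\<close> are inserted into \<open>quotient_of_near_units\<close>. Their phases
  differ exactly by that of the diagonal entry.
\<close>

lemma diag_bounds:
  assumes j: "Suc j < N" and t: "0 \<le> t"
  shows "L2sq (\<lambda>k. diag j t k - 1) \<le> ennreal (24 * pi) * tail_action j 0"
    and "(\<integral>\<^sup>+k. ennreal (1 - (cmod (diag j t k))\<^sup>2) \<partial>lebesgue) \<le> ennreal (16 * pi) * tail_action j 0"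
proof -
  interpret w0: wedge_system N lam V X j by unfold_locales (use j in auto)
  interpret w1: wedge_system N lam V X "Suc j" by unfold_locales (use j in auto)
  define D where "D = (\<lambda>k. (1 - Re (w0.lead k t)) + (1 - Re (w1.lead k t)))"
  have nn: "0 \<le> 1 - Re (w0.lead k t)" "0 \<le> 1 - Re (w1.lead k t)" for k
    using order_trans[OF complex_Re_le_cmod w0.lead_le_1[OF t]] order_trans[OF complex_Re_le_cmod w1.lead_le_1[OF t]] by auto
  have meas: "(\<lambda>k. ennreal (1 - Re (w0.lead k t))) \<in> borel_measurable lebesgue"
    "(\<lambda>k. ennreal (1 - Re (w1.lead k t))) \<in> borel_measurable lebesgue"
    by (intro measurable_compose[OF continuous_imp_lebesgue_measurable measurable_ennreal] continuous_intros
        w0.lead_continuous[OF t] w1.lead_continuous[OF t])+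
  have D: "(\<integral>\<^sup>+k. ennreal (c * D k) \<partial>lebesgue) \<le> ennreal (2 * c * pi) * tail_action j 0" if c: "0 \<le> c" for c
  proof -
    have "(\<integral>\<^sup>+k. ennreal (c * D k) \<partial>lebesgue) = (\<integral>\<^sup>+k. ennreal c * (ennreal (1 - Re (w0.lead k t))
        + ennreal (1 - Re (w1.lead k t))) \<partial>lebesgue)"
      by (simp only: D_def ennreal_mult'[OF c] ennreal_plus[OF nn])
    also have "\<dots> = ennreal c * ((\<integral>\<^sup>+k. ennreal (1 - Re (w0.lead k t)) \<partial>lebesgue) + (\<integral>\<^sup>+k. ennreal (1
        - Re (w1.lead k t)) \<partial>lebesgue))"
      using meas by (subst nn_integral_cmult) (auto simp: nn_integral_add)
    also have "\<dots> \<le> ennreal c * (ennreal pi * tail_action j 0 + ennreal pi * tail_action j 0)"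
    proof (intro mult_left_mono add_mono)
      have g0: "ennreal (pi * w0.gap_action t) \<le> ennreal pi * tail_action j 0"
        using mult_left_mono[OF gap_action_le_tail_action[OF w0.wedge_system_axioms _ t, of j], of "ennreal pi"]
        by (simp add: ennreal_mult')
      have g1: "ennreal (pi * w1.gap_action t) \<le> ennreal pi * tail_action j 0"
        using mult_left_mono[OF gap_action_le_tail_action[OF w1.wedge_system_axioms _ t, of j], of "ennreal pi"]
        by (simp add: ennreal_mult')
      show "(\<integral>\<^sup>+k. ennreal (1 - Re (w0.lead k t)) \<partial>lebesgue) \<le> ennreal pi * tail_action j 0"
        using order_trans[OF w0.lead_L1_bound[OF t] g0] .
      show "(\<integral>\<^sup>+k. ennreal (1 - Re (w1.lead k t)) \<partial>lebesgue) \<le> ennreal pi * tail_action j 0"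
        using order_trans[OF w1.lead_L1_bound[OF t] g1] .
    qed auto
    also have "\<dots> = ennreal (2 * c * pi) * tail_action j 0"
      using c by (simp add: ennreal_mult mult_2[symmetric] mult_ac)
    finally show ?thesis .
  qed
  have pt: "(cmod (diag j t k - 1))\<^sup>2 \<le> 12 * D k \<and> 1 - (cmod (diag j t k))\<^sup>2 \<le> 8 * D k" for k
  proof -
    define E0 where "E0 = exp (- \<i> * of_real (k * w0.ground) * complex_of_real t)"
    define Ej where "Ej = exp (- \<i> * complex_of_real (lam j * t * k))"
    have "w1.ground = w0.ground + lam j" by (simp add: w0.ground_def w1.ground_def)
    then have E1: "exp (- \<i> * of_real (k * w1.ground) * complex_of_real t) = Ej * E0"
      by (simp add: E0_def Ej_def exp_add[symmetric] algebra_simps)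
    have L0: "w0.lead k t = E0 * minor (X t k) j id" by (simp add: w0.lead_def E0_def)
    have L1: "w1.lead k t = Ej * E0 * minor (X t k) (Suc j) id" by (simp only: w1.lead_def E1)
    have nE: "cmod E0 = 1" "cmod Ej = 1" by (simp_all add: E0_def Ej_def)
    have orth: "(\<Sum>p\<in>{0..<N}. cnj (X t k p b) * X t k p c) = (if b = c then 1 else 0)"
        if "b < N" "c < N" for b c
      using columns_orthonormal[OF that t] .
    have "w1.lead k t - diag j t k * w0.lead k t = Ej * E0 * (minor (X t k) (Suc j) id - X t k j j
        * minor (X t k) j id)"
      unfolding L0 L1 diag_def Ej_def[symmetric] by (simp add: algebra_simps)
    then have "cmod (w1.lead k t - diag j t k * w0.lead k t) = cmod (minor (X t k) (Suc j) id
        - X t k j j * minor (X t k) j id)"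
      by (simp add: norm_mult nE)
    then have e: "(cmod (w1.lead k t - diag j t k * w0.lead k t))\<^sup>2 \<le> (1 - (cmod (diag j t k))\<^sup>2)
        * (1 - (cmod (w0.lead k t))\<^sup>2)"
      using minor_expansion[of j N "X t k", OF _ orth] j by (simp add: norm_diag L0 norm_mult nE)
    have x1: "cmod (diag j t k) \<le> 1"
      using entry_le_1[of j j] j t by (simp add: norm_diag)
    show ?thesis
      using quotient_of_near_units[OF x1 w0.lead_le_1[OF t] w1.lead_le_1[OF t] e] by (simp add: D_def)
  qed
  have "L2sq (\<lambda>k. diag j t k - 1) \<le> (\<integral>\<^sup>+k. ennreal (12 * D k) \<partial>lebesgue)"
    using pt by (intro nn_integral_mono ennreal_leI) auto
  also have "\<dots> \<le> ennreal (24 * pi) * tail_action j 0" using D[of 12] by simp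
  finally show "L2sq (\<lambda>k. diag j t k - 1) \<le> ennreal (24 * pi) * tail_action j 0" .
  have "(\<integral>\<^sup>+k. ennreal (1 - (cmod (diag j t k))\<^sup>2) \<partial>lebesgue) \<le> (\<integral>\<^sup>+k. ennreal (8 * D k) \<partial>lebesgue)"
    using pt by (intro nn_integral_mono ennreal_leI) auto
  also have "\<dots> \<le> ennreal (16 * pi) * tail_action j 0" using D[of 8] by simp
  finally show "(\<integral>\<^sup>+k. ennreal (1 - (cmod (diag j t k))\<^sup>2) \<partial>lebesgue) \<le> ennreal (16 * pi)
      * tail_action j 0" .
qed

section \<open>Propagation from a later time\<close>

text \<open>
  The matrix \<open>X(T + t) X(T)\<^sup>*\<close>; the adjoint stands for the inverse because \<open>X(T)\<close> is unitary.
\<close>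

definition propagator :: "real \<Rightarrow> real \<Rightarrow> real \<Rightarrow> nat \<Rightarrow> nat \<Rightarrow> complex" where
  "propagator T t k p q = (\<Sum>r\<in>{0..<N}. cnj (X T k q r) * X (T + t) k p r)"

text \<open>
  Multiplication by the constant matrix \<open>X(T)\<^sup>*\<close> from the right preserves the equation, and at time zero the
  rows of \<open>X(T)\<close> give the identity matrix.
\<close>

lemma propagator_system:
  assumes T: "0 \<le> T"
  shows "matrix_system N lam (\<lambda>s. V (T + s)) (propagator T)"
proof
  fix p assume p: "p < N"
  show "0 \<le> lam p" by (rule lam_nonneg[OF p])
next
  fix p q assume "p < q" "q < N"
  then show "lam p < lam q" by (rule lam_less)
next
  fix t :: real and p q assume a: "0 \<le> t" "p < N" "q < N"
  show "V (T + t) p q = cnj (V (T + t) q p)" using a T by (intro V_herm) auto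
  have "is_primitive (\<lambda>t. 0 + integral_to t (\<lambda>s. V s p q)) (\<lambda>s. V s p q)"
    using a by (intro is_primitive_integral V_int) auto
  from is_primitiveD(1)[OF is_primitive_shift[OF this T] a(1)]
  show "integrable_to t (\<lambda>s. V (T + s) p q)" .
  have "is_primitive (\<lambda>t. 0 + integral_to t (\<lambda>s. (cmod (V s p q))\<^sup>2)) (\<lambda>s. (cmod (V s p q))\<^sup>2)"
    using a by (intro is_primitive_integral V_sq) auto
  from is_primitiveD(1)[OF is_primitive_shift[OF this T] a(1)]
  show "integrable_to t (\<lambda>s. (cmod (V (T + s) p q))\<^sup>2)" .
next
  fix t :: real and p assume a: "0 \<le> t" "p < N"
  show "V (T + t) p p = 0" using a T by (intro V_diag) auto
next
  fix p q k assume a: "p < N" "q < N"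
  show "propagator T 0 k p q = (if p = q then 1 else 0)"
    using rows_orthonormal[OF a T, of k] by (simp add: propagator_def mult.commute)
  have "is_primitive (\<lambda>t. \<Sum>r\<in>{0..<N}. cnj (X T k q r) * X (T + t) k p r)
     (\<lambda>s. \<Sum>r\<in>{0..<N}. cnj (X T k q r) * (\<i> * (of_real (k * lam p) * X (T + s) k p r +
         (\<Sum>g\<in>{0..<N}. V (T + s) p g * X (T + s) k g r))))"
    using a by (intro is_primitive_sum is_primitive_cmult is_primitive_shift[OF X_prim T]) auto
  then show "is_primitive (\<lambda>t. propagator T t k p q)
     (\<lambda>s. \<i> * (of_real (k * lam p) * propagator T s k p q + (\<Sum>r\<in>{0..<N}. V (T + s) p r
         * propagator T s k r q)))"
    unfolding sum_linear_combination propagator_def .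
qed

lemma propagator_compose:
  assumes "0 \<le> T" "p < N" "c < N"
  shows "X (T + t) k p c = (\<Sum>q\<in>{0..<N}. propagator T t k p q * X T k q c)"
proof -
  have "(\<Sum>q\<in>{0..<N}. propagator T t k p q * X T k q c) = (\<Sum>q\<in>{0..<N}. \<Sum>r\<in>{0..<N}. X (T + t) k p r
      * (cnj (X T k q r) * X T k q c))"
    by (simp add: propagator_def sum_distrib_right sum_distrib_left mult_ac)
  also have "\<dots> = (\<Sum>r\<in>{0..<N}. X (T + t) k p r * (\<Sum>q\<in>{0..<N}. cnj (X T k q r) * X T k q c))"
    by (subst sum.swap) (simp add: sum_distrib_left)
  also have "\<dots> = (\<Sum>r\<in>{0..<N}. if r = c then X (T + t) k p c else 0)"
    using columns_orthonormal[OF _ assms(3,1), of _ k] by (intro sum.cong refl) auto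
  finally show ?thesis using assms(3) by simp
qed

text \<open>
  Row \<open>j\<close> of the propagator splits into its diagonal entry, which is close to a phase, and the rest. By
  Cauchy--Schwarz and unitarity the rest contributes at most \<open>1 - |z\<^sub>j\<^sub>j|\<^sup>2\<close> to the square, where \<open>z\<^sub>j\<^sub>j\<close> is
  that diagonal entry, and this defect is controlled in \<open>L\<^sup>1\<close>.
\<close>

lemma diag_increment:
  assumes j: "Suc j < N" and T: "0 \<le> T" "T \<le> t"
    and meas: "\<And>m l. m < N \<Longrightarrow> l < N \<Longrightarrow> set_borel_measurable lebesgue {0..} (\<lambda>s. V s m l)"
  shows "L2sq (\<lambda>k. diag j t k - diag j T k) \<le> ennreal (80 * pi) * tail_action j T"
proof -
  define s where "s = t - T"
  have s: "0 \<le> s" "t = T + s" using T by (auto simp: s_def)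
  interpret Z: matrix_system N lam "\<lambda>s. V (T + s)" "propagator T" by (rule propagator_system[OF T(1)])
  have tail: "Z.tail_action j 0 = tail_action j T"
    unfolding Z.tail_action_def tail_action_def Z.coupled_def coupled_def
  proof (rule sum.cong[OF refl])
    fix x assume x: "x \<in> {0..j} \<times> {j..<N} - {(j, j)}"
    obtain m l where ml: "x = (m, l)" by (cases x)
    have mlN: "m < N" "l < N" using x j ml by auto
    have mh: "(\<lambda>\<tau>. ennreal ((cmod (V \<tau> m l))\<^sup>2) * indicator {T..} \<tau>) \<in> borel_measurable lebesgue"
      using T by (intro square_measurable set_borel_measurable_subset[OF meas[OF mlN]])
          (auto intro: sets_completionI_sets)
    have "(\<integral>\<^sup>+\<tau>\<in>{T..}. ennreal ((cmod (V \<tau> m l))\<^sup>2) \<partial>lebesgue) = (\<integral>\<^sup>+\<tau>. ennreal ((cmod (V (T + 1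
        * \<tau>) m l))\<^sup>2) * indicator {T..} (T + 1 * \<tau>) \<partial>lebesgue)"
      using nn_integral_real_affine_lebesgue[OF mh, of 1 T] by simp
    also have "\<dots> = (\<integral>\<^sup>+\<tau>\<in>{0..}. ennreal ((cmod (V (T + \<tau>) m l))\<^sup>2) \<partial>lebesgue)"
      by (intro nn_integral_cong) (auto simp: indicator_def)
    finally show "(case x of (m, l) \<Rightarrow> ennreal (inverse (lam l - lam m))
        * (\<integral>\<^sup>+\<tau>\<in>{0..}. ennreal ((cmod (V (T + \<tau>) m l))\<^sup>2) \<partial>lebesgue))
       = (case x of (m, l) \<Rightarrow> ennreal (inverse (lam l - lam m))
           * (\<integral>\<^sup>+\<tau>\<in>{T..}. ennreal ((cmod (V \<tau> m l))\<^sup>2) \<partial>lebesgue))"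
      by (simp add: ml)
  qed
  have jN: "j < N" using j by simp
  have pt: "(cmod (diag j t k - diag j T k))\<^sup>2 \<le> 2 * (cmod (Z.diag j s k - 1))\<^sup>2 + 2 * (1
      - (cmod (Z.diag j s k))\<^sup>2)" for k
  proof -
    define E where "E = exp (- \<i> * complex_of_real (lam j * t * k))"
    define R where "R = (\<Sum>q\<in>{0..<N}-{j}. propagator T s k j q * X T k q j)"
    have "X t k j j = (\<Sum>q\<in>{0..<N}. propagator T s k j q * X T k q j)"
      unfolding s(2) by (rule propagator_compose[OF T(1) jN jN])
    also have "\<dots> = propagator T s k j j * X T k j j + R"
      unfolding R_def using jN by (intro sum.remove) auto
    finally have X: "X t k j j = propagator T s k j j * X T k j j + R" .
    define E1 where "E1 = exp (- \<i> * complex_of_real (lam j * s * k))"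
    define E2 where "E2 = exp (- \<i> * complex_of_real (lam j * T * k))"
    have E: "E = E1 * E2"
      by (simp add: E_def E1_def E2_def s(2) exp_add[symmetric] algebra_simps)
    have d: "diag j t k - diag j T k = (Z.diag j s k - 1) * diag j T k + E * R"
      unfolding diag_def Z.diag_def E_def[symmetric] E1_def[symmetric] E2_def[symmetric] X
      by (simp add: E algebra_simps)
    note col = column_norm[OF jN T(1), of k] and row = Z.row_norm[OF jN s(1), of k]
    have split: "(\<Sum>q\<in>{0..<N}. h q) = h j + (\<Sum>q\<in>{0..<N}-{j}. h q)" for h :: "nat \<Rightarrow> real"
      using jN by (intro sum.remove) auto
    have colr: "(\<Sum>q\<in>{0..<N}-{j}. (cmod (X T k q j))\<^sup>2) \<le> 1"
      using col split[of "\<lambda>q. (cmod (X T k q j))\<^sup>2"] zero_le_power2[of "cmod (X T k j j)"] by linarith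
    have rowr: "(\<Sum>q\<in>{0..<N}-{j}. (cmod (propagator T s k j q))\<^sup>2) = 1 - (cmod (Z.diag j s k))\<^sup>2"
      using row split[of "\<lambda>q. (cmod (propagator T s k j q))\<^sup>2"] by (simp add: Z.norm_diag)
    have T1: "cmod (diag j T k) \<le> 1"
      using entry_le_1[OF jN jN T(1)] by (simp add: norm_diag)
    have "cmod R \<le> (\<Sum>q\<in>{0..<N}-{j}. \<bar>cmod (propagator T s k j q)\<bar> * \<bar>cmod (X T k q j)\<bar>)"
      unfolding R_def by (rule order_trans[OF norm_sum]) (simp add: norm_mult)
    also have "\<dots> \<le> L2_set (\<lambda>q. cmod (propagator T s k j q)) ({0..<N}-{j}) * L2_set
        (\<lambda>q. cmod (X T k q j)) ({0..<N}-{j})"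
      by (rule L2_set_mult_ineq)
    finally have "(cmod R)\<^sup>2 \<le> (L2_set (\<lambda>q. cmod (propagator T s k j q)) ({0..<N}-{j}) * L2_set
        (\<lambda>q. cmod (X T k q j)) ({0..<N}-{j}))\<^sup>2"
      by (intro power_mono) auto
    also have "\<dots> = (\<Sum>q\<in>{0..<N}-{j}. (cmod (propagator T s k j q))\<^sup>2) *
        (\<Sum>q\<in>{0..<N}-{j}. (cmod (X T k q j))\<^sup>2)"
      by (simp add: power_mult_distrib L2_set_def sum_nonneg)
    also have "\<dots> \<le> (\<Sum>q\<in>{0..<N}-{j}. (cmod (propagator T s k j q))\<^sup>2) * 1"
      by (intro mult_left_mono colr sum_nonneg) auto
    finally have R2: "(cmod R)\<^sup>2 \<le> 1 - (cmod (Z.diag j s k))\<^sup>2" using rowr by simp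
    have "cmod (diag j t k - diag j T k) \<le> cmod (Z.diag j s k - 1) + cmod R"
    proof -
      have "cmod (diag j t k - diag j T k) \<le> cmod ((Z.diag j s k - 1) * diag j T k) + cmod (E * R)"
        unfolding d by (rule norm_triangle_ineq)
      moreover have "cmod ((Z.diag j s k - 1) * diag j T k) \<le> cmod (Z.diag j s k - 1)"
        using T1 by (simp add: norm_mult mult_left_le)
      moreover have "cmod (E * R) = cmod R" by (simp add: norm_mult E_def)
      ultimately show ?thesis by simp
    qed
    then have "(cmod (diag j t k - diag j T k))\<^sup>2 \<le> (cmod (Z.diag j s k - 1) + cmod R)\<^sup>2"
        by (intro power_mono) auto
    also have "\<dots> \<le> 2 * (cmod (Z.diag j s k - 1))\<^sup>2 + 2 * (cmod R)\<^sup>2"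
      using zero_le_power2[of "cmod (Z.diag j s k - 1) - cmod R"] by
          (simp add: power2_eq_square algebra_simps)
    finally show ?thesis using R2 by simp
  qed
  have Zle: "0 \<le> 1 - (cmod (Z.diag j s k))\<^sup>2" for k
    using Z.entry_le_1[OF jN jN s(1), of k] by (simp add: Z.norm_diag power_le_one)
  have m: "(\<lambda>k. ennreal ((cmod (Z.diag j s k - 1))\<^sup>2)) \<in> borel_measurable lebesgue"
    "(\<lambda>k. ennreal (1 - (cmod (Z.diag j s k))\<^sup>2)) \<in> borel_measurable lebesgue"
    by (intro measurable_compose[OF continuous_imp_lebesgue_measurable measurable_ennreal] continuous_intros
        Z.diag_continuous[OF jN s(1)])+
  have "L2sq (\<lambda>k. diag j t k - diag j T k)
     \<le> (\<integral>\<^sup>+k. 2 * ennreal ((cmod (Z.diag j s k - 1))\<^sup>2) + 2 * ennreal (1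
         - (cmod (Z.diag j s k))\<^sup>2) \<partial>lebesgue)"
  proof (rule nn_integral_mono)
    fix k
    have "ennreal ((cmod (diag j t k - diag j T k))\<^sup>2) \<le> ennreal (2 * (cmod (Z.diag j s k - 1))\<^sup>2
        + 2 * (1 - (cmod (Z.diag j s k))\<^sup>2))"
      by (rule ennreal_leI[OF pt])
    also have "\<dots> = 2 * ennreal ((cmod (Z.diag j s k - 1))\<^sup>2) + 2 * ennreal (1 - (cmod (Z.diag j s k))\<^sup>2)"
    proof -
      have "ennreal (2 * a + 2 * b) = 2 * ennreal a + 2 * ennreal b" if "0 \<le> a" "0 \<le> b" for a b
        using that by (simp add: ennreal_mult)
      then show ?thesis using Zle[of k] by (metis zero_le_power2)
    qed
    finally show "ennreal ((cmod (diag j t k - diag j T k))\<^sup>2) \<le> 2 * ennreal ((cmod (Z.diag j s k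
        - 1))\<^sup>2) + 2 * ennreal (1 - (cmod (Z.diag j s k))\<^sup>2)" .
  qed
  also have "\<dots> = 2 * L2sq (\<lambda>k. Z.diag j s k - 1) + 2 * (\<integral>\<^sup>+k. ennreal (1
      - (cmod (Z.diag j s k))\<^sup>2) \<partial>lebesgue)"
    using m by (simp add: nn_integral_add nn_integral_cmult)
  also have "\<dots> \<le> 2 * (ennreal (24 * pi) * tail_action j T) + 2 * (ennreal (16 * pi) * tail_action j T)"
    using Z.diag_bounds[OF j s(1)] unfolding tail by (intro add_mono mult_left_mono) auto
  also have "\<dots> = ennreal (80 * pi) * tail_action j T"
  proof -
    have "ennreal (80 * pi) = 2 * ennreal (24 * pi) + 2 * ennreal (16 * pi)"
      using ennreal_plus[of "48 * pi" "32 * pi"] ennreal_mult[of 2 "24 * pi"] ennreal_mult[of 2 "16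
          * pi"] by simp
    then show ?thesis by (simp add: distrib_right mult.assoc)
  qed
  finally show ?thesis .
qed

end

section \<open>The limit in \<open>L\<^sup>2\<close>\<close>

lemma nn_integral_tail_tendsto_0:
  fixes f :: "real \<Rightarrow> ennreal"
  assumes f: "(\<lambda>x. f x * indicator {0..} x) \<in> borel_measurable lebesgue"
      and fin: "(\<integral>\<^sup>+x\<in>{0..}. f x \<partial>lebesgue) < \<infinity>"
  shows "((\<lambda>T. \<integral>\<^sup>+x\<in>{T..}. f x \<partial>lebesgue) \<longlongrightarrow> 0) at_top"
proof -
  define g where "g = (\<lambda>T x. f x * indicator {T..} (x::real))"
  have anti: "integral\<^sup>N lebesgue (g T') \<le> integral\<^sup>N lebesgue (g T)" if "T \<le> T'" for T T'
    unfolding g_def using that by (intro nn_integral_mono) (auto simp: indicator_def)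
  have meas: "g (real n) \<in> borel_measurable lebesgue" for n
  proof -
    have "(\<lambda>x. (f x * indicator {0..} x) * indicator {real n..} x) \<in> borel_measurable lebesgue"
      by (rule borel_measurable_times_ennreal[OF f])
          (auto intro!: borel_measurable_indicator sets_completionI_sets)
    also have "(\<lambda>x. (f x * indicator {0..} x) * indicator {real n..} x) = g (real n)"
      by (auto simp: g_def indicator_def fun_eq_iff)
    finally show ?thesis .
  qed
  have fin0: "integral\<^sup>N lebesgue (g (real 0)) < \<infinity>" using fin by (simp add: g_def)
  have pw: "(INF n. g (real n) x) = 0" for x
  proof -
    obtain n :: nat where "x < real n" using reals_Archimedean2 by blast
    then have "g (real n) x = 0" by (simp add: g_def)
    then have "(INF n. g (real n) x) \<le> 0" by (metis INF_lower UNIV_I)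
    then show ?thesis by simp
  qed
  have "(INF n. integral\<^sup>N lebesgue (g (real n))) = (\<integral>\<^sup>+x. (INF n. g (real n) x) \<partial>lebesgue)"
  proof (rule nn_integral_monotone_convergence_INF_decseq[where f="\<lambda>n. g (real n)"
      and i=0, OF _ meas fin0, symmetric])
    show "decseq (\<lambda>n. g (real n))"
      by (rule antimonoI) (auto simp: le_fun_def g_def indicator_def)
  qed
  then have inf: "(INF n. integral\<^sup>N lebesgue (g (real n))) = 0" by (simp add: pw)
  have "((\<lambda>T. integral\<^sup>N lebesgue (g T)) \<longlongrightarrow> 0) at_top"
  proof (rule order_tendstoI)
    fix a :: ennreal assume "0 < a"
    then have "(INF n. integral\<^sup>N lebesgue (g (real n))) < a" using inf by simp
    then obtain n where "integral\<^sup>N lebesgue (g (real n)) < a" by (auto simp: INF_less_iff)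
    then have "integral\<^sup>N lebesgue (g T) < a" if "real n \<le> T" for T
      using anti[OF that] by (rule le_less_trans[rotated])
    then show "eventually (\<lambda>T. integral\<^sup>N lebesgue (g T) < a) at_top"
      using eventually_ge_at_top[of "real n"] by (rule eventually_mono[rotated])
  qed auto
  then show ?thesis by (simp add: g_def)
qed

text \<open>
  Fatou's lemma for functions that converge almost everywhere.
\<close>

lemma L2_limit_bound:
  fixes g :: "nat \<Rightarrow> real \<Rightarrow> complex"
  assumes meas: "c \<in> borel_measurable lebesgue" "\<And>n. g n \<in> borel_measurable lebesgue"
    and lim: "AE k in lebesgue. (\<lambda>n. g n k) \<longlonglongrightarrow> x k"
    and le: "eventually (\<lambda>n. L2sq (\<lambda>k. g n k - c k) \<le> b) sequentially"
  shows "L2sq (\<lambda>k. x k - c k) \<le> b"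
proof -
  have "L2sq (\<lambda>k. x k - c k) \<le> (\<integral>\<^sup>+k. liminf (\<lambda>n. ennreal ((cmod (g n k - c k))\<^sup>2)) \<partial>lebesgue)"
  proof (rule nn_integral_mono_AE)
    show "AE k in lebesgue. ennreal ((cmod (x k - c k))\<^sup>2) \<le> liminf (\<lambda>n. ennreal ((cmod (g n k - c k))\<^sup>2))"
      using lim
    proof eventually_elim
      case (elim k)
      have "(\<lambda>n. ennreal ((cmod (g n k - c k))\<^sup>2)) \<longlonglongrightarrow> ennreal ((cmod (x k - c k))\<^sup>2)"
        by (intro tendsto_ennrealI tendsto_intros elim)
      from lim_imp_Liminf[OF _ this] show ?case by simp
    qed
  qed
  also have "\<dots> \<le> liminf (\<lambda>n. \<integral>\<^sup>+k. ennreal ((cmod (g n k - c k))\<^sup>2) \<partial>lebesgue)"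
  proof (rule nn_integral_liminf)
    show "(\<lambda>k. ennreal ((cmod (g n k - c k))\<^sup>2)) \<in> borel_measurable lebesgue" for n
      using meas by measurable
  qed
  also have "\<dots> \<le> limsup (\<lambda>n. \<integral>\<^sup>+k. ennreal ((cmod (g n k - c k))\<^sup>2) \<partial>lebesgue)"
    by (intro Liminf_le_Limsup) simp
  also have "\<dots> \<le> b"
    by (rule Limsup_bounded[OF le])
  finally show ?thesis .
qed

text \<open>
  The weights \<open>2\<^sup>n\<close> keep the sum of the squared increments integrable, hence finite almost everywhere,
  and so the increments themselves are dominated by a geometric series.
\<close>

lemma fast_L2_Cauchy_AE_convergent:
  fixes g :: "nat \<Rightarrow> real \<Rightarrow> complex"
  assumes meas: "\<And>n. g n \<in> borel_measurable lebesgue"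
    and fast: "\<And>n. L2sq (\<lambda>k. g (Suc n) k - g n k) \<le> ennreal ((1/8) ^ n)"
  shows "AE k in lebesgue. convergent (\<lambda>n. g n k)"
proof -
  define d where "d = (\<lambda>n k. ennreal (2 ^ n * (cmod (g (Suc n) k - g n k))\<^sup>2))"
  have dm: "d n \<in> borel_measurable lebesgue" for n
    unfolding d_def using meas by measurable
  have dn: "integral\<^sup>N lebesgue (d n) \<le> ennreal ((1/4) ^ n)" for n
  proof -
    have "integral\<^sup>N lebesgue (d n) = (\<integral>\<^sup>+k. ennreal (2 ^ n) * ennreal ((cmod (g (Suc n) k
        - g n k))\<^sup>2) \<partial>lebesgue)"
      unfolding d_def by (intro nn_integral_cong ennreal_mult) auto
    also have "\<dots> = ennreal (2 ^ n) * L2sq (\<lambda>k. g (Suc n) k - g n k)"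
    proof (rule nn_integral_cmult)
      show "(\<lambda>k. ennreal ((cmod (g (Suc n) k - g n k))\<^sup>2)) \<in> borel_measurable lebesgue"
        using meas by measurable
    qed
    also have "\<dots> \<le> ennreal (2 ^ n) * ennreal ((1/8) ^ n)"
      by (intro mult_left_mono fast) auto
    also have "\<dots> = ennreal ((1/4) ^ n)"
      by (subst ennreal_mult[symmetric]) (auto simp: power_mult_distrib[symmetric])
    finally show ?thesis .
  qed
  have "(\<integral>\<^sup>+k. (\<Sum>n. d n k) \<partial>lebesgue) = (\<Sum>n. integral\<^sup>N lebesgue (d n))"
    by (rule nn_integral_suminf[OF dm])
  also have "\<dots> \<le> (\<Sum>n. ennreal ((1/4) ^ n))"
    by (intro suminf_le dn) auto
  also have "\<dots> = ennreal (\<Sum>n. (1/4) ^ n)"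
    by (rule suminf_ennreal2) (auto intro!: summable_geometric)
  finally have "(\<integral>\<^sup>+k. (\<Sum>n. d n k) \<partial>lebesgue) \<noteq> \<infinity>"
    by (metis ennreal_less_top infinity_ennreal_def leD top.not_eq_extremum)
  then have "AE k in lebesgue. (\<Sum>n. d n k) \<noteq> \<infinity>"
    by (intro nn_integral_PInf_AE borel_measurable_suminf_order dm)
  then show ?thesis
  proof eventually_elim
    case (elim k)
    obtain M where M: "(\<Sum>n. d n k) = ennreal M" "0 \<le> M" using elim by (cases "\<Sum>n. d n k") auto
    have le: "(cmod (g (Suc n) k - g n k))\<^sup>2 \<le> M * (1/2) ^ n" for n
    proof -
      have "d n k \<le> ennreal M" unfolding M(1)[symmetric] using ennreal_suminf_lessD
        by (metis sum_le_suminf[of "\<lambda>n. d n k" "{n}"] finite.emptyI finite_insert sum.insert sum.empty empty_iff add.right_neutral summableI zero_le)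
      then have "2 ^ n * (cmod (g (Suc n) k - g n k))\<^sup>2 \<le> M" using M(2) by (simp add: d_def)
      then show ?thesis by (simp add: field_simps power_one_over)
    qed
    have "summable (\<lambda>n. g (Suc n) k - g n k)"
    proof (rule summable_comparison_test')
      show "summable (\<lambda>n. sqrt M * (sqrt (1/2)) ^ n)"
        by (intro summable_mult summable_geometric) (simp add: real_sqrt_lt_1_iff)
      fix n
      have "cmod (g (Suc n) k - g n k) \<le> sqrt (M * (1/2) ^ n)"
        by (rule real_le_rsqrt[OF le])
      also have "\<dots> = sqrt M * (sqrt (1/2)) ^ n" by (simp only: real_sqrt_mult real_sqrt_power)
      finally show "norm (g (Suc n) k - g n k) \<le> sqrt M * (sqrt (1/2)) ^ n" .
    qed
    then have "convergent (\<lambda>N. \<Sum>n<N. g (Suc n) k - g n k)" by (simp add: summable_iff_convergent)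
    then have "convergent (\<lambda>N. g N k - g 0 k)" using sum_lessThan_telescope[of "\<lambda>n. g n k"] by simp
    then have "convergent (\<lambda>N. (g N k - g 0 k) + g 0 k)" by (intro convergent_add convergent_const)
    then show ?case by simp
  qed
qed

text \<open>
  The limit is taken along a sequence of times so sparse that the increments decrease geometrically. By
  Fatou's lemma the Cauchy estimate from \<open>T\<close> to these times passes to the limit, and this gives
  convergence along all times.
\<close>

lemma L2_Cauchy_limit:
  fixes y :: "real \<Rightarrow> real \<Rightarrow> complex" and e :: "real \<Rightarrow> ennreal"
  assumes meas: "\<And>t. 0 \<le> t \<Longrightarrow> y t \<in> borel_measurable lebesgue"
    and cauchy: "\<And>T t. 0 \<le> T \<Longrightarrow> T \<le> t \<Longrightarrow> L2sq (\<lambda>k. y t k - y T k) \<le> e T"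
    and e: "(e \<longlongrightarrow> 0) at_top"
    and bound: "\<And>t. 0 \<le> t \<Longrightarrow> L2sq (\<lambda>k. y t k - 1) \<le> B"
  shows "\<exists>x. x \<in> borel_measurable lebesgue \<and>
     ((\<lambda>t. \<integral>\<^sup>+k. ennreal ((cmod (y t k - x k))\<^sup>2) \<partial>lebesgue) \<longlongrightarrow> 0) at_top \<and>
     L2sq (\<lambda>k. x k - 1) \<le> B"
proof -
  have "\<exists>S\<ge>0. \<forall>T\<ge>S. e T \<le> ennreal ((1/8) ^ n)" for n
  proof -
    have "eventually (\<lambda>T. e T < ennreal ((1/8) ^ n)) at_top"
      by (rule order_tendstoD(2)[OF e]) simp
    then obtain S where S: "\<And>T. S \<le> T \<Longrightarrow> e T < ennreal ((1/8) ^ n)"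
      by (auto simp: eventually_at_top_linorder)
    show ?thesis by (rule exI[of _ "max S 0"]) (use S in \<open>auto simp: less_imp_le\<close>)
  qed
  then obtain S where S: "\<And>n. 0 \<le> S n" "\<And>n T. S n \<le> T \<Longrightarrow> e T \<le> ennreal ((1/8) ^ n)" by metis
  \<comment> \<open>Partial sums make the times increase, the summand \<open>n\<close> makes them unbounded.\<close>
  define \<tau> where "\<tau> = (\<lambda>n. real n + (\<Sum>i\<le>n. S i))"
  have \<tau>S: "S n \<le> \<tau> n" for n
    using member_le_sum[of n "{..n}" S] S(1) by (auto simp: \<tau>_def intro: order_trans)
  have \<tau>n: "real n \<le> \<tau> n" for n using S(1) by (auto simp: \<tau>_def intro: sum_nonneg)
  have \<tau>0: "0 \<le> \<tau> n" for n using \<tau>S S(1) order_trans by blast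
  have \<tau>Suc: "\<tau> n \<le> \<tau> (Suc n)" for n using S(1)[of "Suc n"] by (simp add: \<tau>_def)
  define g where "g = (\<lambda>n. y (\<tau> n))"
  have gm: "g n \<in> borel_measurable lebesgue" for n unfolding g_def by (rule meas[OF \<tau>0])
  have "AE k in lebesgue. convergent (\<lambda>n. g n k)"
  proof (rule fast_L2_Cauchy_AE_convergent[OF gm])
    fix n
    have "L2sq (\<lambda>k. g (Suc n) k - g n k) \<le> e (\<tau> n)"
      unfolding g_def by (rule cauchy[OF \<tau>0 \<tau>Suc])
    also have "\<dots> \<le> ennreal ((1/8) ^ n)" by (rule S(2)[OF \<tau>S])
    finally show "L2sq (\<lambda>k. g (Suc n) k - g n k) \<le> ennreal ((1/8) ^ n)" .
  qed
  define x where "x = (\<lambda>k. lim (\<lambda>n. g n k))"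
  have lim: "AE k in lebesgue. (\<lambda>n. g n k) \<longlonglongrightarrow> x k"
    using \<open>AE k in lebesgue. convergent (\<lambda>n. g n k)\<close> by eventually_elim
        (simp add: x_def convergent_LIMSEQ_iff)
  have xm: "x \<in> borel_measurable lebesgue" unfolding x_def by (rule borel_measurable_lim_metric[OF gm])
  have est: "L2sq (\<lambda>k. y t k - x k) \<le> e t" if t: "0 \<le> t" for t
  proof -
    have "L2sq (\<lambda>k. x k - y t k) \<le> e t"
    proof (rule L2_limit_bound[OF meas[OF t] gm lim])
      obtain n0 :: nat where n0: "t \<le> real n0" using real_arch_simple by blast
      show "eventually (\<lambda>n. L2sq (\<lambda>k. g n k - y t k) \<le> e t) sequentially"
      proof (rule eventually_sequentiallyI[of n0])
        fix n assume "n0 \<le> n"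
        then have "t \<le> \<tau> n" using n0 \<tau>n[of n] by linarith
        then show "L2sq (\<lambda>k. g n k - y t k) \<le> e t"
          unfolding g_def by (rule cauchy[OF t])
      qed
    qed
    then show ?thesis by (simp add: norm_minus_commute)
  qed
  show ?thesis
  proof (intro exI[of _ x] conjI xm)
    show "((\<lambda>t. \<integral>\<^sup>+k. ennreal ((cmod (y t k - x k))\<^sup>2) \<partial>lebesgue) \<longlongrightarrow> 0) at_top"
    proof (rule tendsto_sandwich[OF _ _ tendsto_const e])
      show "eventually (\<lambda>t. L2sq (\<lambda>k. y t k - x k) \<le> e t) at_top"
        using eventually_ge_at_top[of 0] by (rule eventually_mono) (rule est)
    qed simp
    show "L2sq (\<lambda>k. x k - 1) \<le> B"
      by (rule L2_limit_bound[OF _ gm lim]) (use bound[OF \<tau>0] in \<open>auto simp: g_def\<close>)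
  qed
qed

lemma (in matrix_system) tail_action_tendsto_0:
  assumes j: "j < N" and fin: "tail_action j 0 < \<infinity>"
    and meas: "\<And>m l. m < N \<Longrightarrow> l < N \<Longrightarrow> set_borel_measurable lebesgue {0..} (\<lambda>s. V s m l)"
  shows "((\<lambda>T. ennreal c * tail_action j T) \<longlongrightarrow> 0) at_top"
proof -
  have "((\<lambda>T. tail_action j T) \<longlongrightarrow> (\<Sum>x\<in>coupled j. 0)) at_top"
    unfolding tail_action_def
  proof (rule tendsto_sum)
    fix x assume x: "x \<in> coupled j"
    obtain m l where ml: "x = (m, l)" by (cases x)
    have mlN: "m < N" "l < N" "m < l" using x j by (auto simp: coupled_def ml)
    have c0: "0 < inverse (lam l - lam m)" using lam_less[OF mlN(3,2)] by simp
    define f where "f = (\<lambda>\<tau>. ennreal ((cmod (V \<tau> m l))\<^sup>2))"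
    have fm: "(\<lambda>\<tau>. f \<tau> * indicator {0..} \<tau>) \<in> borel_measurable lebesgue"
      unfolding f_def by (intro square_measurable meas mlN)
    have "ennreal (inverse (lam l - lam m)) * (\<integral>\<^sup>+\<tau>\<in>{0..}. f \<tau> \<partial>lebesgue) \<le> tail_action j 0"
      unfolding tail_action_def f_def
          using member_le_sum[OF x _ finite_coupled, of "\<lambda>x. case x of (m, l) \<Rightarrow> ennreal (inverse (lam l - lam m)) * (\<integral>\<^sup>+\<tau>\<in>{0..}. ennreal ((cmod (V \<tau> m l))\<^sup>2) \<partial>lebesgue)"]
      by (simp add: ml)
    then have "ennreal (inverse (lam l - lam m)) * (\<integral>\<^sup>+\<tau>\<in>{0..}. f \<tau> \<partial>lebesgue) < \<infinity>"
      using fin by (rule le_less_trans)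
    then have "(\<integral>\<^sup>+\<tau>\<in>{0..}. f \<tau> \<partial>lebesgue) < \<infinity>"
      using c0 by (auto simp: ennreal_mult_less_top)
    from nn_integral_tail_tendsto_0[OF fm this]
    have "((\<lambda>T. ennreal (inverse (lam l - lam m))
        * (\<integral>\<^sup>+\<tau>\<in>{T..}. f \<tau> \<partial>lebesgue)) \<longlongrightarrow> ennreal (inverse (lam l - lam m)) * 0) at_top"
      by (intro ennreal_tendsto_cmult) auto
    then show "((\<lambda>T. case x of (m, l) \<Rightarrow> ennreal (inverse (lam l - lam m))
        * (\<integral>\<^sup>+\<tau>\<in>{T..}. ennreal ((cmod (V \<tau> m l))\<^sup>2) \<partial>lebesgue)) \<longlongrightarrow> 0) at_top"
      by (simp add: ml f_def)
  qed
  then have "((\<lambda>T. ennreal c * tail_action j T) \<longlongrightarrow> ennreal c * 0) at_top"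
    by (intro ennreal_tendsto_cmult) auto
  then show ?thesis by simp
qed

section \<open>Systems with a locally square integrable potential\<close>

text \<open>
  Local square integrability of the norm gives local integrability of each entry because
  \<open>r \<le> 1 + r\<^sup>2\<close>.
\<close>

lemma matrix_system_of_potential:
  assumes N: "N \<ge> 3" and sp: "spectrum_ok N lam" and pot: "potential N V"
      and sol: "fundamental_solution N lam V X"
  shows "matrix_system N (\<lambda>p. lam (Suc p)) (\<lambda>s p q. V s (Suc p) (Suc q)) (\<lambda>t k p q. X t k (Suc p) (Suc q))"
proof -
  have mono: "strict_mono_on {1..N} lam" and lam1: "lam 1 = 0" using sp by (auto simp: spectrum_ok_def)
  have sq: "integrable_to t (\<lambda>s. (cmod (V s m l))\<^sup>2) \<and> integrable_to t (\<lambda>s. V s m l)"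
    if t: "0 \<le> t" and ml: "m \<in> {1..N}" "l \<in> {1..N}" for t m l
  proof -
    have nrm: "integrable_to t (\<lambda>s. (matrix_norm N (V s))\<^sup>2)" using pot t unfolding potential_def by blast
    have "set_borel_measurable lebesgue {0..} (\<lambda>s. V s m l)" using pot ml unfolding potential_def by blast
    then have m: "set_borel_measurable lebesgue {0..t} (\<lambda>s. V s m l)"
      by (rule set_borel_measurable_subset) (auto intro: sets_completionI_sets)
    have m2: "set_borel_measurable lebesgue {0..t} (\<lambda>s. (cmod (V s m l))\<^sup>2)"
    proof -
      have "(\<lambda>s. (cmod (indicator {0..t} s *\<^sub>R V s m l))\<^sup>2) \<in> borel_measurable lebesgue"
        using m unfolding set_borel_measurable_def by measurable
      moreover have "(\<lambda>s. (cmod (indicator {0..t} s *\<^sub>R V s m l))\<^sup>2) = (\<lambda>s. indicator {0..t} s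
          *\<^sub>R (cmod (V s m l))\<^sup>2)"
        by (auto simp: indicator_def)
      ultimately show ?thesis by (simp add: set_borel_measurable_def)
    qed
    have 1: "integrable_to t (\<lambda>s. (cmod (V s m l))\<^sup>2)"
    proof (rule set_integrable_bound[OF nrm m2], rule AE_I2, rule impI)
      fix s
      have "(cmod (V s m l))\<^sup>2 \<le> (\<Sum>(m, l)\<in>{1..N} \<times> {1..N}. (cmod (V s m l))\<^sup>2)"
        using member_le_sum[of "(m, l)" "{1..N} \<times> {1..N}" "\<lambda>(m, l). (cmod (V s m l))\<^sup>2"] ml by auto
      also have "\<dots> = (matrix_norm N (V s))\<^sup>2"
        by (simp add: matrix_norm_def L2_set_def sum_nonneg split_beta)
      finally show "norm ((cmod (V s m l))\<^sup>2) \<le> norm ((matrix_norm N (V s))\<^sup>2)" by simp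
    qed
    have "integrable_to t (\<lambda>s. 1 + (cmod (V s m l))\<^sup>2)"
    proof (rule set_integral_add(1)[OF _ 1])
      show "integrable_to t (\<lambda>s. 1::real)"
        unfolding set_integrable_def by (intro integrable_scaleR_left integrable_real_indicator)
            (auto simp: emeasure_lborel_Icc_eq)
    qed
    then have "integrable_to t (\<lambda>s. V s m l)"
    proof (rule set_integrable_bound)
      show "set_borel_measurable lebesgue {0..t} (\<lambda>s. V s m l)" by (rule m)
      show "AE s in lebesgue. s \<in> {0..t} \<longrightarrow> norm (V s m l) \<le> norm (1 + (cmod (V s m l))\<^sup>2)"
      proof (rule AE_I2, rule impI)
        fix s
        have "0 \<le> (cmod (V s m l) - 1)\<^sup>2 + (cmod (V s m l))\<^sup>2 + 1" by simp
        then have "cmod (V s m l) \<le> 1 + (cmod (V s m l))\<^sup>2" by (simp add: power2_eq_square algebra_simps)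
        then show "norm (V s m l) \<le> norm (1 + (cmod (V s m l))\<^sup>2)" by simp
      qed
    qed
    with 1 show ?thesis by blast
  qed
  show ?thesis
  proof
    fix p assume p: "p < N"
    show "0 \<le> lam (Suc p)"
      using strict_mono_onD[OF mono, of 1 "Suc p"] p lam1 by (cases "p = 0") (auto simp: less_imp_le)
  next
    fix p q assume "p < q" "q < N"
    then show "lam (Suc p) < lam (Suc q)" by (intro strict_mono_onD[OF mono]) auto
  next
    fix t :: real and p q assume a: "0 \<le> t" "p < N" "q < N"
    show "V t (Suc p) (Suc q) = cnj (V t (Suc q) (Suc p))"
    proof -
      have H: "V t m l = cnj (V t l m)" if "m \<in> {1..N}" "l \<in> {1..N}" for m l
        using pot a(1) that unfolding potential_def by blast
      show ?thesis using a by (intro H) auto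
    qed
    show "integrable_to t (\<lambda>s. V s (Suc p) (Suc q))" "integrable_to t (\<lambda>s. (cmod (V s (Suc p) (Suc q)))\<^sup>2)"
      using sq[OF a(1), of "Suc p" "Suc q"] a by auto
  next
    fix t :: real and p assume a: "0 \<le> t" "p < N"
    have "Suc p \<in> {1..N}" using a by simp
    then show "V t (Suc p) (Suc p) = 0" using pot a(1) unfolding potential_def by blast
  next
    fix p q k assume a: "p < N" "q < N"
    define d :: complex where "d = (if p = q then 1 else 0)"
    define r where "r = (\<lambda>s. ode_rhs N lam V k s (X s k) (Suc p) (Suc q))"
    have X: "integrable_to t r \<and> X t k (Suc p) (Suc q) = d + integral_to t r" if "0 \<le> t" for t
    proof -
      have "Suc p \<in> {1..N}" "Suc q \<in> {1..N}" using a by auto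
      then have "integrable_to t r \<and>
          X t k (Suc p) (Suc q) = (if Suc p = Suc q then 1 else 0) + integral_to t r"
        using sol that unfolding fundamental_solution_def r_def by blast
      then show ?thesis by (simp only: d_def nat.inject)
    qed
    have pr: "is_primitive (\<lambda>t. d + integral_to t r) r"
      using X by (intro is_primitive_integral) blast
    have "d + integral_to 0 r = d"
      using is_primitiveD(2)[OF pr, of 0] by simp
    then show "X 0 k (Suc p) (Suc q) = (if p = q then 1 else 0)" using X[of 0] by (simp add: d_def)
    show "is_primitive (\<lambda>t. X t k (Suc p) (Suc q))
        (\<lambda>s. \<i> * (of_real (k * lam (Suc p)) * X s k (Suc p) (Suc q) +
            (\<Sum>r\<in>{0..<N}. V s (Suc p) (Suc r) * X s k (Suc r) (Suc q))))"
    proof (rule is_primitive_cong[OF pr])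
      show "d + integral_to t r = X t k (Suc p) (Suc q)" if "0 \<le> t" for t using X[OF that] by simp
      fix s
      have "(\<Sum>m\<in>{1..N}. (of_real k * (if Suc p = m then of_real (lam (Suc p)) else 0)
          + V s (Suc p) m) * X s k m (Suc q))
         = (\<Sum>m\<in>{1..N}. if Suc p = m then of_real (k * lam (Suc p)) * X s k m (Suc q) else 0) +
             (\<Sum>m\<in>{1..N}. V s (Suc p) m * X s k m (Suc q))"
        unfolding sum.distrib[symmetric] by (intro sum.cong refl) (auto simp: algebra_simps)
      also have "(\<Sum>m\<in>{1..N}. if Suc p = m then of_real (k * lam (Suc p)) * X s k m (Suc q) else 0)
          = of_real (k * lam (Suc p)) * X s k (Suc p) (Suc q)"
        using a by simp
      also have "(\<Sum>m\<in>{1..N}. V s (Suc p) m * X s k m (Suc q)) = (\<Sum>m\<in>{0..<N}. V s (Suc p) (Suc m)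
          * X s k (Suc m) (Suc q))"
        by (rule sum.reindex_bij_witness[of _ Suc "\<lambda>m. m - 1"]) auto
      finally show "r s = \<i> * (of_real (k * lam (Suc p)) * X s k (Suc p) (Suc q) +
          (\<Sum>r\<in>{0..<N}. V s (Suc p) (Suc r) * X s k (Suc r) (Suc q)))"
        unfolding r_def ode_rhs_def by simp
    qed
  qed
qed

theorem theorem3p2:
  shows "\<exists>C::real. C > 0 \<and>
    (\<forall>(N::nat) (lam :: nat \<Rightarrow> real) (V :: real \<Rightarrow> cmatrix) (X :: real \<Rightarrow> real \<Rightarrow> cmatrix) (j::nat).
      N \<ge> 3 \<longrightarrow> spectrum_ok N lam \<longrightarrow> potential N V \<longrightarrow> fundamental_solution N lam V X \<longrightarrow>
      1 < j \<longrightarrow> j < N \<longrightarrow> I_prime N lam j V < \<infinity> \<longrightarrow>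
        (\<forall>t\<ge>0. (\<lambda>k. X t k j j) \<in> borel_measurable lebesgue \<and>
          (\<integral>\<^sup>+k. ennreal ((cmod (X t k j j - exp (\<i> * complex_of_real (lam j * t * k))))\<^sup>2) \<partial>lebesgue)
            \<le> ennreal C * I_prime N lam j V) \<and>
        (\<exists>x_inf :: real \<Rightarrow> complex. x_inf \<in> borel_measurable lebesgue \<and>
          ((\<lambda>t. \<integral>\<^sup>+k. ennreal ((cmod (X t k j j * exp (- \<i> * complex_of_real (lam j * t * k)) - x_inf k))\<^sup>2)
              \<partial>lebesgue) \<longlongrightarrow> 0) at_top \<and>
          (\<integral>\<^sup>+k. ennreal ((cmod (x_inf k - 1))\<^sup>2) \<partial>lebesgue) \<le> ennreal C * I_prime N lam j V))"
proof (intro exI[of _ "24 * pi"] conjI allI impI)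
  show "0 < 24 * pi" by simp
next
  fix N :: nat and lam :: "nat \<Rightarrow> real" and V :: "real \<Rightarrow> cmatrix" and X :: "real \<Rightarrow> real \<Rightarrow> cmatrix"
      and j :: nat
  assume N: "N \<ge> 3" and sp: "spectrum_ok N lam" and pot: "potential N V"
      and sol: "fundamental_solution N lam V X"
    and j: "1 < j" "j < N" and fin: "I_prime N lam j V < \<infinity>"
  define i where "i = j - 1"
  have i: "j = Suc i" "Suc i < N" using j by (auto simp: i_def)
  interpret M: matrix_system N "\<lambda>p. lam (Suc p)" "\<lambda>s p q. V s (Suc p) (Suc q)" "\<lambda>t k p q. X t k (Suc p) (Suc q)"
    by (rule matrix_system_of_potential[OF N sp pot sol])
  have I: "M.tail_action i 0 = I_prime N lam j V"
  proof -
    have "I_prime N lam j V = (\<Sum>(m, l)\<in>Sigma {1..j}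
        (\<lambda>m. {l\<in>{j..N}. (m, l) \<noteq> (j, j)}). ennreal (inverse \<bar>lam l - lam m\<bar>) *
        (\<integral>\<^sup>+\<tau>\<in>{0..}. ennreal ((cmod (V \<tau> m l))\<^sup>2) \<partial>lebesgue))"
      unfolding I_prime_def by (rule sum.Sigma) auto
    also have "\<dots> = M.tail_action i 0"
      unfolding M.tail_action_def
    proof (rule sum.reindex_bij_witness[of _ "\<lambda>(m, l). (Suc m, Suc l)" "\<lambda>(m, l). (m - 1, l - 1)"])
      fix x assume "x \<in> Sigma {1..j} (\<lambda>m. {l\<in>{j..N}. (m, l) \<noteq> (j, j)})"
      then obtain m l where x: "x = (Suc m, Suc l)" "m \<le> i" "i \<le> l" "l < N" "(m, l) \<noteq> (i, i)"
        using i by (cases x, case_tac a; case_tac b) auto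
      then have "lam (Suc m) < lam (Suc l)" by (intro M.lam_less) auto
      then show "(case case x of (m, l) \<Rightarrow> (m - 1, l - 1) of (m, l) \<Rightarrow> ennreal (inverse (lam (Suc l)
          - lam (Suc m))) *
          (\<integral>\<^sup>+\<tau>\<in>{0..}. ennreal ((cmod (V \<tau> (Suc m) (Suc l)))\<^sup>2) \<partial>lebesgue)) =
        (case x of (m, l) \<Rightarrow> ennreal (inverse \<bar>lam l - lam m\<bar>)
            * (\<integral>\<^sup>+\<tau>\<in>{0..}. ennreal ((cmod (V \<tau> m l))\<^sup>2) \<partial>lebesgue))"
        by (simp add: x(1))
    qed (use i in \<open>auto simp: M.coupled_def\<close>)
    finally show ?thesis by simp
  qed
  have meas: "set_borel_measurable lebesgue {0..} (\<lambda>s. V s (Suc m) (Suc l))" if "m < N" "l < N" for m l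
  proof -
    have "Suc m \<in> {1..N}" "Suc l \<in> {1..N}" using that by auto
    then show ?thesis using pot unfolding potential_def by blast
  qed
  have iN: "i < N" using i by simp
  have diag: "M.diag i t k = X t k j j * exp (- \<i> * complex_of_real (lam j * t * k))" for t k
    by (simp add: M.diag_def i(1))
  {
    fix t :: real assume t: "0 \<le> t"
    have "continuous_on UNIV (\<lambda>k. X t k j j)" using M.X_continuous[OF iN iN t] by (simp add: i(1))
    then show "(\<lambda>k. X t k j j) \<in> borel_measurable lebesgue" by (rule continuous_imp_lebesgue_measurable)
    have "cmod (X t k j j - exp (\<i> * complex_of_real (lam j * t * k))) = cmod (M.diag i t k - 1)" for k
    proof -
      have "exp (- \<i> * complex_of_real (lam j * t * k)) * exp (\<i> * complex_of_real (lam j * t * k)) = 1"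
        by (simp add: exp_minus)
      then have "M.diag i t k - 1 = exp (- \<i> * complex_of_real (lam j * t * k)) * (X t k j j
          - exp (\<i> * complex_of_real (lam j * t * k)))"
        unfolding diag right_diff_distrib by (simp only: mult.commute)
      then show ?thesis by (simp add: norm_mult)
    qed
    then show "L2sq (\<lambda>k. X t k j j - exp (\<i> * complex_of_real (lam j * t * k)))
       \<le> ennreal (24 * pi) * I_prime N lam j V"
      using M.diag_bounds(1)[OF i(2) t] by (simp only: I)
  }
  show "\<exists>x_inf :: real \<Rightarrow> complex. x_inf \<in> borel_measurable lebesgue \<and>
      ((\<lambda>t. \<integral>\<^sup>+k. ennreal ((cmod (X t k j j * exp (- \<i> * complex_of_real (lam j * t * k)) - x_inf k))\<^sup>2)
          \<partial>lebesgue) \<longlongrightarrow> 0) at_top \<and>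
      L2sq (\<lambda>k. x_inf k - 1) \<le> ennreal (24 * pi) * I_prime N lam j V"
    unfolding diag[symmetric] I[symmetric]
  proof (rule L2_Cauchy_limit)
    show "M.diag i t \<in> borel_measurable lebesgue" if "0 \<le> t" for t
      by (rule continuous_imp_lebesgue_measurable[OF M.diag_continuous[OF iN that]])
    show "L2sq (\<lambda>k. M.diag i t k - M.diag i T k) \<le> ennreal (80 * pi) * M.tail_action i T"
      if "0 \<le> T" "T \<le> t" for T t
      by (rule M.diag_increment[OF i(2) that meas])
    show "((\<lambda>T. ennreal (80 * pi) * M.tail_action i T) \<longlongrightarrow> 0) at_top"
      using fin by (intro M.tail_action_tendsto_0 iN meas) (simp_all add: I)
    show "L2sq (\<lambda>k. M.diag i t k - 1) \<le> ennreal (24 * pi) * M.tail_action i 0" if "0 \<le> t" for t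
      by (rule M.diag_bounds(1)[OF i(2) that])
  qed
qed

end
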